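(* Consider the model in which one observes $Y=(Y_1,Y_2,\dots)$ with $Y_i=\kappa_i\mu_{0,i}+n^{-1/2}Z_i$, $i\ge1$, where $Z_1,Z_2,\dots$ are i.i.d. standard normal, $\mu_0\in\ell_2$, and $(\kappa_i)$ is a known sequence with $C^{-1}i^{-p}\le\kappa_i\le Ci^{-p}$ for some $p\ge0$, $C\ge1$. Define \[ \ell_n(\alpha)=-\frac12\sum_{i=1}^\infty\Big(\log\Big(1+\frac{n}{i^{1+2\alpha}\kappa_i^{-2}}\Big)-\frac{n^2}{i^{1+2\alpha}\kappa_i^{-2}+n}Y_i^2\Big), \] and, with $h_n$ defined by \[ h_n(\alpha)=\frac{1+2\alpha+2p}{n^{1/(1+2\alpha+2p)}\log n}\sum_{i=1}^{\infty}\frac{n^2 i^{1+2\alpha}\mu_{0,i}^2\log i}{(i^{1+2\alpha}\kappa_i^{-2}+n)^2}, \] set $\underline{\alpha}_n=\inf\{\alpha>0:h_n(\alpha)>l\}\wedge\sqrt{\log n}$ and $\overline{\alpha}_n=\inf\{\alpha>0:h_n(\alpha)>L(\log n)^2\}$ for constants $0<l<L$. Let $\beta>0$, $\gamma>0$. Then for every $R>0$ the constants $l$ and $L$ can be chosen such that \[ \inf_{\mu_0\in\mathcal{B}(R)}\mathrm{P}_0\Big(\operatorname*{argmax}_{\alpha\in[0,\log n]}\ell_n(\alpha)\in[\underline{\alpha}_n,\overline{\alpha}_n]\Big)\to 1\quad(n\to\infty), \] where either $\mathcal{B}(R)=\{\mu_0\in\ell_2:\|\mu_0\|_\beta\le R\}$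 or $\mathcal{B}(R)=\{\mu_0\in\ell_2:\|\mu_0\|_{A^\gamma}\le R\}$.
   Context: $\mathrm{P}_0$ denotes the law of $Y$ under the true parameter $\mu_0$. $\ell_n$ is the marginal log-likelihood of $\alpha$ (relative to an infinite product of $N(0,1/n)$ laws) when $\mu\sim\bigotimes_i N(0,i^{-1-2\alpha})$; it is a.s. continuous on $[0,\log n]$ and the argmax is any maximizer (if not unique, any value may be chosen). Sobolev norm $\|\mu\|_\beta^2=\sum_i i^{2\beta}\mu_i^2$, analytic norm $\|\mu\|_{A^\gamma}^2=\sum_i e^{2\gamma i}\mu_i^2$. Infimum of the empty set is $+\infty$. *)

theory Defs
  imports "HOL-Probability.Probability"
begin

text \<open>Conventions: sequences are functions nat => real; only indices i >= 1 are
meaningful (index 0 is ignored). Series over i >= 1 are written as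
suminf over k with i = Suc k.\<close>

text \<open>Law P_0 of Y = (Y_i): independent, Y_i ~ N(kappa_i mu_{0,i}, 1/n)
(standard deviation n^(-1/2)). The coordinate 0 is a dummy.\<close>
definition P0 :: "nat \<Rightarrow> (nat \<Rightarrow> real) \<Rightarrow> (nat \<Rightarrow> real) \<Rightarrow> (nat \<Rightarrow> real) measure" where
  "P0 n \<kappa> \<mu> = (\<Pi>\<^sub>M i\<in>UNIV. density lborel (normal_density (\<kappa> i * \<mu> i) (1 / sqrt (real n))))"

definition ell :: "nat \<Rightarrow> (nat \<Rightarrow> real) \<Rightarrow> (nat \<Rightarrow> real) \<Rightarrow> real \<Rightarrow> real" where
  "ell n \<kappa> Y \<alpha> = - 1/2 * (\<Sum>k. let i = real (Suc k) in
       ln (1 + real n / (i powr (1 + 2*\<alpha>) * inverse (\<kappa> (Suc k)) ^ 2))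
       - (real n)^2 / (i powr (1 + 2*\<alpha>) * inverse (\<kappa> (Suc k)) ^ 2 + real n) * (Y (Suc k))^2)"

definition hn :: "nat \<Rightarrow> real \<Rightarrow> (nat \<Rightarrow> real) \<Rightarrow> (nat \<Rightarrow> real) \<Rightarrow> real \<Rightarrow> real" where
  "hn n p \<kappa> \<mu> \<alpha> = (1 + 2*\<alpha> + 2*p) / (real n powr (1 / (1 + 2*\<alpha> + 2*p)) * ln (real n)) *
     (\<Sum>k. let i = real (Suc k) in
       (real n)^2 * i powr (1 + 2*\<alpha>) * (\<mu> (Suc k))^2 * ln i
       / (i powr (1 + 2*\<alpha>) * inverse (\<kappa> (Suc k)) ^ 2 + real n)^2)"

text \<open>Lower and upper bounds (values in ereal; Inf of the empty set is +infinity).\<close>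
definition alpha_low :: "nat \<Rightarrow> real \<Rightarrow> (nat \<Rightarrow> real) \<Rightarrow> (nat \<Rightarrow> real) \<Rightarrow> real \<Rightarrow> ereal" where
  "alpha_low n p \<kappa> \<mu> l =
     min (Inf (ereal ` {\<alpha>. \<alpha> > 0 \<and> hn n p \<kappa> \<mu> \<alpha> > l})) (ereal (sqrt (ln (real n))))"

definition alpha_up :: "nat \<Rightarrow> real \<Rightarrow> (nat \<Rightarrow> real) \<Rightarrow> (nat \<Rightarrow> real) \<Rightarrow> real \<Rightarrow> ereal" where
  "alpha_up n p \<kappa> \<mu> L = Inf (ereal ` {\<alpha>. \<alpha> > 0 \<and> hn n p \<kappa> \<mu> \<alpha> > L * (ln (real n))^2})"

definition is_argmax_ell :: "nat \<Rightarrow> (nat \<Rightarrow> real) \<Rightarrow> (nat \<Rightarrow> real) \<Rightarrow> real \<Rightarrow> bool" where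
  "is_argmax_ell n \<kappa> Y a \<longleftrightarrow> a \<in> {0..ln (real n)} \<and>
     (\<forall>b\<in>{0..ln (real n)}. ell n \<kappa> Y b \<le> ell n \<kappa> Y a)"

text \<open>Event: the argmax exists and every maximiser (hence any chosen one) lies
in [alpha_low, alpha_up].\<close>
definition good_event :: "nat \<Rightarrow> real \<Rightarrow> (nat \<Rightarrow> real) \<Rightarrow> (nat \<Rightarrow> real) \<Rightarrow> real \<Rightarrow> real \<Rightarrow> (nat \<Rightarrow> real) set" where
  "good_event n p \<kappa> \<mu> l L = {Y. (\<exists>a. is_argmax_ell n \<kappa> Y a) \<and>
     (\<forall>a. is_argmax_ell n \<kappa> Y a \<longrightarrow>
        alpha_low n p \<kappa> \<mu> l \<le> ereal a \<and> ereal a \<le> alpha_up n p \<kappa> \<mu> L)}"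

text \<open>inf over mu in B of P_0(event) tends to 1, with P_0(event) read as inner
probability (so that no measurability issue arises).\<close>
definition unif_prob_to_one ::
  "real \<Rightarrow> (nat \<Rightarrow> real) \<Rightarrow> (nat \<Rightarrow> real) set \<Rightarrow> real \<Rightarrow> real \<Rightarrow> bool" where
  "unif_prob_to_one p \<kappa> B l L \<longleftrightarrow>
     (\<forall>\<epsilon>>0. \<exists>N. \<forall>n\<ge>N. \<forall>\<mu>\<in>B. \<exists>A\<in>sets (P0 n \<kappa> \<mu>).
        A \<subseteq> good_event n p \<kappa> \<mu> l L \<and> measure (P0 n \<kappa> \<mu>) A \<ge> 1 - \<epsilon>)"

definition l2 :: "(nat \<Rightarrow> real) set" where
  "l2 = {\<mu>. summable (\<lambda>k. (\<mu> (Suc k))^2)}"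

definition sobolev_ball :: "real \<Rightarrow> real \<Rightarrow> (nat \<Rightarrow> real) set" where
  "sobolev_ball \<beta> R = {\<mu>\<in>l2. summable (\<lambda>k. real (Suc k) powr (2*\<beta>) * (\<mu> (Suc k))^2) \<and>
      sqrt (\<Sum>k. real (Suc k) powr (2*\<beta>) * (\<mu> (Suc k))^2) \<le> R}"

definition analytic_ball :: "real \<Rightarrow> real \<Rightarrow> (nat \<Rightarrow> real) set" where
  "analytic_ball \<gamma> R = {\<mu>\<in>l2. summable (\<lambda>k. exp (2*\<gamma>*real (Suc k)) * (\<mu> (Suc k))^2) \<and>
      sqrt (\<Sum>k. exp (2*\<gamma>*real (Suc k)) * (\<mu> (Suc k))^2) \<le> R}"

end

theory Submission
  imports Defs "HOL-Real_Asymp.Real_Asymp"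
begin

text \<open>
  With \<open>u = n / (w + n)\<close> and \<open>w = i powr (1 + 2 * \<alpha>) / \<kappa>\<^sup>2\<close>, the log-likelihood is minus one half of the
  sum of \<open>- ln (1 - u) - u * n * Y\<^sup>2\<close>, and \<open>u\<close> decreases in \<open>\<alpha>\<close>. Because of this monotonicity a comparison
  of two values of the likelihood that is needed for all \<open>\<alpha>\<close> in a short interval reduces to its end
  points, so only finitely many sums of centred chi-square type variables have to be controlled, and
  Chebyshev's inequality together with a union bound suffices.

  Below the lower bound the signal is small compared with the mean gain of the likelihood (of order
  \<open>N / s\<close> when \<open>\<alpha>\<close> grows by \<open>1 / ln n\<close>, with \<open>s = 1 + 2 * \<alpha> + 2 * p\<close> and \<open>N = n powr (1 / s)\<close>), hence every
  \<open>\<alpha>\<close> is beaten by a slightly larger value; a grid of mesh \<open>(ln n) powr (-3)\<close> is enough. Above the upper bound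
  the quadratic terms only decrease with \<open>\<alpha>\<close> and the logarithms contribute at most a multiple of
  \<open>N * ln n\<close>, which the signal lost between \<open>\<alpha> - 2 / ln n\<close> and \<open>\<alpha> - 1 / ln n\<close> exceeds if \<open>L\<close> is large.

  The series need not converge absolutely (take \<open>\<alpha> = p = 0\<close>). Grouping the indices into the blocks
  \<open>k ^ 5 \<le> i < (k + 1) ^ 5\<close> and freezing \<open>i powr (- 2 * \<alpha>)\<close> on each block gives convergence uniformly in \<open>\<alpha>\<close>,
  which also shows that the likelihood is continuous and that a maximiser exists. Analytic balls are
  contained in Sobolev balls of order one.
\<close>

section \<open>Chi-square type noise\<close>

text \<open>The cap \<open>sqrt (ln n)\<close> on the lower bound is what makes Chebyshev sufficient
  there. With T = ln n, \<open>expo\<close> is O(sqrt T) below the cap, so the effective dimension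
  is at least exp (sqrt T / q) for a constant q; this exceeds every power of T and pays for the
  whole grid. The mesh is dictated by the cost of moving the shrinkage factors to a grid point, mesh
  * T^2 * N up to constants, which for mesh T^-3 is N / T and stays below the gain N / s. Above the
  upper bound N may stay bounded, since \<alpha> can be as large as T, and a union over a grid is
  out of reach. There a single reference point beats all larger \<alpha> at once, and its noise is
  compared with the signal itself, which is at least of order T. The factor (ln n)^2 pays for the
  logarithms and for \<open>expo\<close> being of order T. The comparisons only involve finite sums:
  the series is cut at i = n^20, and on an event that does not involve \<alpha> the discarded tail
  is at most 1 for large n. All estimates hold for fixed n with constants free of \<mu>, which
  yields uniformity over the ball.\<close>

definition noise :: "nat \<Rightarrow> (nat \<Rightarrow> real) \<Rightarrow> (nat \<Rightarrow> real) \<Rightarrow> (nat \<Rightarrow> real) \<Rightarrow> nat \<Rightarrow> real" where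
  "noise n \<kappa> \<mu> Y i = real n * (Y i)\<^sup>2 - 1 - real n * (\<kappa> i * \<mu> i)\<^sup>2"

text \<open>Independence is tested by comparing the joint law with the product of the marginals.
  Restriction to \<open>I\<close> is the identity on extensional functions, so both are
  \<open>PiM I M\<close>.\<close>

lemma (in product_prob_space) indep_vars_component:
  assumes "I \<noteq> {}"
  shows "P.indep_vars M (\<lambda>i \<omega>. \<omega> i) I"
proof -
  have "distr (PiM I M) (PiM I M) (\<lambda>x. \<lambda>i\<in>I. x i) = distr (PiM I M) (PiM I M) (\<lambda>x. x)"
    by (intro distr_cong) (auto simp: space_PiM PiE_def extensional_restrict)
  also have "\<dots> = PiM I M"
    by (rule distr_id2) simp
  also have "\<dots> = PiM I (\<lambda>i. distr (PiM I M) (M i) (\<lambda>\<omega>. \<omega> i))"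
    by (intro PiM_cong) (simp_all add: PiM_component)
  finally show ?thesis
    using assms by (subst P.indep_vars_iff_distr_eq_PiM') auto
qed

text \<open>The off-diagonal terms of the expanded square vanish by independence and centring.
  Independence also supplies the integrability of the mixed products, so second moments enter only
  on the diagonal.\<close>

lemma (in prob_space) expectation_square_sum_indep:
  fixes X :: "'b \<Rightarrow> 'a \<Rightarrow> real"
  assumes "finite S" and indep: "indep_vars (\<lambda>_. borel) X S"
    and int: "\<And>i. i \<in> S \<Longrightarrow> integrable M (X i)"
    and zero: "\<And>i. i \<in> S \<Longrightarrow> expectation (X i) = 0"
    and sq: "\<And>i. i \<in> S \<Longrightarrow> integrable M (\<lambda>x. (X i x)\<^sup>2)"
  shows "integrable M (\<lambda>x. (\<Sum>i\<in>S. c i * X i x)\<^sup>2)" (is ?int)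
    and "expectation (\<lambda>x. (\<Sum>i\<in>S. c i * X i x)\<^sup>2) = (\<Sum>i\<in>S. (c i)\<^sup>2 * expectation (\<lambda>x. (X i x)\<^sup>2))" (is ?eq)
proof -
  have prod: "integrable M (\<lambda>x. X i x * X j x) \<and>
      expectation (\<lambda>x. X i x * X j x) = (if i = j then expectation (\<lambda>x. (X i x)\<^sup>2) else 0)"
    if ij: "i \<in> S" "j \<in> S" for i j
  proof (cases "i = j")
    case True
    then show ?thesis using sq[OF ij(1)] by (simp add: power2_eq_square)
  next
    case False
    have "indep_vars (\<lambda>_. borel) X {i, j}"
      using ij by (intro indep_vars_subset[OF indep]) auto
    note this' = indep_vars_lebesgue_integral[OF _ this] indep_vars_integrable[OF _ this]
    have "(\<lambda>x. \<Prod>k\<in>{i, j}. X k x) = (\<lambda>x. X i x * X j x)"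
      using False by simp
    then show ?thesis
      using this' int ij zero False by auto
  qed
  have expand: "(\<lambda>x. (\<Sum>i\<in>S. c i * X i x)\<^sup>2) = (\<lambda>x. \<Sum>i\<in>S. \<Sum>j\<in>S. (c i * c j) * (X i x * X j x))"
    by (auto simp: power2_eq_square sum_product algebra_simps fun_eq_iff)
  show ?int
    unfolding expand using prod
    by (intro Bochner_Integration.integrable_sum integrable_mult_right) blast
  let ?t = "\<lambda>i j x. (c i * c j) * (X i x * X j x)"
  have t_int: "integrable M (?t i j)" if "i \<in> S" "j \<in> S" for i j
    using prod[OF that] by (intro integrable_mult_right) blast
  have t_eq: "expectation (?t i j) = (if i = j then (c i)\<^sup>2 * expectation (\<lambda>x. (X i x)\<^sup>2) else 0)"
    if "i \<in> S" "j \<in> S" for i j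
    unfolding integral_mult_right_zero conjunct2[OF prod[OF that]]
    by (simp add: power2_eq_square[of "c _"])
  have "expectation (\<lambda>x. \<Sum>i\<in>S. \<Sum>j\<in>S. ?t i j x) = (\<Sum>i\<in>S. expectation (\<lambda>x. \<Sum>j\<in>S. ?t i j x))"
    by (intro Bochner_Integration.integral_sum Bochner_Integration.integrable_sum t_int)
  also have "\<dots> = (\<Sum>i\<in>S. \<Sum>j\<in>S. expectation (?t i j))"
    by (intro sum.cong refl Bochner_Integration.integral_sum t_int)
  also have "\<dots> = (\<Sum>i\<in>S. \<Sum>j\<in>S. if i = j then (c i)\<^sup>2 * expectation (\<lambda>x. (X i x)\<^sup>2) else 0)"
    by (intro sum.cong refl t_eq)
  also have "\<dots> = (\<Sum>i\<in>S. (c i)\<^sup>2 * expectation (\<lambda>x. (X i x)\<^sup>2))"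
    using \<open>finite S\<close> by simp
  finally show ?eq unfolding expand .
qed

text \<open>These are the mean and variance of a noncentral chi-square variable with one degree of
  freedom. Expanding in powers of \<open>y - m\<close> reduces them to central normal moments of
  order at most 4.\<close>

lemma normal_square_moments:
  fixes m :: real and n :: nat
  assumes "n > 0"
  defines "D \<equiv> density lborel (normal_density m (1 / sqrt (real n)))"
    and "f \<equiv> \<lambda>y. real n * y\<^sup>2 - 1 - real n * m\<^sup>2"
  shows "integrable D f" "(\<integral>y. f y \<partial>D) = 0"
    and "integrable D (\<lambda>y. (f y)\<^sup>2)" "(\<integral>y. (f y)\<^sup>2 \<partial>D) = 2 + 4 * real n * m\<^sup>2"
proof -
  define s where "s = 1 / sqrt (real n)"
  have s: "s > 0" "s\<^sup>2 = 1 / real n" "s^4 = 1 / (real n)\<^sup>2"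
    using assms(1) by (auto simp: s_def power_divide power4_eq_xxxx power2_eq_square)
  let ?g = "\<lambda>k y. normal_density m s y * (y - m)^k"
  have m0: "has_bochner_integral lborel (?g 0) 1"
    using normal_moment_even[OF s(1), of m 0] by simp
  have m1: "has_bochner_integral lborel (?g 1) 0"
    using normal_moment_odd[OF s(1), of m 0] by simp
  have m2: "has_bochner_integral lborel (?g 2) (1 / real n)"
    using normal_moment_even[OF s(1), of m 1] s(2) by simp
  have m3: "has_bochner_integral lborel (?g 3) 0"
    using normal_moment_odd[OF s(1), of m 1] by (simp add: numeral_3_eq_3)
  have m4: "has_bochner_integral lborel (?g 4) (3 / (real n)\<^sup>2)"
    using normal_moment_even[OF s(1), of m 2] assms(1) unfolding s(2)
    by (simp add: fact_numeral power2_eq_square)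
  have f_exp: "f y = real n * (y - m)^2 + 2 * real n * m * (y - m)^1 - (y - m)^0" for y
    by (simp add: f_def power2_eq_square algebra_simps)
  have "has_bochner_integral lborel (\<lambda>y. real n * ?g 2 y + (2 * real n * m) * ?g 1 y - ?g 0 y)
      (real n * (1 / real n) + (2 * real n * m) * 0 - 1)"
    by (intro has_bochner_integral_add has_bochner_integral_diff has_bochner_integral_mult_right m0 m1 m2)
  also have "(\<lambda>y. real n * ?g 2 y + (2 * real n * m) * ?g 1 y - ?g 0 y) = (\<lambda>y. normal_density m s y *\<^sub>R f y)"
    by (auto simp: f_exp algebra_simps)
  finally have F: "has_bochner_integral D f 0"
    using assms(1) unfolding D_def s_def[symmetric]
    by (subst has_bochner_integral_density) (auto simp: f_def)
  have f2_exp: "(f y)\<^sup>2 = (real n)\<^sup>2 * (y - m)^4 + 4 * (real n)\<^sup>2 * m * (y - m)^3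
      + (4 * (real n)\<^sup>2 * m\<^sup>2 - 2 * real n) * (y - m)^2 - 4 * real n * m * (y - m)^1 + (y - m)^0" for y
    unfolding f_exp by (simp add: power2_eq_square power4_eq_xxxx power3_eq_cube algebra_simps)
  have "has_bochner_integral lborel (\<lambda>y. (real n)\<^sup>2 * ?g 4 y + (4 * (real n)\<^sup>2 * m) * ?g 3 y
      + (4 * (real n)\<^sup>2 * m\<^sup>2 - 2 * real n) * ?g 2 y - (4 * real n * m) * ?g 1 y + ?g 0 y)
      ((real n)\<^sup>2 * (3 / (real n)\<^sup>2) + (4 * (real n)\<^sup>2 * m) * 0
      + (4 * (real n)\<^sup>2 * m\<^sup>2 - 2 * real n) * (1 / real n) - (4 * real n * m) * 0 + 1)"
    by (intro has_bochner_integral_add has_bochner_integral_diff has_bochner_integral_mult_right m0 m1 m2 m3 m4)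
  also have "(\<lambda>y. (real n)\<^sup>2 * ?g 4 y + (4 * (real n)\<^sup>2 * m) * ?g 3 y
      + (4 * (real n)\<^sup>2 * m\<^sup>2 - 2 * real n) * ?g 2 y - (4 * real n * m) * ?g 1 y + ?g 0 y)
      = (\<lambda>y. normal_density m s y *\<^sub>R (f y)\<^sup>2)"
    unfolding f2_exp by (auto simp: algebra_simps)
  also have "(real n)\<^sup>2 * (3 / (real n)\<^sup>2) + (4 * (real n)\<^sup>2 * m) * 0
      + (4 * (real n)\<^sup>2 * m\<^sup>2 - 2 * real n) * (1 / real n) - (4 * real n * m) * 0 + 1 = 2 + 4 * real n * m\<^sup>2"
    using assms(1) by (simp add: field_simps power2_eq_square)
  finally have F2: "has_bochner_integral D (\<lambda>y. (f y)\<^sup>2) (2 + 4 * real n * m\<^sup>2)"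
    using assms(1) unfolding D_def s_def[symmetric]
    by (subst has_bochner_integral_density) (auto simp: f_def)
  show "integrable D f" "(\<integral>y. f y \<partial>D) = 0"
    using F by (auto simp: has_bochner_integral_iff)
  show "integrable D (\<lambda>y. (f y)\<^sup>2)" "(\<integral>y. (f y)\<^sup>2 \<partial>D) = 2 + 4 * real n * m\<^sup>2"
    using F2 by (auto simp: has_bochner_integral_iff)
qed

lemma prob_space_P0: "n > 0 \<Longrightarrow> prob_space (P0 n \<kappa> \<mu>)"
  unfolding P0_def by (intro prob_space_PiM prob_space_normal_density) simp

lemma measurable_noise_sum [measurable]:
  "(\<lambda>Y. \<Sum>i\<in>S. c i * noise n \<kappa> \<mu> Y i) \<in> borel_measurable (P0 n \<kappa> \<mu>)"
proof -
  have [measurable]: "(\<lambda>Y. Y i) \<in> borel_measurable (P0 n \<kappa> \<mu>)" for i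
    unfolding P0_def
    using measurable_component_singleton[of i UNIV "\<lambda>i. density lborel (normal_density (\<kappa> i * \<mu> i) (1 / sqrt (real n)))"]
    by simp
  show ?thesis
    unfolding noise_def by measurable
qed

lemma space_P0: "space (P0 n \<kappa> \<mu>) = UNIV"
  unfolding P0_def by (simp add: space_PiM PiE_def)

text \<open>Chebyshev's inequality, with the variance summed over independent coordinates. All later
  probability bounds are instances of this one, combined with union bounds.\<close>

lemma noise_sum_tail_prob:
  assumes "n > 0" "finite S" "t > 0"
  shows "measure (P0 n \<kappa> \<mu>) {Y. \<bar>\<Sum>i\<in>S. c i * noise n \<kappa> \<mu> Y i\<bar> \<ge> t}
     \<le> (\<Sum>i\<in>S. (c i)\<^sup>2 * (2 + 4 * real n * (\<kappa> i * \<mu> i)\<^sup>2)) / t\<^sup>2"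
proof -
  define D where "D = (\<lambda>i. density lborel (normal_density (\<kappa> i * \<mu> i) (1 / sqrt (real n))))"
  have P0: "P0 n \<kappa> \<mu> = PiM UNIV D"
    by (simp add: P0_def D_def)
  have ps: "prob_space (D i)" for i
    unfolding D_def using assms by (intro prob_space_normal_density) simp
  interpret product_prob_space D UNIV
    by (intro product_prob_spaceI ps)
  define f where "f = (\<lambda>i y. real n * y\<^sup>2 - 1 - real n * (\<kappa> i * \<mu> i)\<^sup>2)"
  have noise: "noise n \<kappa> \<mu> Y i = f i (Y i)" for Y i
    by (simp add: noise_def f_def)
  have mom: "integrable (D i) (f i)" "(\<integral>y. f i y \<partial>D i) = 0"
    "integrable (D i) (\<lambda>y. (f i y)\<^sup>2)" "(\<integral>y. (f i y)\<^sup>2 \<partial>D i) = 2 + 4 * real n * (\<kappa> i * \<mu> i)\<^sup>2" for i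
    using normal_square_moments[OF assms(1), of "\<kappa> i * \<mu> i"] unfolding D_def f_def by simp_all
  have f_meas: "f i \<in> borel_measurable (D i)" for i
    unfolding f_def D_def by measurable
  have comp: "integrable (PiM UNIV D) (\<lambda>Y. g (Y i)) \<longleftrightarrow> integrable (D i) g"
     "(\<integral>Y. g (Y i) \<partial>PiM UNIV D) = (\<integral>y. g y \<partial>D i)" if "g \<in> borel_measurable (D i)" for g :: "real \<Rightarrow> real" and i
    using that integrable_distr_eq[of "\<lambda>\<omega>. \<omega> i" "PiM UNIV D" "D i" g] integral_distr[of "\<lambda>\<omega>. \<omega> i" "PiM UNIV D" "D i" g]
    by (auto simp: PiM_component)
  have "P.indep_vars D (\<lambda>i \<omega>. \<omega> i) S"
    by (rule P.indep_vars_subset[OF indep_vars_component]) auto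
  then have indep: "P.indep_vars (\<lambda>_. borel) (\<lambda>i Y. f i (Y i)) S"
    using f_meas by (rule P.indep_vars_compose2)
  have sq: "f i \<in> borel_measurable (D i)" "(\<lambda>y. (f i y)\<^sup>2) \<in> borel_measurable (D i)" for i
    using f_meas by auto
  have comp_f: "integrable (PiM UNIV D) (\<lambda>Y. f i (Y i))" "(\<integral>Y. f i (Y i) \<partial>PiM UNIV D) = 0"
    "integrable (PiM UNIV D) (\<lambda>Y. (f i (Y i))\<^sup>2)"
    "(\<integral>Y. (f i (Y i))\<^sup>2 \<partial>PiM UNIV D) = 2 + 4 * real n * (\<kappa> i * \<mu> i)\<^sup>2" for i
    using comp[OF sq(1), of i] comp[OF sq(2), of i] mom[of i] by simp_all
  note E = P.expectation_square_sum_indep[OF assms(2) indep comp_f(1-3), of c, unfolded comp_f(4)]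
  have mean: "(\<integral>Y. (\<Sum>i\<in>S. c i * f i (Y i)) \<partial>PiM UNIV D) = 0"
    using comp_f(1,2) by (subst Bochner_Integration.integral_sum) auto
  have meas: "(\<lambda>Y. \<Sum>i\<in>S. c i * f i (Y i)) \<in> borel_measurable (PiM UNIV D)"
    using measurable_noise_sum[of c n \<kappa> \<mu> S] unfolding P0 noise .
  note cheb = P.Chebyshev_inequality[OF meas E(1) assms(3)]
  have "space (PiM UNIV D) = UNIV"
    using space_P0[of n \<kappa> \<mu>] unfolding P0 .
  then show ?thesis
    using cheb unfolding mean P0 noise E(2) diff_zero by simp
qed

section \<open>Shrinkage weights\<close>

lemma sum_inverse_le_ln:
  assumes "m \<ge> 1" shows "(\<Sum>i=1..m. 1 / real i) \<le> 1 + ln (real m)"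
  using assms
proof (induction m rule: nat_induct_at_least)
  case base
  then show ?case by simp
next
  case (Suc m)
  have "ln (real m / real (Suc m)) \<le> real m / real (Suc m) - 1"
    using Suc by (intro ln_le_minus_one) auto
  then have "1 / real (Suc m) \<le> ln (real (Suc m)) - ln (real m)"
    using Suc by (simp add: ln_div field_simps)
  then show ?case using Suc by simp
qed

lemma exp_minus_one_le: "exp t - 1 \<le> t * exp t" for t :: real
proof -
  have "exp t * (1 - exp (- t)) \<le> exp t * t"
    using exp_ge_add_one_self[of "- t"] by (intro mult_left_mono) auto
  moreover have "exp t * (1 - exp (- t)) = exp t - 1"
    by (simp add: right_diff_distrib exp_add[symmetric])
  ultimately show ?thesis by (simp add: mult.commute)
qed

text \<open>Here \<open>n\<close> is fixed, so every estimate is non-asymptotic. From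
  \<open>n \<ge> 3 > e\<close> comes \<open>T > 1\<close>, by which constants are absorbed into
  powers of \<open>T\<close>.\<close>

locale inverse_model =
  fixes \<kappa> :: "nat \<Rightarrow> real" and p C :: real and n :: nat
  assumes p_nonneg: "p \<ge> 0" and C_ge_1: "C \<ge> 1"
    and kappa: "\<And>i. i \<ge> 1 \<Longrightarrow> inverse C * real i powr (-p) \<le> \<kappa> i \<and> \<kappa> i \<le> C * real i powr (-p)"
    and n_ge_3: "n \<ge> 3"
begin

text \<open>
  \<open>dimn\<close> is the effective dimension: \<open>wt \<alpha> i\<close> is below or above \<open>n\<close>, up to the factor \<open>C\<^sup>2\<close>, according
  to whether \<open>i\<close> is below or above \<open>dimn \<alpha>\<close>. The function \<open>h\<^sub>n\<close> of the paper is
  \<open>expo / (dimn * ln n)\<close> times the sum of \<open>sig \<alpha> i * (\<mu> i)\<^sup>2\<close>.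
\<close>

definition expo :: "real \<Rightarrow> real" where "expo \<alpha> = 1 + 2 * \<alpha> + 2 * p"

definition dimn :: "real \<Rightarrow> real" where "dimn \<alpha> = real n powr (1 / expo \<alpha>)"

definition wt :: "real \<Rightarrow> nat \<Rightarrow> real" where
  "wt \<alpha> i = real i powr (1 + 2 * \<alpha>) * (inverse (\<kappa> i))\<^sup>2"

definition shr :: "real \<Rightarrow> nat \<Rightarrow> real" where "shr \<alpha> i = real n / (wt \<alpha> i + real n)"

definition lgt :: "real \<Rightarrow> nat \<Rightarrow> real" where "lgt \<alpha> i = ln (1 + real n / wt \<alpha> i)"

definition sig :: "real \<Rightarrow> nat \<Rightarrow> real" where
  "sig \<alpha> i = (real n)\<^sup>2 * real i powr (1 + 2 * \<alpha>) * ln (real i) / (wt \<alpha> i + real n)\<^sup>2"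

abbreviation "T \<equiv> ln (real n)"

lemma n_pos: "real n > 0" and T_gt_1: "T > 1"
proof -
  show "real n > 0" using n_ge_3 by simp
  have "exp 1 < (3::real)" using e_less_272 by simp
  also have "3 \<le> real n" using n_ge_3 by simp
  finally have "ln (exp 1) < T" using n_ge_3 by (subst ln_less_cancel_iff) auto
  then show "T > 1" by simp
qed

lemma C_pos: "C > 0" and C2_ge_1: "C\<^sup>2 \<ge> 1"
  using C_ge_1 by (auto simp: one_le_power)

lemma kappa_pos: "i \<ge> 1 \<Longrightarrow> \<kappa> i > 0"
  by (rule less_le_trans[of _ "inverse C * real i powr (-p)"]) (use kappa[of i] C_pos in auto)

lemma kappa_le: assumes "i \<ge> 1" shows "\<kappa> i \<le> C"
proof -
  have "real i powr (-p) \<le> real i powr 0"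
    using assms p_nonneg by (intro powr_mono) auto
  then have "C * real i powr (-p) \<le> C * 1" using assms C_pos by (intro mult_left_mono) auto
  then show ?thesis using kappa[OF assms] by simp
qed

lemma kappa_sq_le: "i \<ge> 1 \<Longrightarrow> (\<kappa> i)\<^sup>2 \<le> C\<^sup>2"
  using kappa_le kappa_pos by (intro power_mono) (auto intro: less_imp_le)

text \<open>Since \<open>\<kappa>\<close> enters \<open>wt\<close> squared, its decay contributes
  the \<open>2 * p\<close> in \<open>expo\<close> and its constant becomes
  \<open>C\<^sup>2\<close>.\<close>

lemma wt_bounds:
  assumes "i \<ge> 1"
  shows "real i powr expo \<alpha> / C\<^sup>2 \<le> wt \<alpha> i" "wt \<alpha> i \<le> C\<^sup>2 * real i powr expo \<alpha>"
proof -
  have i: "real i > 0" using assms by simp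
  have eq: "real i powr expo \<alpha> = real i powr (1 + 2 * \<alpha>) * (real i powr p)\<^sup>2"
    using i by (simp add: expo_def powr_add[symmetric] power2_eq_square)
  have k: "\<kappa> i > 0" by (rule kappa_pos[OF assms])
  have *: "real i powr (-p) = inverse (real i powr p)"
    by (simp add: powr_minus)
  have le: "inverse (\<kappa> i) \<le> C * real i powr p"
  proof -
    have "inverse (\<kappa> i) \<le> inverse (inverse C * real i powr (-p))"
      using kappa[OF assms] i C_pos by (intro le_imp_inverse_le) auto
    then show ?thesis by (simp add: *)
  qed
  have ge: "real i powr p / C \<le> inverse (\<kappa> i)"
  proof -
    have "inverse (C * real i powr (-p)) \<le> inverse (\<kappa> i)"
      using kappa[OF assms] k by (intro le_imp_inverse_le) auto
    then show ?thesis by (simp add: * field_simps)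
  qed
  have "(inverse (\<kappa> i))\<^sup>2 \<le> (C * real i powr p)\<^sup>2"
    using le k by (intro power_mono) auto
  from mult_left_mono[OF this, of "real i powr (1 + 2 * \<alpha>)"]
  show "wt \<alpha> i \<le> C\<^sup>2 * real i powr expo \<alpha>"
    unfolding wt_def eq by (simp add: power_mult_distrib mult.left_commute)
  have "(real i powr p / C)\<^sup>2 \<le> (inverse (\<kappa> i))\<^sup>2"
    using ge C_pos by (intro power_mono) auto
  then show "real i powr expo \<alpha> / C\<^sup>2 \<le> wt \<alpha> i"
    unfolding wt_def eq by (simp add: power_divide times_divide_eq_right[symmetric] mult_left_mono del: times_divide_eq_right)
qed

lemma wt_pos: "i \<ge> 1 \<Longrightarrow> wt \<alpha> i > 0"
  using kappa_pos[of i] by (simp add: wt_def)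

lemma wt_kappa: "i \<ge> 1 \<Longrightarrow> wt \<alpha> i * (\<kappa> i)\<^sup>2 = real i powr (1 + 2 * \<alpha>)"
  using kappa_pos[of i] by (simp add: wt_def power_mult_distrib[symmetric] mult.assoc)

lemma wt_shift: "wt (\<alpha> + d) i = wt \<alpha> i * real i powr (2 * d)"
  by (simp add: wt_def powr_add[symmetric] algebra_simps)

lemma wt_mono: "i \<ge> 1 \<Longrightarrow> \<alpha> \<le> \<beta> \<Longrightarrow> wt \<alpha> i \<le> wt \<beta> i"
  unfolding wt_def by (intro mult_right_mono powr_mono) auto

lemma shr_pos: "i \<ge> 1 \<Longrightarrow> shr \<alpha> i > 0" and shr_le_1: "i \<ge> 1 \<Longrightarrow> shr \<alpha> i \<le> 1"
  using wt_pos[of i \<alpha>] n_pos by (auto simp: shr_def)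

lemma shr_antimono: "i \<ge> 1 \<Longrightarrow> \<alpha> \<le> \<beta> \<Longrightarrow> shr \<beta> i \<le> shr \<alpha> i"
  unfolding shr_def using wt_mono[of i \<alpha> \<beta>] wt_pos[of i \<alpha>] n_pos
  by (intro divide_left_mono) auto

lemma lgt_nonneg: "i \<ge> 1 \<Longrightarrow> lgt \<alpha> i \<ge> 0"
  using wt_pos[of i \<alpha>] n_pos by (simp add: lgt_def)

lemma lgt_antimono: "i \<ge> 1 \<Longrightarrow> \<alpha> \<le> \<beta> \<Longrightarrow> lgt \<beta> i \<le> lgt \<alpha> i"
  unfolding lgt_def using wt_mono[of i \<alpha> \<beta>] wt_pos[of i \<alpha>] n_pos
  by (subst ln_le_cancel_iff) (auto intro!: divide_left_mono add_pos_nonneg)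

lemma lgt_le: "i \<ge> 1 \<Longrightarrow> lgt \<alpha> i \<le> real n / wt \<alpha> i"
  using wt_pos[of i \<alpha>] n_pos unfolding lgt_def by (intro ln_add_one_self_le_self) auto

text \<open>This is \<open>ln (1 - u) \<le> - u\<close> for \<open>u = shr \<alpha> i\<close>,
  because \<open>1 - u\<close> is the inverse of \<open>1 + n / wt\<close>. It lets one bound on the
  logarithms serve for the sums of \<open>shr\<close> as well.\<close>

lemma shr_le_lgt: assumes "i \<ge> 1" shows "shr \<alpha> i \<le> lgt \<alpha> i"
proof -
  have w: "wt \<alpha> i > 0" by (rule wt_pos[OF assms])
  have "ln (inverse (1 + real n / wt \<alpha> i)) \<le> inverse (1 + real n / wt \<alpha> i) - 1"
    using w n_pos by (intro ln_le_minus_one) (auto intro: add_pos_pos)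
  moreover have "ln (inverse (1 + real n / wt \<alpha> i)) = - lgt \<alpha> i"
    using w n_pos by (subst ln_inverse) (auto simp: lgt_def intro: add_pos_pos)
  moreover have "inverse (1 + real n / wt \<alpha> i) - 1 = - shr \<alpha> i"
    using w n_pos by (simp add: shr_def divide_simps)
  ultimately show ?thesis by linarith
qed

lemma ratio_le: "i \<ge> 1 \<Longrightarrow> real n / wt \<alpha> i \<le> C\<^sup>2 * real n / real i powr expo \<alpha>"
  using wt_bounds(1)[of i \<alpha>] wt_pos[of i \<alpha>] C_pos n_pos
  by (simp add: field_simps)

section \<open>The effective dimension and sums of the logarithmic terms\<close>

lemma expo_ge_1: "\<alpha> \<ge> 0 \<Longrightarrow> expo \<alpha> \<ge> 1"
  using p_nonneg by (simp add: expo_def)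

lemma dimn_pos: "dimn \<alpha> > 0"
  using n_pos by (simp add: dimn_def)

lemma dimn_ge_1: assumes "\<alpha> \<ge> 0" shows "dimn \<alpha> \<ge> 1"
  using expo_ge_1[OF assms] n_ge_3 by (simp add: dimn_def ge_one_powr_ge_zero)

lemma dimn_exp: "dimn \<alpha> = exp (T / expo \<alpha>)"
  using n_pos by (simp add: dimn_def powr_def)

lemma ln_dimn: "ln (dimn \<alpha>) = T / expo \<alpha>"
  by (simp add: dimn_exp)

lemma dimn_powr: assumes "\<alpha> \<ge> 0" shows "dimn \<alpha> powr expo \<alpha> = real n"
  using expo_ge_1[OF assms] n_pos by (simp add: dimn_def powr_powr)

lemma dimn_le_n: assumes "\<alpha> \<ge> 0" shows "dimn \<alpha> \<le> real n"
proof -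
  have "real n powr (1 / expo \<alpha>) \<le> real n powr 1"
    using expo_ge_1[OF assms] n_ge_3 by (intro powr_mono) auto
  then show ?thesis using n_pos by (simp add: dimn_def)
qed

lemma n_div_powr:
  assumes "\<alpha> \<ge> 0" "i \<ge> 1"
  shows "real n / real i powr expo \<alpha> = (dimn \<alpha> / real i) powr expo \<alpha>"
  using assms dimn_pos[of \<alpha>] by (simp add: powr_divide dimn_powr)

text \<open>Beyond the effective dimension the base \<open>dimn \<alpha> / i\<close> is at most 1,
  so the exponent may be lowered to 1. Tail sums become harmonic, which costs a logarithm but is
  uniform over all \<alpha> \<ge> 0, including the case \<open>expo \<alpha> = 1\<close>.\<close>

lemma n_div_powr_le:
  assumes "\<alpha> \<ge> 0" "i \<ge> 1" "dimn \<alpha> \<le> real i"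
  shows "real n / real i powr expo \<alpha> \<le> dimn \<alpha> / real i"
proof -
  have "(dimn \<alpha> / real i) powr expo \<alpha> \<le> (dimn \<alpha> / real i) powr 1"
    using assms expo_ge_1[OF assms(1)] dimn_pos[of \<alpha>] by (intro powr_mono') auto
  then show ?thesis using assms dimn_pos[of \<alpha>] by (simp add: n_div_powr)
qed

lemma powr_expo_le_n:
  assumes "\<alpha> \<ge> 0" "i \<ge> 1" "real i \<le> dimn \<alpha>"
  shows "real i powr expo \<alpha> \<le> real n"
proof -
  have "real i powr expo \<alpha> \<le> dimn \<alpha> powr expo \<alpha>"
    using assms expo_ge_1[OF assms(1)] by (intro powr_mono2) auto
  then show ?thesis by (simp add: dimn_powr assms)
qed

text \<open>As \<open>ln (dimn \<alpha>) = T / expo \<alpha>\<close>, a step of at most 2 / T in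
  \<alpha> changes this logarithm by at most 4. Hence 1 / T is the natural step size in
  \<alpha>.\<close>

lemma dimn_ratio:
  assumes "0 \<le> \<alpha>" "\<alpha> \<le> \<alpha>'" "(\<alpha>' - \<alpha>) * T \<le> 2"
  shows "dimn \<alpha> \<le> exp 4 * dimn \<alpha>'"
proof -
  have e: "expo \<alpha> \<ge> 1" "expo \<alpha>' \<ge> 1" using assms by (auto intro: expo_ge_1)
  have "T / expo \<alpha> - T / expo \<alpha>' = 2 * ((\<alpha>' - \<alpha>) * T) / (expo \<alpha> * expo \<alpha>')"
    using e by (simp add: field_simps) (simp add: expo_def algebra_simps)
  also have "\<dots> \<le> 2 * 2 / 1"
    using e assms T_gt_1 mult_mono[of 1 "expo \<alpha>" 1 "expo \<alpha>'"] by (intro frac_le) auto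
  finally have "T / expo \<alpha> \<le> 4 + T / expo \<alpha>'" by simp
  then show ?thesis unfolding dimn_exp exp_add[symmetric] by simp
qed

text \<open>At most \<open>dimn \<alpha>\<close> indices lie below the effective dimension, each
  costing at most \<open>ln (1 + C\<^sup>2 * n)\<close>; the others cost
  \<open>C\<^sup>2 * dimn \<alpha> / i\<close>. The cut-off \<open>m\<close> and its logarithm are
  unavoidable, since the full series diverges for \<alpha> = p = 0.\<close>

lemma sum_lgt_le:
  assumes "\<alpha> \<ge> 0" "m \<ge> 1"
  shows "(\<Sum>i=1..<m. lgt \<alpha> i) \<le> dimn \<alpha> * (ln (1 + C\<^sup>2 * real n) + C\<^sup>2 * (1 + ln (real m)))"
proof -
  define b where "b = ln (1 + C\<^sup>2 * real n)"
  have b: "b \<ge> 0" unfolding b_def using n_pos by simp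
  let ?S = "{i \<in> {1..<m}. real i \<le> dimn \<alpha>}"
  have *: "lgt \<alpha> i \<le> (if real i \<le> dimn \<alpha> then b else 0) + C\<^sup>2 * dimn \<alpha> * (1 / real i)"
    if "i \<in> {1..<m}" for i
  proof (cases "real i \<le> dimn \<alpha>")
    case True
    have i: "i \<ge> 1" using that by simp
    have "real i powr expo \<alpha> \<ge> 1"
      using i expo_ge_1[OF assms(1)] by (intro ge_one_powr_ge_zero) auto
    then have "C\<^sup>2 * real n / real i powr expo \<alpha> \<le> C\<^sup>2 * real n / 1"
      using n_pos i by (intro divide_left_mono) auto
    then have "real n / wt \<alpha> i \<le> C\<^sup>2 * real n"
      using ratio_le[OF i, of \<alpha>] by simp
    then have "lgt \<alpha> i \<le> b"
      unfolding lgt_def b_def using wt_pos[OF i, of \<alpha>] n_pos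
      by (subst ln_le_cancel_iff) (auto intro!: add_pos_nonneg)
    moreover have "0 \<le> C\<^sup>2 * dimn \<alpha> * (1 / real i)"
      using dimn_pos[of \<alpha>] by simp
    ultimately show ?thesis using True by (simp add: add_increasing2)
  next
    case False
    have i: "i \<ge> 1" using that by simp
    have "lgt \<alpha> i \<le> C\<^sup>2 * (real n / real i powr expo \<alpha>)"
      using lgt_le[OF i, of \<alpha>] ratio_le[OF i, of \<alpha>] by simp
    also have "\<dots> \<le> C\<^sup>2 * (dimn \<alpha> / real i)"
      using False by (intro mult_left_mono n_div_powr_le assms i) auto
    finally show ?thesis using False by simp
  qed
  have "(\<Sum>i=1..<m. lgt \<alpha> i) \<le> (\<Sum>i=1..<m. (if real i \<le> dimn \<alpha> then b else 0) + C\<^sup>2 * dimn \<alpha> * (1 / real i))"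
    by (intro sum_mono *)
  also have "\<dots> = real (card ?S) * b + C\<^sup>2 * dimn \<alpha> * (\<Sum>i=1..<m. 1 / real i)"
    by (simp add: sum.distrib sum_distrib_left sum.If_cases Int_def)
  also have "\<dots> \<le> dimn \<alpha> * b + C\<^sup>2 * dimn \<alpha> * (1 + ln (real m))"
  proof (intro add_mono mult_right_mono mult_left_mono b)
    have "?S \<subseteq> {1..nat \<lfloor>dimn \<alpha>\<rfloor>}"
      using dimn_pos[of \<alpha>] by (auto simp: le_nat_floor)
    then have "card ?S \<le> nat \<lfloor>dimn \<alpha>\<rfloor>"
      using card_mono[of "{1..nat \<lfloor>dimn \<alpha>\<rfloor>}" ?S] by simp
    then show "real (card ?S) \<le> dimn \<alpha>"
      using dimn_pos[of \<alpha>] by (meson le_nat_floor less_imp_le of_nat_floor of_nat_mono order_trans)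
    have "(\<Sum>i=1..<m. 1 / real i) \<le> (\<Sum>i=1..m. 1 / real i)"
      by (intro sum_mono2) auto
    then show "(\<Sum>i=1..<m. 1 / real i) \<le> 1 + ln (real m)"
      using sum_inverse_le_ln[OF assms(2)] by linarith
  qed (use dimn_pos[of \<alpha>] in auto)
  finally show ?thesis by (simp add: b_def algebra_simps)
qed

text \<open>The constant is 23 = 2 + 21: twice \<open>C\<^sup>2 * T\<close> for
  \<open>ln (1 + C\<^sup>2 * n)\<close>, and 1 + 20 from the harmonic sum, as
  \<open>ln (n^20) = 20 * T\<close>.\<close>

lemma sum_lgt_le_dimn:
  assumes "\<alpha> \<ge> 0"
  shows "(\<Sum>i=1..<n^20. lgt \<alpha> i) \<le> 23 * C\<^sup>2 * (dimn \<alpha> * T)"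
proof -
  have "ln (1 + C\<^sup>2 * real n) \<le> ln ((1 + C\<^sup>2) * real n)"
    using n_ge_3 by (subst ln_le_cancel_iff) (auto simp: algebra_simps intro: add_pos_nonneg)
  also have "\<dots> = ln (1 + C\<^sup>2) + T"
    using n_pos C2_ge_1 by (subst ln_mult_pos) auto
  also have "\<dots> \<le> C\<^sup>2 * T + C\<^sup>2 * T"
    using ln_add_one_self_le_self[of "C\<^sup>2"] mult_left_mono[of 1 T "C\<^sup>2"] mult_right_mono[of 1 "C\<^sup>2" T]
      T_gt_1 C2_ge_1 by (intro add_mono) auto
  finally have 1: "ln (1 + C\<^sup>2 * real n) \<le> 2 * (C\<^sup>2 * T)" by (simp add: mult.commute)
  have "ln (real (n^20)) = 20 * T"
    using n_pos by (simp add: ln_realpow)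
  then have 2: "C\<^sup>2 * (1 + ln (real (n^20))) \<le> 21 * (C\<^sup>2 * T)"
    using mult_left_mono[of 1 T "C\<^sup>2"] T_gt_1 by (simp add: algebra_simps)
  have "(\<Sum>i=1..<n^20. lgt \<alpha> i) \<le> dimn \<alpha> * (ln (1 + C\<^sup>2 * real n) + C\<^sup>2 * (1 + ln (real (n^20))))"
    using n_ge_3 assms by (intro sum_lgt_le) auto
  also have "\<dots> \<le> dimn \<alpha> * (23 * (C\<^sup>2 * T))"
    using 1 2 dimn_pos[of \<alpha>] by (intro mult_left_mono) auto
  finally show ?thesis by (simp add: mult_ac)
qed

section \<open>Increments of the shrinkage factors in \<alpha>\<close>

lemma shr_diff:
  assumes "i \<ge> 1"
  shows "shr \<alpha> i - shr \<beta> i = real n * (wt \<beta> i - wt \<alpha> i) / ((wt \<alpha> i + real n) * (wt \<beta> i + real n))"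
  using wt_pos[OF assms, of \<alpha>] wt_pos[OF assms, of \<beta>] n_pos
  by (simp add: shr_def diff_frac_eq algebra_simps)

text \<open>With u, v the factors at \<alpha>, \<beta>, this is ln ((1 - v) / (1 - u)) \<ge> (u - v)
  / (1 - v), an instance of ln x \<le> x - 1. What is left after subtracting u - v is (u - v) * n /
  wt, which is nonnegative: without signal, the mean log-likelihood increases with \<alpha> term by
  term.\<close>

lemma lgt_diff_ge:
  assumes "i \<ge> 1" "\<alpha> \<le> \<beta>"
  shows "(shr \<alpha> i - shr \<beta> i) * (1 + real n / wt \<beta> i) \<le> lgt \<alpha> i - lgt \<beta> i"
proof -
  have w: "wt \<alpha> i > 0" "wt \<beta> i > 0" using assms by (auto intro: wt_pos)
  define A B where "A = 1 + real n / wt \<alpha> i" and "B = 1 + real n / wt \<beta> i"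
  have AB: "A > 0" "B > 0" using w n_pos by (auto simp: A_def B_def intro: add_pos_pos)
  have "ln (B / A) \<le> B / A - 1" using AB by (intro ln_le_minus_one) auto
  then have "1 - B / A \<le> lgt \<alpha> i - lgt \<beta> i"
    using AB by (simp add: ln_div lgt_def A_def B_def)
  moreover have "(shr \<alpha> i - shr \<beta> i) * (1 + real n / wt \<beta> i) = 1 - B / A"
    using w n_pos by (simp add: A_def B_def shr_def divide_simps) (simp add: algebra_simps)
  ultimately show ?thesis by simp
qed

text \<open>Below the effective dimension both weights are at most \<open>C\<^sup>2 * n\<close>,
  which bounds the denominators and gives the factor \<open>(1 + C\<^sup>2)\<^sup>2\<close>. The
  relative increase of the weight is 1 - exp (-t) with t = 2 d ln i \<le> 2, hence at least t / (1 +
  t) \<ge> t / 3; this is the origin of 2/3.\<close>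

lemma shr_gain_ge:
  assumes "i \<ge> 1" "\<alpha> \<ge> 0" "d \<ge> 0" "real i \<le> dimn (\<alpha> + d)" "d * ln (real i) \<le> 1"
  shows "(shr \<alpha> i - shr (\<alpha> + d) i) * (real n / wt (\<alpha> + d) i) \<ge> 2/3 * d * ln (real i) / (1 + C\<^sup>2)\<^sup>2"
proof -
  define w w' where "w = wt \<alpha> i" and "w' = wt (\<alpha> + d) i"
  define t where "t = 2 * (d * ln (real i))"
  have t: "0 \<le> t" "t \<le> 2" using assms by (auto simp: t_def)
  have w: "0 < w" "w \<le> w'" using assms by (auto simp: w_def w'_def intro: wt_pos wt_mono)
  have w': "w' \<le> C\<^sup>2 * real n"
  proof -
    have "w' \<le> C\<^sup>2 * real i powr expo (\<alpha> + d)" unfolding w'_def by (rule wt_bounds[OF assms(1)])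
    also have "\<dots> \<le> C\<^sup>2 * real n" using assms by (intro mult_left_mono powr_expo_le_n) auto
    finally show ?thesis .
  qed
  have "w' = w * exp t"
    using assms(1) by (simp add: w_def w'_def wt_shift powr_def t_def mult_ac)
  then have frac: "(w' - w) / w' = 1 - exp (- t)"
    using w by (simp add: field_simps exp_minus)
  have "exp (-t) \<le> 1 / (1 + t)"
    using exp_ge_add_one_self[of t] t by (simp add: exp_minus field_simps)
  then have "1 - exp (-t) \<ge> t / (1 + t)" using t by (simp add: field_simps)
  moreover have "t / (1 + t) \<ge> t / 3" using t by (intro divide_left_mono) auto
  ultimately have f: "(w' - w) / w' \<ge> t / 3" unfolding frac by linarith
  have "(w + real n) * (w' + real n) \<le> ((1 + C\<^sup>2) * real n) * ((1 + C\<^sup>2) * real n)"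
    using w w' n_pos by (intro mult_mono) (auto simp: algebra_simps)
  then have "(real n)\<^sup>2 / (((1 + C\<^sup>2) * real n) * ((1 + C\<^sup>2) * real n)) \<le> (real n)\<^sup>2 / ((w + real n) * (w' + real n))"
    using w n_pos C2_ge_1 by (intro divide_left_mono) (auto intro!: mult_pos_pos)
  then have g: "(real n)\<^sup>2 / ((w + real n) * (w' + real n)) \<ge> 1 / (1 + C\<^sup>2)\<^sup>2"
    using n_pos by (simp add: power2_eq_square)
  have "(shr \<alpha> i - shr (\<alpha> + d) i) * (real n / wt (\<alpha> + d) i)
      = (w' - w) / w' * ((real n)\<^sup>2 / ((w + real n) * (w' + real n)))"
    unfolding shr_diff[OF assms(1)] w_def[symmetric] w'_def[symmetric] by (simp add: power2_eq_square mult_ac)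
  also have "\<dots> \<ge> t / 3 * (1 / (1 + C\<^sup>2)\<^sup>2)"
    using f g t w by (intro mult_mono) auto
  finally show ?thesis by (simp add: t_def)
qed

text \<open>A Lipschitz bound in \<alpha> for every index, without reference to the effective
  dimension. The price is the factor \<open>ln i\<close>, affordable when \<open>d\<close> is the
  mesh of the grid.\<close>

lemma shr_diff_le:
  assumes "i \<ge> 1" "d \<ge> 0"
  shows "shr \<alpha> i - shr (\<alpha> + d) i \<le> 2 * d * ln (real i) * shr \<alpha> i"
proof -
  define w w' where "w = wt \<alpha> i" and "w' = wt (\<alpha> + d) i"
  define t where "t = 2 * (d * ln (real i))"
  have t: "0 \<le> t" using assms by (auto simp: t_def)
  have w: "0 < w" "w \<le> w'" using assms by (auto simp: w_def w'_def intro: wt_pos wt_mono)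
  have w': "w' = w * exp t"
    using assms(1) by (simp add: w_def w'_def wt_shift powr_def t_def mult_ac)
  have "w' - w = w' * (1 - exp (- t))" by (simp add: w' exp_minus field_simps)
  also have "\<dots> \<le> w' * t"
    using exp_ge_add_one_self[of "- t"] w by (intro mult_left_mono) auto
  also have "\<dots> \<le> t * (w' + real n)" using t by (simp add: algebra_simps)
  finally have "(w' - w) / (w' + real n) \<le> t"
    using w n_pos by (simp add: divide_le_eq)
  then have "shr \<alpha> i * ((w' - w) / (w' + real n)) \<le> shr \<alpha> i * t"
    using shr_pos[OF assms(1), of \<alpha>] by (intro mult_left_mono) auto
  moreover have "shr \<alpha> i - shr (\<alpha> + d) i = shr \<alpha> i * ((w' - w) / (w' + real n))"
    unfolding shr_diff[OF assms(1)] w_def[symmetric] w'_def[symmetric] by (simp add: shr_def w_def)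
  ultimately show ?thesis by (simp add: t_def mult_ac)
qed

section \<open>The signal weights behind \<open>hn\<close>\<close>

lemma sig_nonneg: "i \<ge> 1 \<Longrightarrow> sig \<alpha> i \<ge> 0"
  by (simp add: sig_def)

text \<open>In \<open>shr * n * \<kappa>\<^sup>2\<close> the numerator
  \<open>wt * \<kappa>\<^sup>2\<close> is a pure power of i, and minus the derivative in \<alpha> is
  exactly \<open>2 * sig\<close>. The identity is the finite-difference version, with
  \<open>ln i\<close> replaced by an exponential increment. This is why \<open>hn\<close> measures
  how fast the likelihood loses signal.\<close>

lemma shr_signal_eq:
  assumes "i \<ge> 1"
  shows "(shr \<alpha> i - shr (\<alpha> + d) i) * (real n * (\<kappa> i)\<^sup>2) = (real n)\<^sup>2 * real i powr (1 + 2 * \<alpha>)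
     * (exp (2 * d * ln (real i)) - 1) / ((wt \<alpha> i + real n) * (wt (\<alpha> + d) i + real n))"
proof -
  have "wt (\<alpha> + d) i - wt \<alpha> i = wt \<alpha> i * (exp (2 * d * ln (real i)) - 1)"
    using assms by (simp add: wt_shift powr_def algebra_simps)
  then show ?thesis
    unfolding shr_diff[OF assms] wt_kappa[OF assms, symmetric] by (simp add: power2_eq_square mult_ac)
qed

text \<open>For i \<le> n the exponent t is at most 4 and exp t - 1 \<le> exp 4 * t. For i > n it is
  unbounded, but then n \<le> \<open>C\<^sup>2 * w\<close>, and the factor exp t is absorbed by
  \<open>w' = w * exp t\<close> in the other denominator. The constant adds the two cases.\<close>

lemma shr_signal_le:
  assumes "i \<ge> 1" "\<alpha> \<ge> 0" "d \<ge> 0" "d * T \<le> 2"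
  shows "(shr \<alpha> i - shr (\<alpha> + d) i) * (real n * (\<kappa> i)\<^sup>2) \<le> (exp 4 + 1 + C\<^sup>2) * (2 * d) * sig \<alpha> i"
proof -
  define w w' where "w = wt \<alpha> i" and "w' = wt (\<alpha> + d) i"
  define t where "t = 2 * d * ln (real i)"
  define c where "c = exp 4 + 1 + C\<^sup>2"
  have c: "exp 4 \<le> c" "1 + C\<^sup>2 \<le> c" "0 \<le> c" by (auto simp: c_def intro: add_nonneg_nonneg)
  have t: "0 \<le> t" using assms by (auto simp: t_def)
  have w: "0 < w" "w \<le> w'" using assms by (auto simp: w_def w'_def intro: wt_pos wt_mono)
  have w': "w' = w * exp t"
    using assms(1) by (simp add: w_def w'_def wt_shift powr_def t_def mult_ac)
  have "(exp t - 1) * (w + real n) \<le> c * t * (w' + real n)"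
  proof (cases "i \<le> n")
    case True
    have "2 * (d * ln (real i)) \<le> 2 * (d * T)"
      using True assms by (intro mult_left_mono) auto
    then have "t \<le> 4" using assms(4) by (simp add: t_def)
    then have "t * exp t \<le> t * c" using t c(1) by (intro mult_left_mono) (auto intro: order_trans)
    then have "exp t - 1 \<le> c * t" using exp_minus_one_le[of t] by (simp add: mult_ac)
    then show ?thesis using t w n_pos c by (intro mult_mono) (auto intro!: mult_nonneg_nonneg simp: c_def)
  next
    case False
    have "real n \<le> real i powr 1" using False by simp
    also have "\<dots> \<le> real i powr expo \<alpha>"
      using expo_ge_1[OF assms(2)] assms(1) by (intro powr_mono) auto
    also have "\<dots> \<le> C\<^sup>2 * w"
      using wt_bounds(1)[OF assms(1), of \<alpha>] C_pos by (simp add: w_def field_simps)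
    finally have "(exp t - 1) * (w + real n) \<le> (exp t - 1) * ((1 + C\<^sup>2) * w)"
      using t by (intro mult_left_mono) (auto simp: algebra_simps)
    also have "\<dots> \<le> (t * exp t) * ((1 + C\<^sup>2) * w)"
      using w C2_ge_1 by (intro mult_right_mono exp_minus_one_le) auto
    also have "\<dots> = (1 + C\<^sup>2) * t * w'" by (simp add: w')
    also have "\<dots> \<le> c * t * (w' + real n)"
      using c w t by (intro mult_mono) auto
    finally show ?thesis .
  qed
  then have "(exp t - 1) / (w' + real n) \<le> c * t / (w + real n)"
    using w n_pos by (simp add: field_simps)
  then have "((real n)\<^sup>2 * real i powr (1 + 2 * \<alpha>) / (w + real n)) * ((exp t - 1) / (w' + real n))
     \<le> ((real n)\<^sup>2 * real i powr (1 + 2 * \<alpha>) / (w + real n)) * (c * t / (w + real n))"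
    using w n_pos by (intro mult_left_mono) auto
  then show ?thesis
    unfolding shr_signal_eq[OF assms(1)] sig_def w_def[symmetric] w'_def[symmetric] c_def[symmetric]
    by (simp add: t_def power2_eq_square mult_ac)
qed

text \<open>Evaluating \<open>sig\<close> to the right of both arguments makes the denominators
  comparable in the required direction, because weights increase with \<alpha>. The numerator grows
  by \<open>i powr (4 / T) \<le> exp 4\<close>, which is where i \<le> n enters. The shift by 2 / T
  leaves room for a reference point on the left of a crossing of \<open>hn\<close>.\<close>

lemma shr_signal_ge:
  assumes "i \<ge> 1" "i \<le> n" "\<alpha> \<ge> 0"
  shows "(shr \<alpha> i - shr (\<alpha> + 1 / T) i) * (real n * (\<kappa> i)\<^sup>2) \<ge> 2 * exp (-4) / T * sig (\<alpha> + 2 / T) i"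
proof -
  define w w' ws where "w = wt \<alpha> i" and "w' = wt (\<alpha> + 1 / T) i" and "ws = wt (\<alpha> + 2 / T) i"
  define t where "t = 2 * (1 / T) * ln (real i)"
  define x where "x = real i powr (1 + 2 * \<alpha>)"
  have "ln (real i) \<le> T" using assms by simp
  then have t: "0 \<le> t" "t \<le> 2" using assms T_gt_1 by (auto simp: t_def divide_le_eq)
  have w: "0 < w" "w \<le> w'" "w' \<le> ws"
    using assms T_gt_1 by (auto simp: w_def w'_def ws_def intro!: wt_pos wt_mono divide_right_mono)
  have x: "x > 0" using assms by (simp add: x_def)
  have "real i powr (1 + 2 * (\<alpha> + 2 / T)) = x * real i powr (4 / T)"
    unfolding x_def powr_add[symmetric] by (simp add: algebra_simps)
  also have "real i powr (4 / T) = exp (2 * t)"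
    using assms by (simp add: powr_def t_def mult_ac)
  also have "x * exp (2 * t) \<le> x * exp 4"
    using t x by (intro mult_left_mono) auto
  finally have xs: "real i powr (1 + 2 * (\<alpha> + 2 / T)) \<le> x * exp 4" .
  have "2 * exp (-4) / T * sig (\<alpha> + 2 / T) i
      = exp (-4) * ((real n)\<^sup>2 * t / (ws + real n)\<^sup>2) * real i powr (1 + 2 * (\<alpha> + 2 / T))"
    unfolding sig_def ws_def t_def by (simp add: mult_ac)
  also have "\<dots> \<le> exp (-4) * ((real n)\<^sup>2 * t / (ws + real n)\<^sup>2) * (x * exp 4)"
    using t by (intro mult_left_mono xs) auto
  also have "\<dots> = (exp (-4) * exp 4) * ((real n)\<^sup>2 * x * t / ((ws + real n) * (ws + real n)))"
    by (simp add: power2_eq_square mult_ac)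
  also have "\<dots> = (real n)\<^sup>2 * x * t / ((ws + real n) * (ws + real n))"
    by (simp add: exp_add[symmetric])
  also have "\<dots> \<le> (real n)\<^sup>2 * x * (exp t - 1) / ((w + real n) * (w' + real n))"
  proof (rule frac_le)
    show "(real n)\<^sup>2 * x * t \<le> (real n)\<^sup>2 * x * (exp t - 1)"
    proof (intro mult_left_mono)
      show "t \<le> exp t - 1" using exp_ge_add_one_self[of t] by linarith
    qed (use x in auto)
    show "(w + real n) * (w' + real n) \<le> (ws + real n) * (ws + real n)"
      using w n_pos by (intro mult_mono) auto
    show "0 < (w + real n) * (w' + real n)" using w n_pos by (intro mult_pos_pos) auto
    show "0 \<le> (real n)\<^sup>2 * x * (exp t - 1)" using x t by auto
  qed
  finally show ?thesis
    unfolding shr_signal_eq[OF assms(1)] w_def w'_def x_def t_def .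
qed

lemma sig_factor_le:
  assumes "i \<ge> 1"
  shows "(real n)\<^sup>2 * real i powr (1 + 2 * \<alpha>) / (wt \<alpha> i + real n)\<^sup>2
     \<le> C^4 * (real i powr (1 + 2 * \<alpha>) * (real n / real i powr expo \<alpha>)\<^sup>2)"
proof -
  define x z w where "x = real i powr (1 + 2 * \<alpha>)" and "z = real i powr expo \<alpha>" and "w = wt \<alpha> i"
  have pos: "x > 0" "z > 0" "w > 0" using assms wt_pos[OF assms] by (auto simp: x_def z_def w_def)
  have "real n / (w + real n) \<le> real n / w" using pos n_pos by (intro divide_left_mono) auto
  also have "\<dots> \<le> C\<^sup>2 * (real n / z)" using ratio_le[OF assms, of \<alpha>] by (simp add: w_def z_def)
  finally have "(real n / (w + real n))\<^sup>2 \<le> (C\<^sup>2 * (real n / z))\<^sup>2"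
    using pos n_pos by (intro power_mono) auto
  then have "x * (real n / (w + real n))\<^sup>2 \<le> x * (C\<^sup>2 * (real n / z))\<^sup>2"
    using pos by (intro mult_left_mono) auto
  then show ?thesis
    unfolding x_def[symmetric] z_def[symmetric] w_def[symmetric]
    by (simp add: power_divide power_mult_distrib power_mult[symmetric] mult_ac)
qed

text \<open>Half of the power \<open>2 * \<beta>\<close> absorbs
  \<open>i powr (2 * \<alpha>)\<close>, the other half the logarithm through
  \<open>ln i \<le> i powr \<beta> / \<beta>\<close>; hence the restriction 2 \<alpha> \<le>
  \<beta>. In both ranges of i one factor i is traded for \<open>dimn \<alpha>\<close>.\<close>

lemma sig_le_smooth:
  assumes "i \<ge> 1" "0 \<le> \<alpha>" "2 * \<alpha> \<le> \<beta>" "\<beta> > 0"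
  shows "sig \<alpha> i \<le> C^4 / \<beta> * dimn \<alpha> * real i powr (2 * \<beta>)"
proof -
  define x where "x = real i powr (1 + 2 * \<alpha>)"
  have C4: "C^4 \<ge> 1" using C_ge_1 by simp
  have xi: "x = real i * real i powr (2 * \<alpha>)" using assms by (simp add: x_def powr_add)
  have "(real n)\<^sup>2 * x / (wt \<alpha> i + real n)\<^sup>2 \<le> C^4 * (dimn \<alpha> * real i powr (2 * \<alpha>))"
  proof (cases "real i \<le> dimn \<alpha>")
    case True
    have "(real n)\<^sup>2 * x / (wt \<alpha> i + real n)\<^sup>2 \<le> x"
      using wt_pos[OF assms(1), of \<alpha>] n_pos assms(1)
      by (simp add: divide_le_eq x_def power_mono mult.commute[of _ "real i powr _"])
    also have "\<dots> \<le> 1 * (dimn \<alpha> * real i powr (2 * \<alpha>))" unfolding xi using True by (simp add: mult_right_mono)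
    also have "\<dots> \<le> C^4 * (dimn \<alpha> * real i powr (2 * \<alpha>))"
      using C4 dimn_pos[of \<alpha>] by (intro mult_right_mono) auto
    finally show ?thesis .
  next
    case False
    define q where "q = real n / real i powr expo \<alpha>"
    have q: "0 \<le> q" "q \<le> dimn \<alpha> / real i" "dimn \<alpha> / real i \<le> 1"
      using n_div_powr_le[OF assms(2,1)] False assms by (auto simp: q_def)
    have "q\<^sup>2 \<le> dimn \<alpha> / real i * 1"
      unfolding power2_eq_square using q by (intro mult_mono) auto
    then have "C^4 * (x * q\<^sup>2) \<le> C^4 * (x * (dimn \<alpha> / real i))"
      using assms C_pos by (intro mult_left_mono) (auto simp: x_def)
    also have "\<dots> = C^4 * (dimn \<alpha> * real i powr (2 * \<alpha>))" unfolding xi using assms by simp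
    finally show ?thesis using sig_factor_le[OF assms(1), of \<alpha>] by (simp add: x_def q_def)
  qed
  then have "sig \<alpha> i \<le> C^4 * (dimn \<alpha> * real i powr (2 * \<alpha>)) * ln (real i)"
    unfolding sig_def x_def[symmetric] using assms
    by (simp add: times_divide_eq_left[symmetric] mult_right_mono del: times_divide_eq_left)
  also have "\<dots> \<le> C^4 * (dimn \<alpha> * real i powr \<beta>) * (real i powr \<beta> / \<beta>)"
    using assms C_pos dimn_pos[of \<alpha>] by (intro mult_mono mult_left_mono powr_mono ln_powr_bound) auto
  also have "real i powr \<beta> * real i powr \<beta> = real i powr (2 * \<beta>)"
    by (simp add: powr_add[symmetric])
  then have "C^4 * (dimn \<alpha> * real i powr \<beta>) * (real i powr \<beta> / \<beta>) = C^4 / \<beta> * dimn \<alpha> * real i powr (2 * \<beta>)"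
    by (simp add: mult_ac)
  finally show ?thesis .
qed

lemma sig_factor_le_powr:
  assumes "i \<ge> 1"
  shows "(real n)\<^sup>2 * real i powr (1 + 2 * \<alpha>) / (wt \<alpha> i + real n)\<^sup>2 \<le> C^4 * ((real n)\<^sup>2 / real i powr expo \<alpha>)"
proof -
  define x z where "x = real i powr (1 + 2 * \<alpha>)" and "z = real i powr expo \<alpha>"
  have "x \<le> z" unfolding x_def z_def using assms p_nonneg by (intro powr_mono) (auto simp: expo_def)
  moreover have "z > 0" using assms by (simp add: z_def)
  ultimately have "x * (real n / z)\<^sup>2 \<le> z * (real n / z)\<^sup>2" by (intro mult_right_mono) auto
  also have "\<dots> = (real n)\<^sup>2 / z" using \<open>z > 0\<close> by (simp add: power2_eq_square)
  finally have "C^4 * (x * (real n / z)\<^sup>2) \<le> C^4 * ((real n)\<^sup>2 / z)"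
    using C_pos by (intro mult_left_mono) auto
  then show ?thesis using sig_factor_le[OF assms, of \<alpha>] unfolding x_def z_def by linarith
qed

text \<open>Deliberately crude: it only serves to make the series in \<open>hn\<close>
  summable.\<close>

lemma sig_le_const:
  assumes "i \<ge> 1" "\<alpha> \<ge> 0"
  shows "sig \<alpha> i \<le> C^4 * (real n)\<^sup>2"
proof -
  have ln: "0 \<le> ln (real i)" "ln (real i) \<le> real i"
    using assms ln_le_minus_one[of "real i"] by auto
  have "real i powr 1 \<le> real i powr expo \<alpha>"
    using assms expo_ge_1[OF assms(2)] by (intro powr_mono) auto
  then have "ln (real i) \<le> real i powr expo \<alpha>" using ln assms by simp
  have "sig \<alpha> i \<le> C^4 * ((real n)\<^sup>2 / real i powr expo \<alpha>) * ln (real i)"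
    unfolding sig_def using sig_factor_le_powr[OF assms(1), of \<alpha>] ln
    by (simp add: times_divide_eq_left[symmetric] mult_right_mono del: times_divide_eq_left)
  also have "\<dots> \<le> C^4 * ((real n)\<^sup>2 / real i powr expo \<alpha>) * real i powr expo \<alpha>"
    using \<open>ln (real i) \<le> real i powr expo \<alpha>\<close> C_pos by (intro mult_left_mono) auto
  also have "\<dots> = C^4 * (real n)\<^sup>2" using assms by simp
  finally show ?thesis .
qed

text \<open>With e = \<open>expo \<alpha>\<close>, the factor is at most n^(2 - e) \<le> n^(1 / e),
  because (e - 1)^2 \<ge> 0. So the indices from n on contribute to the series only a constant
  multiple of \<open>dimn \<alpha>\<close>, with no logarithmic factor.\<close>

lemma sig_le_tail:
  assumes "i \<ge> n" "\<alpha> \<ge> 0" "\<beta> > 0"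
  shows "sig \<alpha> i \<le> C^4 / (2 * \<beta>) * dimn \<alpha> * real i powr (2 * \<beta>)"
proof -
  have i: "i \<ge> 1" using assms n_ge_3 by simp
  have e: "expo \<alpha> \<ge> 1" by (rule expo_ge_1[OF assms(2)])
  have "(real n)\<^sup>2 / real i powr expo \<alpha> \<le> (real n)\<^sup>2 / real n powr expo \<alpha>"
    using assms e n_pos i by (intro divide_left_mono powr_mono2) auto
  also have "\<dots> = real n powr (2 - expo \<alpha>)"
    using n_pos by (simp add: powr_diff)
  also have "\<dots> \<le> real n powr (1 / expo \<alpha>)"
  proof (intro powr_mono)
    have "(2 - expo \<alpha>) * expo \<alpha> \<le> 1"
      using zero_le_power2[of "expo \<alpha> - 1"] by (simp add: power2_eq_square algebra_simps)
    then show "2 - expo \<alpha> \<le> 1 / expo \<alpha>" using e by (simp add: le_divide_eq)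
  qed (use n_ge_3 in auto)
  finally have "C^4 * ((real n)\<^sup>2 / real i powr expo \<alpha>) \<le> C^4 * dimn \<alpha>"
    using C_pos by (intro mult_left_mono) (auto simp: dimn_def)
  then have "(real n)\<^sup>2 * real i powr (1 + 2 * \<alpha>) / (wt \<alpha> i + real n)\<^sup>2 \<le> C^4 * dimn \<alpha>"
    using sig_factor_le_powr[OF i, of \<alpha>] by linarith
  then have "sig \<alpha> i \<le> C^4 * dimn \<alpha> * ln (real i)"
    unfolding sig_def using i
    by (simp add: times_divide_eq_left[symmetric] mult_right_mono del: times_divide_eq_left)
  also have "\<dots> \<le> C^4 * dimn \<alpha> * (real i powr (2 * \<beta>) / (2 * \<beta>))"
    using assms i C_pos dimn_pos[of \<alpha>] by (intro mult_left_mono ln_powr_bound) auto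
  finally show ?thesis by (simp add: mult_ac)
qed

end

section \<open>Sobolev signals\<close>

text \<open>Telescoping with 1 / x^2 \<le> 2 / x - 2 / (x + 1), which holds as x + 1 \<le> 2 x. The
  factor 2 lets the sums start at k itself, even at k = 1.\<close>

lemma sum_inverse_squares_le:
  assumes "k \<ge> 1"
  shows "summable (\<lambda>j. 1 / (real (k + j))\<^sup>2)" "(\<Sum>j. 1 / (real (k + j))\<^sup>2) \<le> 2 / real k"
    "(\<Sum>j=k..<m. 1 / (real j)\<^sup>2) \<le> 2 / real k"
proof -
  have "(\<lambda>j. 2 / real (k + j)) \<longlonglongrightarrow> 0"
    using LIMSEQ_ignore_initial_segment[OF lim_const_over_n[of "2::real"], of k] by (simp add: add.commute)
  from telescope_sums'[OF this]
  have tel: "(\<lambda>j. 2 / real (k + j) - 2 / real (k + Suc j)) sums (2 / real k)" by simp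
  have le: "1 / (real (k + j))\<^sup>2 \<le> 2 / real (k + j) - 2 / real (k + Suc j)" for j
  proof -
    define x where "x = real (k + j)"
    have x: "x \<ge> 1" using assms by (simp add: x_def)
    have "2 / x - 2 / (x + 1) = 2 / (x * (x + 1))" using x by (simp add: field_simps)
    also have "\<dots> \<ge> 2 / (x * (2 * x))" using x by (intro divide_left_mono mult_left_mono mult_pos_pos) auto
    also have "2 / (x * (2 * x)) = 1 / x\<^sup>2" by (simp add: power2_eq_square)
    finally show ?thesis by (simp add: x_def add_ac)
  qed
  show sm: "summable (\<lambda>j. 1 / (real (k + j))\<^sup>2)"
    using le by (intro summable_comparison_test'[OF sums_summable[OF tel], of 0]) auto
  then show su: "(\<Sum>j. 1 / (real (k + j))\<^sup>2) \<le> 2 / real k"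
    using suminf_le[OF le sm sums_summable[OF tel]] sums_unique[OF tel] by simp
  have "(\<Sum>j=k..<m. 1 / (real j)\<^sup>2) = (\<Sum>j<m-k. 1 / (real (k + j))\<^sup>2)"
    by (intro sum.reindex_bij_witness[of _ "\<lambda>j. k + j" "\<lambda>j. j - k"]) auto
  also have "\<dots> \<le> (\<Sum>j. 1 / (real (k + j))\<^sup>2)"
    by (intro sum_le_suminf sm) auto
  finally show "(\<Sum>j=k..<m. 1 / (real j)\<^sup>2) \<le> 2 / real k" using su by linarith
qed

text \<open>
  The fifth power balances two requirements: the block sums of the noise have a variance of order
  \<open>k powr (-6)\<close>, so that they are below \<open>1 / k\<^sup>2\<close> for all large \<open>k\<close>, while \<open>ln i\<close> still varies by only \<open>5 / k\<close>
  on a block.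
\<close>

definition block :: "nat \<Rightarrow> nat set" where "block k = {k^5..<(Suc k)^5}"

text \<open>31 = 2^5 - 1 is the sum of the lower binomial coefficients, all lower powers of k being
  at most k^4.\<close>

lemma card_block_le:
  assumes "k \<ge> 1" shows "real (card (block k)) \<le> 31 * real k ^ 4"
proof -
  have "(Suc k)^5 = k^5 + 5 * k^4 + 10 * k^3 + 10 * k^2 + 5 * k + 1"
    by (simp add: eval_nat_numeral algebra_simps)
  moreover have "k^3 \<le> k^4" "k^2 \<le> k^4" "k \<le> k^4" "1 \<le> k^4"
    using assms power_increasing[of 3 4 k] power_increasing[of 2 4 k] power_increasing[of 1 4 k] by auto
  ultimately have "card (block k) \<le> 31 * k^4"
    unfolding block_def by simp
  then have "real (card (block k)) \<le> real (31 * k^4)" by (rule of_nat_mono)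
  then show ?thesis by simp
qed

lemma block_ge: "i \<in> block k \<Longrightarrow> k^5 \<le> i" and finite_block: "finite (block k)"
  by (auto simp: block_def)

lemma block_ge_1: "i \<in> block k \<Longrightarrow> k \<ge> 1 \<Longrightarrow> i \<ge> 1"
  using block_ge[of i k] one_le_power[of k 5] by linarith

lemma sum_block_inverse_le:
  assumes "k \<ge> 1" shows "(\<Sum>i\<in>block k. 1 / real i) \<le> 31 / real k"
    "(\<Sum>i\<in>block k. 1 / (real i)\<^sup>2) \<le> 31 / real k ^ 6"
proof -
  have i: "1 / real i \<le> 1 / real k ^ 5" if "i \<in> block k" for i
    using of_nat_mono[OF block_ge[OF that], where 'a = real] assms block_ge_1[OF that assms]
    by (intro divide_left_mono) auto
  have "(\<Sum>i\<in>block k. 1 / real i) \<le> real (card (block k)) * (1 / real k ^ 5)"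
    using i by (rule sum_bounded_above)
  also have "\<dots> \<le> 31 * real k ^ 4 * (1 / real k ^ 5)"
    using card_block_le[OF assms] by (intro mult_right_mono) auto
  also have "\<dots> = 31 / real k" using assms by (simp add: eval_nat_numeral)
  finally show "(\<Sum>i\<in>block k. 1 / real i) \<le> 31 / real k" .
  have "(\<Sum>i\<in>block k. 1 / (real i)\<^sup>2) \<le> real (card (block k)) * (1 / real k ^ 5)\<^sup>2"
  proof (rule sum_bounded_above)
    fix j assume "j \<in> block k"
    from power_mono[OF i[OF this], of 2] show "1 / (real j)\<^sup>2 \<le> (1 / real k ^ 5)\<^sup>2"
      by (simp add: power_divide)
  qed
  also have "\<dots> \<le> 31 * real k ^ 4 * (1 / real k ^ 5)\<^sup>2"
    using card_block_le[OF assms] by (intro mult_right_mono) auto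
  also have "\<dots> = 31 / real k ^ 6" using assms by (simp add: eval_nat_numeral field_simps)
  finally show "(\<Sum>i\<in>block k. 1 / (real i)\<^sup>2) \<le> 31 / real k ^ 6" .
qed

lemma sum_blocks:
  fixes f :: "nat \<Rightarrow> real"
  assumes "k \<le> k'" shows "(\<Sum>i=k^5..<k'^5. f i) = (\<Sum>j=k..<k'. \<Sum>i\<in>block j. f i)"
  using assms
proof (induction k' rule: dec_induct)
  case (step k')
  have "(\<Sum>i=k^5..<(Suc k')^5. f i) = (\<Sum>i=k^5..<k'^5. f i) + (\<Sum>i\<in>block k'. f i)"
    unfolding block_def using step by (intro sum.atLeastLessThan_concat[symmetric] power_mono) auto
  then show ?case using step by simp
qed simp

lemma sum_Suc_eq: "(\<Sum>k<m. f (Suc k)) = (\<Sum>i=1..<Suc m. f i)" for f :: "nat \<Rightarrow> real"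
  by (intro sum.reindex_bij_witness[of _ "\<lambda>i. i - 1" Suc]) auto

text \<open>Only the indices between sqrt x and x are kept. For x \<ge> 4 there are at least x / 4
  of them, each with logarithm at least (ln x) / 2.\<close>

lemma sum_ln_ge:
  fixes x :: real
  assumes "x \<ge> 4"
  shows "(\<Sum>i=1..nat \<lfloor>x\<rfloor>. ln (real i)) \<ge> x * ln x / 8"
proof -
  let ?S = "{nat \<lceil>sqrt x\<rceil>..nat \<lfloor>x\<rfloor>}"
  have sq: "sqrt x * sqrt x = x" "sqrt x \<ge> 2"
    using assms real_le_rsqrt[of 2 x] by (auto simp: power2_eq_square)
  have "2 * sqrt x \<le> sqrt x * sqrt x" using sq by (intro mult_right_mono) auto
  then have half: "sqrt x \<le> x / 2" using sq by simp
  have "real (card ?S) \<ge> real (nat \<lfloor>x\<rfloor>) + 1 - real (nat \<lceil>sqrt x\<rceil>)" by simp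
  moreover have "real (nat \<lfloor>x\<rfloor>) \<ge> x - 1" using assms by linarith
  moreover have "real (nat \<lceil>sqrt x\<rceil>) \<le> sqrt x + 1" using sq by linarith
  ultimately have card: "real (card ?S) \<ge> x / 4" using half assms by linarith
  have "x * ln x / 8 = (x / 4) * (ln x / 2)" by simp
  also have "\<dots> \<le> real (card ?S) * (ln x / 2)"
    using card assms by (intro mult_right_mono) auto
  also have "\<dots> \<le> (\<Sum>i\<in>?S. ln (real i))"
  proof (rule sum_bounded_below)
    fix i assume "i \<in> ?S"
    then have i: "real i \<ge> sqrt x" by (simp add: nat_le_iff ceiling_le_iff)
    then have "ln (sqrt x) \<le> ln (real i)" using assms sq by (subst ln_le_cancel_iff) auto
    then show "ln x / 2 \<le> ln (real i)" using assms by (simp add: ln_sqrt)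
  qed
  also have "\<dots> \<le> (\<Sum>i=1..nat \<lfloor>x\<rfloor>. ln (real i))"
  proof (intro sum_mono2)
    have "1 \<le> nat \<lceil>sqrt x\<rceil>" using sq by linarith
    then show "?S \<subseteq> {1..nat \<lfloor>x\<rfloor>}" by auto
  qed auto
  finally show ?thesis .
qed

text \<open>Here 1/12 is 2/3 from \<open>shr_gain_ge\<close> times 1/8 from
  \<open>sum_ln_ge\<close>. Both constants are functions of \<open>C\<close> outside the locales,
  because \<open>l\<close> has to be fixed before \<open>n\<close> and \<open>\<mu>\<close>.\<close>

definition gain_const :: "real \<Rightarrow> real" where "gain_const C = 1 / (12 * (1 + C\<^sup>2)\<^sup>2)"

definition signal_const :: "real \<Rightarrow> real" where "signal_const C = exp 4 + 1 + C\<^sup>2"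

lemma gain_const_bounds: "0 < gain_const C" "gain_const C \<le> 1"
proof -
  have "1 \<le> (1 + C\<^sup>2)\<^sup>2" by (intro one_le_power) simp
  then have "(1 + C\<^sup>2)\<^sup>2 > 0" "12 * (1 + C\<^sup>2)\<^sup>2 \<ge> 1" by linarith+
  then show "0 < gain_const C" "gain_const C \<le> 1" by (simp_all add: gain_const_def)
qed

lemma signal_const_pos: "0 < signal_const C"
  unfolding signal_const_def by (intro add_pos_nonneg) auto

section \<open>The series in \<open>hn\<close> for a signal in a Sobolev ball\<close>

locale sobolev_model = inverse_model +
  fixes \<mu> :: "nat \<Rightarrow> real" and \<beta> R :: real
  assumes beta_pos: "\<beta> > 0" and mu: "\<mu> \<in> sobolev_ball \<beta> R"
begin

lemma mu_summable: "summable (\<lambda>k. real (Suc k) powr (2*\<beta>) * (\<mu> (Suc k))\<^sup>2)"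
  and mu_suminf_le: "(\<Sum>k. real (Suc k) powr (2*\<beta>) * (\<mu> (Suc k))\<^sup>2) \<le> R\<^sup>2"
proof -
  let ?s = "\<Sum>k. real (Suc k) powr (2*\<beta>) * (\<mu> (Suc k))\<^sup>2"
  show s: "summable (\<lambda>k. real (Suc k) powr (2*\<beta>) * (\<mu> (Suc k))\<^sup>2)"
    using mu by (simp add: sobolev_ball_def)
  have "sqrt ?s \<le> R" using mu by (simp add: sobolev_ball_def)
  then show "?s \<le> R\<^sup>2" by (rule sqrt_le_D)
qed

lemma mu_sq_weight_le: "i \<ge> 1 \<Longrightarrow> (\<mu> i)\<^sup>2 \<le> real i powr (2*\<beta>) * (\<mu> i)\<^sup>2"
  using ge_one_powr_ge_zero[of "real i" "2*\<beta>"] beta_pos mult_right_mono[of 1 "real i powr (2*\<beta>)" "(\<mu> i)\<^sup>2"]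
  by simp

lemma sum_mu_sq_le:
  assumes "finite S" "\<And>i. i \<in> S \<Longrightarrow> i \<ge> 1"
  shows "(\<Sum>i\<in>S. (\<mu> i)\<^sup>2) \<le> R\<^sup>2"
proof -
  have "(\<Sum>i\<in>S. (\<mu> i)\<^sup>2) \<le> (\<Sum>i\<in>S. real i powr (2*\<beta>) * (\<mu> i)\<^sup>2)"
    using assms by (intro sum_mono mu_sq_weight_le) auto
  also have "\<dots> = (\<Sum>k\<in>(\<lambda>i. i - 1) ` S. real (Suc k) powr (2*\<beta>) * (\<mu> (Suc k))\<^sup>2)"
    using assms(2) by (intro sum.reindex_bij_witness[of _ Suc "\<lambda>i. i - 1"]) force+
  also have "\<dots> \<le> R\<^sup>2"
    using sum_le_suminf[OF mu_summable, of "(\<lambda>i. i - 1) ` S"] assms mu_suminf_le by simp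
  finally show ?thesis .
qed

lemma mu_sq_le: "i \<ge> 1 \<Longrightarrow> (\<mu> i)\<^sup>2 \<le> R\<^sup>2"
  using sum_mu_sq_le[of "{i}"] by simp

lemma sig_summable:
  assumes "\<alpha> \<ge> 0" shows "summable (\<lambda>k. sig \<alpha> (Suc k) * (\<mu> (Suc k))\<^sup>2)"
proof (rule summable_comparison_test'[of _ 0])
  show "summable (\<lambda>k. C^4 * (real n)\<^sup>2 * (real (Suc k) powr (2*\<beta>) * (\<mu> (Suc k))\<^sup>2))"
    by (intro summable_mult mu_summable)
  fix k
  have "sig \<alpha> (Suc k) * (\<mu> (Suc k))\<^sup>2 \<le> C^4 * (real n)\<^sup>2 * (real (Suc k) powr (2*\<beta>) * (\<mu> (Suc k))\<^sup>2)"
    using assms C_pos by (intro mult_mono sig_le_const mu_sq_weight_le) auto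
  then show "norm (sig \<alpha> (Suc k) * (\<mu> (Suc k))\<^sup>2) \<le> C^4 * (real n)\<^sup>2 * (real (Suc k) powr (2*\<beta>) * (\<mu> (Suc k))\<^sup>2)"
    using sig_nonneg[of "Suc k" \<alpha>] by simp
qed

abbreviation "h \<equiv> hn n p \<kappa> \<mu>"

lemma hn_eq: "h \<alpha> = expo \<alpha> / (dimn \<alpha> * T) * (\<Sum>k. sig \<alpha> (Suc k) * (\<mu> (Suc k))\<^sup>2)"
  unfolding hn_def sig_def wt_def dimn_def expo_def Let_def by (simp add: mult_ac)

lemma sig_suminf_eq:
  assumes "\<alpha> \<ge> 0" shows "(\<Sum>k. sig \<alpha> (Suc k) * (\<mu> (Suc k))\<^sup>2) = dimn \<alpha> * T / expo \<alpha> * h \<alpha>"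
  using expo_ge_1[OF assms] dimn_pos[of \<alpha>] T_gt_1 by (simp add: hn_eq)

text \<open>For 2 \<alpha> \<le> \<beta> the function is O(1 / T), so it exceeds neither threshold
  near 0 once n is large. This handles the grid point 0, which the infimum over \<alpha> > 0 does
  not see, and keeps the upper crossing away from 0.\<close>

lemma hn_le_smooth:
  assumes "0 \<le> \<alpha>" "2 * \<alpha> \<le> \<beta>"
  shows "h \<alpha> \<le> (1 + \<beta> + 2 * p) * C^4 * R\<^sup>2 / (\<beta> * T)"
proof -
  have "(\<Sum>k. sig \<alpha> (Suc k) * (\<mu> (Suc k))\<^sup>2) \<le> (\<Sum>k. C^4 / \<beta> * dimn \<alpha> * (real (Suc k) powr (2*\<beta>) * (\<mu> (Suc k))\<^sup>2))"
  proof (intro suminf_le sig_summable summable_mult mu_summable assms)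
    fix k
    show "sig \<alpha> (Suc k) * (\<mu> (Suc k))\<^sup>2 \<le> C^4 / \<beta> * dimn \<alpha> * (real (Suc k) powr (2*\<beta>) * (\<mu> (Suc k))\<^sup>2)"
      using mult_right_mono[OF sig_le_smooth[OF _ assms beta_pos, of "Suc k"], of "(\<mu> (Suc k))\<^sup>2"]
      by (simp add: mult_ac)
  qed
  also have "\<dots> = C^4 / \<beta> * dimn \<alpha> * (\<Sum>k. real (Suc k) powr (2*\<beta>) * (\<mu> (Suc k))\<^sup>2)"
    by (intro suminf_mult mu_summable)
  also have "\<dots> \<le> C^4 / \<beta> * dimn \<alpha> * R\<^sup>2"
    using C_pos beta_pos dimn_pos[of \<alpha>] by (intro mult_left_mono mu_suminf_le) auto
  finally have "h \<alpha> \<le> expo \<alpha> / (dimn \<alpha> * T) * (C^4 / \<beta> * dimn \<alpha> * R\<^sup>2)"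
    unfolding hn_eq using expo_ge_1[OF assms(1)] dimn_pos[of \<alpha>] T_gt_1
    by (intro mult_left_mono divide_nonneg_pos) auto
  also have "\<dots> = expo \<alpha> * (C^4 * R\<^sup>2 / (\<beta> * T))" using dimn_pos[of \<alpha>] by simp
  also have "\<dots> \<le> (1 + \<beta> + 2 * p) * (C^4 * R\<^sup>2 / (\<beta> * T))"
    using assms C_pos beta_pos T_gt_1 by (intro mult_right_mono) (auto simp: expo_def)
  finally show ?thesis by simp
qed

lemma sum_sig_le:
  assumes "\<alpha> \<ge> 0" shows "(\<Sum>i=1..<m. sig \<alpha> i * (\<mu> i)\<^sup>2) \<le> dimn \<alpha> * T / expo \<alpha> * h \<alpha>"
proof (cases m)
  case (Suc m')
  have "(\<Sum>k<m'. sig \<alpha> (Suc k) * (\<mu> (Suc k))\<^sup>2) \<le> (\<Sum>k. sig \<alpha> (Suc k) * (\<mu> (Suc k))\<^sup>2)"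
    using sig_nonneg by (intro sum_le_suminf sig_summable assms) auto
  then show ?thesis
    unfolding sum_Suc_eq[of "\<lambda>i. sig \<alpha> i * (\<mu> i)\<^sup>2"] sig_suminf_eq[OF assms] Suc .
next
  case 0
  have "0 \<le> (\<Sum>k. sig \<alpha> (Suc k) * (\<mu> (Suc k))\<^sup>2)"
    using sig_nonneg by (intro suminf_nonneg sig_summable assms) auto
  then show ?thesis unfolding sig_suminf_eq[OF assms] 0 by simp
qed

text \<open>The sum stops at n because \<open>shr_signal_ge\<close> only covers i \<le> n. The loss
  is bounded through \<open>sig_le_tail\<close> and the radius, a multiple of
  \<open>dimn \<alpha>\<close> that is small compared with the main term above the upper
  threshold.\<close>

lemma sum_sig_ge:
  assumes "\<alpha> \<ge> 0"
  shows "(\<Sum>i=1..<Suc n. sig \<alpha> i * (\<mu> i)\<^sup>2) \<ge> dimn \<alpha> * T / expo \<alpha> * h \<alpha> - C^4 / (2 * \<beta>) * dimn \<alpha> * R\<^sup>2"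
proof -
  let ?f = "\<lambda>k. sig \<alpha> (Suc k) * (\<mu> (Suc k))\<^sup>2"
  let ?g = "\<lambda>k. real (Suc k) powr (2*\<beta>) * (\<mu> (Suc k))\<^sup>2"
  have "(\<Sum>k. ?f k) = (\<Sum>k. ?f (k + n)) + (\<Sum>k<n. ?f k)"
    by (intro suminf_split_initial_segment sig_summable assms)
  moreover have "(\<Sum>k. ?f (k + n)) \<le> (\<Sum>k. C^4 / (2 * \<beta>) * dimn \<alpha> * ?g (k + n))"
  proof (intro suminf_le summable_mult)
    fix k
    show "?f (k + n) \<le> C^4 / (2 * \<beta>) * dimn \<alpha> * ?g (k + n)"
      using mult_right_mono[OF sig_le_tail[OF _ assms beta_pos, of "Suc (k + n)"], of "(\<mu> (Suc (k + n)))\<^sup>2"]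
      by (simp add: mult_ac)
    show "summable (\<lambda>k. ?f (k + n))" using sig_summable[OF assms] by (subst summable_iff_shift)
    show "summable (\<lambda>k. ?g (k + n))" using mu_summable by (subst summable_iff_shift)
  qed
  moreover have "(\<Sum>k. C^4 / (2 * \<beta>) * dimn \<alpha> * ?g (k + n)) = C^4 / (2 * \<beta>) * dimn \<alpha> * (\<Sum>k. ?g (k + n))"
    using mu_summable by (intro suminf_mult) (subst summable_iff_shift)
  moreover have "(\<Sum>k. ?g (k + n)) \<le> R\<^sup>2"
    using suminf_split_initial_segment[OF mu_summable, of n] mu_suminf_le sum_nonneg[of "{..<n}" ?g] by simp
  then have "C^4 / (2 * \<beta>) * dimn \<alpha> * (\<Sum>k. ?g (k + n)) \<le> C^4 / (2 * \<beta>) * dimn \<alpha> * R\<^sup>2"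
    using C_pos beta_pos dimn_pos[of \<alpha>] by (intro mult_left_mono) auto
  ultimately show ?thesis
    unfolding sum_Suc_eq[of "\<lambda>i. sig \<alpha> i * (\<mu> i)\<^sup>2"] sig_suminf_eq[OF assms] by linarith
qed

section \<open>Uniform convergence of the likelihood series\<close>

text \<open>The sign is that of minus twice the log-likelihood: maximising \<open>ell\<close> means
  minimising the sum of these terms.\<close>

definition lik :: "real \<Rightarrow> (nat \<Rightarrow> real) \<Rightarrow> nat \<Rightarrow> real" where
  "lik \<alpha> Y i = lgt \<alpha> i - shr \<alpha> i * (real n * (Y i)\<^sup>2)"

abbreviation "xi \<equiv> noise n \<kappa> \<mu>"

lemma ell_eq: "ell n \<kappa> Y \<alpha> = - 1/2 * (\<Sum>k. lik \<alpha> Y (Suc k))"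
  unfolding ell_def lik_def lgt_def shr_def wt_def Let_def by (simp add: power2_eq_square mult_ac)

definition signal_bound :: real where "signal_bound = 1 + real n * C\<^sup>2 * R\<^sup>2"

lemma signal_bound_ge_1: "signal_bound \<ge> 1" by (simp add: signal_bound_def)

lemma signal_le: assumes "i \<ge> 1" shows "real n * (\<kappa> i * \<mu> i)\<^sup>2 \<le> signal_bound - 1"
proof -
  have "(\<kappa> i)\<^sup>2 * (\<mu> i)\<^sup>2 \<le> C\<^sup>2 * R\<^sup>2"
    using kappa_sq_le[OF assms] mu_sq_le[OF assms] by (intro mult_mono) auto
  from mult_left_mono[OF this, of "real n"] show ?thesis
    by (simp add: signal_bound_def power_mult_distrib mult_ac)
qed

text \<open>Neither sum contains \<alpha>, so one event serves all \<alpha> in [0, T]. The sums with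
  \<open>\<kappa>\<^sup>2 / i\<close> control the leading part of the likelihood noise, those with
  \<open>1 / i\<close> the absolute sums of the noise that bound the errors of
  approximation.\<close>

definition tail_event :: "nat \<Rightarrow> (nat \<Rightarrow> real) set" where
  "tail_event K = (\<Inter>k\<in>{K..}. {Y. \<bar>\<Sum>i\<in>block k. ((\<kappa> i)\<^sup>2 / real i) * xi Y i\<bar> < 1 / (real k)\<^sup>2} \<inter>
     {Y. \<bar>\<Sum>i\<in>block k. (1 / real i) * xi Y i\<bar> < 1 / (real k)\<^sup>2})"

lemma noise_sum_sets: "{Y. \<bar>\<Sum>i\<in>S. c i * xi Y i\<bar> < t} \<in> sets (P0 n \<kappa> \<mu>)"
  "{Y. \<bar>\<Sum>i\<in>S. c i * xi Y i\<bar> \<ge> t} \<in> sets (P0 n \<kappa> \<mu>)"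
proof -
  have "{Y \<in> space (P0 n \<kappa> \<mu>). \<bar>\<Sum>i\<in>S. c i * xi Y i\<bar> < t} \<in> sets (P0 n \<kappa> \<mu>)"
    "{Y \<in> space (P0 n \<kappa> \<mu>). \<bar>\<Sum>i\<in>S. c i * xi Y i\<bar> \<ge> t} \<in> sets (P0 n \<kappa> \<mu>)"
    by measurable
  then show "{Y. \<bar>\<Sum>i\<in>S. c i * xi Y i\<bar> < t} \<in> sets (P0 n \<kappa> \<mu>)"
    "{Y. \<bar>\<Sum>i\<in>S. c i * xi Y i\<bar> \<ge> t} \<in> sets (P0 n \<kappa> \<mu>)"
    by (simp_all add: space_P0)
qed

lemma tail_event_sets: "tail_event K \<in> sets (P0 n \<kappa> \<mu>)"
  unfolding tail_event_def using sets.top[of "P0 n \<kappa> \<mu>"]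
  by (intro sets.countable_INT'' sets.Int noise_sum_sets) (auto simp: space_P0)

text \<open>Used with \<open>c = \<kappa>\<^sup>2\<close> and with \<open>c = 1\<close>, both
  satisfying the bound by \<open>C^4\<close>. The variance is of order k^-6 and the squared
  threshold k^-4, which leaves a summable k^-2; 124 = 4 * 31.\<close>

lemma block_noise_prob:
  assumes "k \<ge> 1" "\<And>i. i \<ge> 1 \<Longrightarrow> (c i)\<^sup>2 \<le> C^4" 
  shows "measure (P0 n \<kappa> \<mu>) {Y. \<bar>\<Sum>i\<in>block k. (c i / real i) * xi Y i\<bar> \<ge> 1 / (real k)\<^sup>2}
    \<le> 124 * C^4 * signal_bound * (1 / (real k)\<^sup>2)"
proof -
  have "measure (P0 n \<kappa> \<mu>) {Y. \<bar>\<Sum>i\<in>block k. (c i / real i) * xi Y i\<bar> \<ge> 1 / (real k)\<^sup>2}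
     \<le> (\<Sum>i\<in>block k. (c i / real i)\<^sup>2 * (2 + 4 * real n * (\<kappa> i * \<mu> i)\<^sup>2)) / (1 / (real k)\<^sup>2)\<^sup>2"
    using assms n_ge_3 by (intro noise_sum_tail_prob finite_block) auto
  also have "\<dots> \<le> (\<Sum>i\<in>block k. (4 * C^4 * signal_bound) * (1 / (real i)\<^sup>2)) / (1 / (real k)\<^sup>2)\<^sup>2"
  proof (intro divide_right_mono sum_mono)
    fix i assume "i \<in> block k"
    then have i: "i \<ge> 1" using block_ge_1 assms by auto
    have "(c i / real i)\<^sup>2 * (2 + 4 * real n * (\<kappa> i * \<mu> i)\<^sup>2) \<le> (C^4 * (1 / (real i)\<^sup>2)) * (4 * signal_bound)"
    proof (rule mult_mono)
      show "(c i / real i)\<^sup>2 \<le> C^4 * (1 / (real i)\<^sup>2)"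
        using divide_right_mono[OF assms(2)[OF i], of "(real i)\<^sup>2"] by (simp add: power_divide)
      show "2 + 4 * real n * (\<kappa> i * \<mu> i)\<^sup>2 \<le> 4 * signal_bound"
        using signal_le[OF i] by simp
    qed auto
    then show "(c i / real i)\<^sup>2 * (2 + 4 * real n * (\<kappa> i * \<mu> i)\<^sup>2) \<le> (4 * C^4 * signal_bound) * (1 / (real i)\<^sup>2)"
      by (simp add: mult_ac)
  qed auto
  also have "\<dots> = (4 * C^4 * signal_bound) * (\<Sum>i\<in>block k. 1 / (real i)\<^sup>2) / (1 / (real k)\<^sup>2)\<^sup>2"
    by (simp only: sum_distrib_left)
  also have "\<dots> \<le> (4 * C^4 * signal_bound) * (31 / real k ^ 6) / (1 / (real k)\<^sup>2)\<^sup>2"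
    using sum_block_inverse_le(2)[OF assms(1)] C_pos signal_bound_ge_1 by (intro divide_right_mono mult_left_mono) auto
  also have "\<dots> = 124 * C^4 * signal_bound * (1 / (real k)\<^sup>2)"
    using assms(1) by (simp add: power_divide eval_nat_numeral)
  finally show ?thesis .
qed

text \<open>A countable union bound: 496 = 2 * 2 * 124, for two sums per block and the bound 2 / K
  on the tail of the series of inverse squares.\<close>

lemma tail_event_prob:
  assumes "K \<ge> 1"
  shows "measure (P0 n \<kappa> \<mu>) (tail_event K) \<ge> 1 - 496 * C^4 * signal_bound / real K"
proof -
  interpret prob_space "P0 n \<kappa> \<mu>" using n_ge_3 by (intro prob_space_P0) auto
  define A where "A = (\<lambda>k. {Y. \<bar>\<Sum>i\<in>block k. ((\<kappa> i)\<^sup>2 / real i) * xi Y i\<bar> \<ge> 1 / (real k)\<^sup>2} \<union>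
     {Y. \<bar>\<Sum>i\<in>block k. (1 / real i) * xi Y i\<bar> \<ge> 1 / (real k)\<^sup>2})"
  have As: "A k \<in> events" for k unfolding A_def by (intro sets.Un noise_sum_sets)
  have Ap: "prob (A k) \<le> 248 * C^4 * signal_bound * (1 / (real k)\<^sup>2)" if "k \<ge> 1" for k
  proof -
    have "prob (A k) \<le> prob {Y. \<bar>\<Sum>i\<in>block k. ((\<kappa> i)\<^sup>2 / real i) * xi Y i\<bar> \<ge> 1 / (real k)\<^sup>2}
       + prob {Y. \<bar>\<Sum>i\<in>block k. (1 / real i) * xi Y i\<bar> \<ge> 1 / (real k)\<^sup>2}"
      unfolding A_def by (intro measure_Un_le noise_sum_sets)
    also have "\<dots> \<le> 124 * C^4 * signal_bound * (1 / (real k)\<^sup>2) + 124 * C^4 * signal_bound * (1 / (real k)\<^sup>2)"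
    proof (intro add_mono block_noise_prob that)
      fix i :: nat assume "i \<ge> 1"
      from power_mono[OF kappa_sq_le[OF this], of 2]
      show "((\<kappa> i)\<^sup>2)\<^sup>2 \<le> C^4" by (simp add: power_mult[symmetric])
    qed (use C_ge_1 in \<open>auto simp: one_le_power\<close>)
    finally show ?thesis by (simp add: mult_ac)
  qed
  have cA: "space (P0 n \<kappa> \<mu>) - tail_event K = (\<Union>j. A (K + j))"
  proof -
    define B where "B = (\<lambda>k. {Y. \<bar>\<Sum>i\<in>block k. ((\<kappa> i)\<^sup>2 / real i) * xi Y i\<bar> < 1 / (real k)\<^sup>2} \<inter>
      {Y. \<bar>\<Sum>i\<in>block k. (1 / real i) * xi Y i\<bar> < 1 / (real k)\<^sup>2})"
    have "A k = - B k" for k by (auto simp: A_def B_def not_less)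
    moreover have "tail_event K = (\<Inter>k\<in>range (\<lambda>j. K + j). B k)"
      unfolding tail_event_def B_def by (intro INF_cong) (auto simp: image_iff nat_le_iff_add)
    ultimately show ?thesis unfolding space_P0 by auto
  qed
  have le: "prob (A (K + j)) \<le> 248 * C^4 * signal_bound * (1 / (real (K + j))\<^sup>2)" for j
    using assms by (intro Ap) auto
  have sm: "summable (\<lambda>j. 248 * C^4 * signal_bound * (1 / (real (K + j))\<^sup>2))"
    by (intro summable_mult sum_inverse_squares_le assms)
  have sA: "summable (\<lambda>j. prob (A (K + j)))"
    using le by (intro summable_comparison_test'[OF sm, of 0]) auto
  have "prob (\<Union>j. A (K + j)) \<le> (\<Sum>j. prob (A (K + j)))"
    using As sA by (intro finite_measure_subadditive_countably) auto
  also have "\<dots> \<le> (\<Sum>j. 248 * C^4 * signal_bound * (1 / (real (K + j))\<^sup>2))"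
    by (intro suminf_le le sA sm)
  also have "\<dots> = 248 * C^4 * signal_bound * (\<Sum>j. 1 / (real (K + j))\<^sup>2)"
    by (intro suminf_mult sum_inverse_squares_le assms)
  also have "\<dots> \<le> 248 * C^4 * signal_bound * (2 / real K)"
    using C_pos signal_bound_ge_1 by (intro mult_left_mono sum_inverse_squares_le assms) auto
  finally have "prob (space (P0 n \<kappa> \<mu>) - tail_event K) \<le> 496 * C^4 * signal_bound / real K"
    unfolding cA by simp
  then show ?thesis using prob_compl[OF tail_event_sets[of K]] by simp
qed

text \<open>Noise is bounded below by \<open>- signal_bound\<close>, so its absolute value is at
  most the noise plus \<open>2 * signal_bound\<close>. A signed sum thereby controls an absolute
  one, and no further moments are required; 63 = 1 + 2 * 31.\<close>

lemma block_abs_noise_le: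
  assumes "Y \<in> tail_event K" "K \<le> k" "1 \<le> k"
  shows "(\<Sum>i\<in>block k. \<bar>xi Y i\<bar> / real i) \<le> 63 * signal_bound / real k"
proof -
  have "\<bar>xi Y i\<bar> / real i \<le> (1 / real i) * xi Y i + 2 * signal_bound * (1 / real i)" if "i \<in> block k" for i
  proof -
    have i: "i \<ge> 1" using block_ge_1[OF that assms(3)] .
    have "\<bar>xi Y i\<bar> \<le> xi Y i + 2 * signal_bound"
    proof -
      have "0 \<le> real n * (Y i)\<^sup>2" by simp
      then show ?thesis using signal_le[OF i] signal_bound_ge_1 unfolding noise_def by linarith
    qed
    from divide_right_mono[OF this, of "real i"] show ?thesis by (simp add: add_divide_distrib)
  qed
  then have "(\<Sum>i\<in>block k. \<bar>xi Y i\<bar> / real i) \<le> (\<Sum>i\<in>block k. (1 / real i) * xi Y i + 2 * signal_bound * (1 / real i))"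
    by (rule sum_mono)
  also have "\<dots> = (\<Sum>i\<in>block k. (1 / real i) * xi Y i) + 2 * signal_bound * (\<Sum>i\<in>block k. 1 / real i)"
    by (simp only: sum.distrib sum_distrib_left)
  also have "\<dots> \<le> signal_bound / real k + 2 * signal_bound * (31 / real k)"
  proof (intro add_mono mult_left_mono sum_block_inverse_le assms)
    have "\<bar>\<Sum>i\<in>block k. (1 / real i) * xi Y i\<bar> < 1 / (real k)\<^sup>2"
      using assms unfolding tail_event_def by auto
    moreover have "1 / (real k)\<^sup>2 \<le> signal_bound / real k"
      using assms(3) signal_bound_ge_1 by (intro frac_le) (auto simp: power2_eq_square)
    ultimately show "(\<Sum>i\<in>block k. (1 / real i) * xi Y i) \<le> signal_bound / real k" by linarith
  qed (use signal_bound_ge_1 in auto)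
  finally show ?thesis by (simp add: add_divide_distrib[symmetric])
qed

text \<open>726 = 31 + 631 + 63 + 1 collects the four parts of \<open>block_bounds\<close>. The
  growth is of order n^3, so a cut at block \<open>n^4\<close> makes the tail negligible.\<close>

definition block_const :: real where "block_const = 726 * (real n)\<^sup>2 * C^4 * signal_bound"

lemma block_const_nonneg: "block_const \<ge> 0" using signal_bound_ge_1 C_pos by (simp add: block_const_def)

lemma ratio_le_div: assumes "i \<ge> 1" "\<alpha> \<ge> 0" shows "real n / wt \<alpha> i \<le> real n * C\<^sup>2 / real i"
proof -
  have "real i powr 1 \<le> real i powr expo \<alpha>" using assms expo_ge_1 by (intro powr_mono) auto
  then have "C\<^sup>2 * real n / real i powr expo \<alpha> \<le> C\<^sup>2 * real n / real i"
    using assms by (intro divide_left_mono) auto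
  then show ?thesis using ratio_le[OF assms(1), of \<alpha>] by (simp add: mult.commute)
qed

lemma shr_le_ratio: assumes "i \<ge> 1" shows "shr \<alpha> i \<le> real n / wt \<alpha> i"
  unfolding shr_def using wt_pos[OF assms, of \<alpha>] n_pos by (intro divide_left_mono) auto

text \<open>Replacing \<open>shr\<close> by \<open>n / wt\<close> costs the product of the two,
  which is of second order in 1 / i. The gain is that \<open>n / wt\<close> factors into
  \<open>\<kappa>\<^sup>2 / i\<close> and the pure power that is frozen on a block.\<close>

lemma ratio_minus_shr:
  assumes "i \<ge> 1" "\<alpha> \<ge> 0"
  shows "0 \<le> real n / wt \<alpha> i - shr \<alpha> i" "real n / wt \<alpha> i - shr \<alpha> i \<le> (real n)\<^sup>2 * C^4 * (1 / (real i)\<^sup>2)"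
proof -
  show "0 \<le> real n / wt \<alpha> i - shr \<alpha> i" using shr_le_ratio[OF assms(1)] by simp
  have w: "wt \<alpha> i > 0" by (rule wt_pos[OF assms(1)])
  have "real n / wt \<alpha> i - shr \<alpha> i = (real n / wt \<alpha> i) * shr \<alpha> i"
    using w n_pos by (simp add: shr_def divide_simps) (simp add: algebra_simps)
  also have "\<dots> \<le> (real n * C\<^sup>2 / real i) * (real n * C\<^sup>2 / real i)"
    using ratio_le_div[OF assms] shr_le_ratio[OF assms(1), of \<alpha>] shr_pos[OF assms(1), of \<alpha>] w
    by (intro mult_mono) (auto intro: order_trans)
  also have "\<dots> = (real n)\<^sup>2 * C^4 * (1 / (real i)\<^sup>2)"
    by (simp add: power2_eq_square power4_eq_xxxx mult_ac)
  finally show "real n / wt \<alpha> i - shr \<alpha> i \<le> (real n)\<^sup>2 * C^4 * (1 / (real i)\<^sup>2)" .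
qed

text \<open>On a block \<open>ln i\<close> varies by at most 5 / k, and exp (-2 \<alpha> x) is
  Lipschitz in x \<ge> 0 with constant 2 \<alpha>.\<close>

lemma block_power_diff:
  assumes "i \<in> block k" "k \<ge> 1" "\<alpha> \<ge> 0"
  shows "\<bar>real i powr (-2*\<alpha>) - (real k ^ 5) powr (-2*\<alpha>)\<bar> \<le> 10 * \<alpha> / real k"
proof -
  define a b where "a = ln (real k ^ 5)" and "b = ln (real i)"
  have k: "real k \<ge> 1" using assms by simp
  have i: "i \<ge> 1" using block_ge_1 assms by auto
  have "real k ^ 5 \<le> real i" using of_nat_mono[OF block_ge[OF assms(1)], where 'a = real] by simp
  then have ab: "a \<le> b" using k i by (simp add: a_def b_def)
  have "i \<le> (Suc k)^5" using assms(1) by (simp add: block_def)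
  then have "real i \<le> real (Suc k) ^ 5" by (metis of_nat_le_iff of_nat_power)
  then have "b \<le> ln (real (Suc k) ^ 5)" using i by (simp add: b_def)
  also have "\<dots> - a = 5 * (ln (real (Suc k)) - ln (real k))" using k by (simp add: a_def ln_realpow)
  also have "ln (real (Suc k)) - ln (real k) = ln (1 + 1 / real k)"
    using k ln_div[of "real (Suc k)" "real k"] by (simp add: add_divide_distrib add.commute)
  also have "\<dots> \<le> 1 / real k" by (intro ln_add_one_self_le_self) auto
  finally have ba: "b - a \<le> 5 / real k" by simp
  have a0: "a \<ge> 0" using k by (simp add: a_def)
  have eq: "real i powr (-2*\<alpha>) = exp (-2*\<alpha>*b)" "(real k ^ 5) powr (-2*\<alpha>) = exp (-2*\<alpha>*a)"
    using i k by (simp_all add: powr_def a_def b_def)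
  have "exp (-2*\<alpha>*a) - exp (-2*\<alpha>*b) = exp (-2*\<alpha>*a) * (1 - exp (-(2*\<alpha>*(b - a))))"
    by (simp add: right_diff_distrib exp_add[symmetric] algebra_simps)
  also have "\<dots> \<le> 1 * (2*\<alpha>*(b - a))"
    using assms(3) a0 ab exp_ge_add_one_self[of "-(2*\<alpha>*(b - a))"] by (intro mult_mono) auto
  also have "\<dots> \<le> 2 * \<alpha> * (5 / real k)" using mult_left_mono[OF ba, of "2 * \<alpha>"] assms(3) by simp
  finally have "exp (-2*\<alpha>*a) - exp (-2*\<alpha>*b) \<le> 10 * \<alpha> / real k" by simp
  moreover have "exp (-2*\<alpha>*b) \<le> exp (-2*\<alpha>*a)" using ab assms(3) by (simp add: mult_left_mono)
  ultimately show ?thesis unfolding eq by simp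
qed


section \<open>Estimates on a single block and their summation\<close>

lemma lik_decomp:
  "lik \<alpha> Y i = (lgt \<alpha> i - shr \<alpha> i) - shr \<alpha> i * xi Y i - shr \<alpha> i * (real n * (\<kappa> i * \<mu> i)\<^sup>2)"
  by (simp add: lik_def noise_def algebra_simps)

lemma ratio_eq:
  assumes "i \<ge> 1"
  shows "real n / wt \<alpha> i = real n * (((\<kappa> i)\<^sup>2 / real i) * real i powr (-2*\<alpha>))"
  using kappa_pos[OF assms] assms
  by (simp add: wt_def powr_add powr_minus field_simps)

text \<open>The block sum splits into a deterministic part \<open>a\<close>, the noise
  \<open>m\<close> with linearised coefficients, the linearisation error \<open>e\<close> and the
  signal \<open>s\<close>. Cancellation is needed in \<open>m\<close> alone; the rest is bounded
  termwise. The first bound is summable over full blocks, the weaker second one covers an incomplete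
  block.\<close>

lemma block_bounds:
  assumes "Y \<in> tail_event K" "K \<le> k" "1 \<le> k" "0 \<le> \<alpha>" "\<alpha> \<le> T"
  shows "\<bar>\<Sum>i\<in>block k. lik \<alpha> Y i\<bar> \<le> block_const / (real k)\<^sup>2" (is ?A)
    and "(\<Sum>i\<in>block k. \<bar>lik \<alpha> Y i\<bar>) \<le> block_const / real k" (is ?B)
proof -
  define H where "H = (\<Sum>i\<in>block k. \<bar>xi Y i\<bar> / real i)"
  define c where "c = (\<lambda>i. (\<kappa> i)\<^sup>2 / real i)"
  define q where "q = (real k ^ 5) powr (-2*\<alpha>)"
  define N2 where "N2 = (real n)\<^sup>2 * C^4"
  have k1: "real k \<ge> 1" using assms by simp
  have ge1: "i \<ge> 1" if "i \<in> block k" for i using block_ge_1[OF that assms(3)] .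
  have H: "0 \<le> H" "H \<le> 63 * signal_bound / real k"
    using block_abs_noise_le[OF assms(1-3)] by (auto simp: H_def intro!: sum_nonneg)
  have N2: "N2 \<ge> real n * C\<^sup>2" "real n * C\<^sup>2 \<ge> 1" "N2 \<ge> 0"
  proof -
    show "real n * C\<^sup>2 \<ge> 1" using mult_mono[of 1 "real n" 1 "C\<^sup>2"] C2_ge_1 n_ge_3 by simp
    then have "real n * C\<^sup>2 * 1 \<le> (real n * C\<^sup>2) * (real n * C\<^sup>2)" by (intro mult_left_mono) auto
    also have "\<dots> = N2" by (simp add: N2_def power2_eq_square power4_eq_xxxx mult_ac)
    finally show "N2 \<ge> real n * C\<^sup>2" by simp
    show "N2 \<ge> 0" by (simp add: N2_def)
  qed
  have inv_le: "1 / real i \<le> 1 / real k ^ 5" if "i \<in> block k" for i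
    using of_nat_mono[OF block_ge[OF that], where 'a = real] assms(3) ge1[OF that]
    by (intro divide_left_mono) auto
  have kp: "1 / real k ^ 5 \<le> 1 / (real k)\<^sup>2" "1 / real k ^ 6 \<le> 1 / (real k)\<^sup>2" "1 / (real k)\<^sup>2 \<le> 1 / real k"
    "1 / real k ^ 5 \<le> 1 / real k"
    using k1 power_increasing[of 2 5 "real k"] power_increasing[of 2 6 "real k"]
      power_increasing[of 1 2 "real k"] power_increasing[of 1 5 "real k"] by (auto intro!: divide_left_mono)

  define a where "a = (\<Sum>i\<in>block k. lgt \<alpha> i - shr \<alpha> i)"
  have a_term: "0 \<le> lgt \<alpha> i - shr \<alpha> i" if "i \<in> block k" for i
    using shr_le_lgt[OF ge1[OF that], of \<alpha>] by simp
  have a: "0 \<le> a" "a \<le> 31 * N2 * (1 / (real k)\<^sup>2)"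
  proof -
    show "0 \<le> a" unfolding a_def by (intro sum_nonneg a_term)
    have "a \<le> (\<Sum>i\<in>block k. N2 * (1 / (real i)\<^sup>2))"
      unfolding a_def N2_def
    proof (intro sum_mono)
      fix i assume "i \<in> block k"
      from ge1[OF this] show "lgt \<alpha> i - shr \<alpha> i \<le> (real n)\<^sup>2 * C^4 * (1 / (real i)\<^sup>2)"
        using ratio_minus_shr(2)[of i \<alpha>] lgt_le[of i \<alpha>] assms(4) by simp
    qed
    also have "\<dots> = N2 * (\<Sum>i\<in>block k. 1 / (real i)\<^sup>2)" by (simp only: sum_distrib_left)
    also have "\<dots> \<le> N2 * (31 / real k ^ 6)"
      using N2 by (intro mult_left_mono sum_block_inverse_le assms) auto
    also have "\<dots> = 31 * N2 * (1 / real k ^ 6)" by simp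
    also have "\<dots> \<le> 31 * N2 * (1 / (real k)\<^sup>2)" using N2 kp by (intro mult_left_mono) auto
    finally show "a \<le> 31 * N2 * (1 / (real k)\<^sup>2)" .
  qed

  define s where "s = (\<Sum>i\<in>block k. shr \<alpha> i * (real n * (\<kappa> i * \<mu> i)\<^sup>2))"
  have s_term: "0 \<le> shr \<alpha> i * (real n * (\<kappa> i * \<mu> i)\<^sup>2)" if "i \<in> block k" for i
    using shr_pos[OF ge1[OF that], of \<alpha>] by simp
  have shr_le: "shr \<alpha> i \<le> real n * C\<^sup>2 * (1 / real i)" if "i \<in> block k" for i
    using shr_le_ratio[OF ge1[OF that], of \<alpha>] ratio_le_div[OF ge1[OF that] assms(4)] by simp
  have s: "0 \<le> s" "s \<le> N2 * signal_bound * (1 / (real k)\<^sup>2)"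
  proof -
    show "0 \<le> s" unfolding s_def by (intro sum_nonneg s_term)
    have "s \<le> (\<Sum>i\<in>block k. (real n * C\<^sup>2 * (1 / real k ^ 5)) * (real n * C\<^sup>2 * (\<mu> i)\<^sup>2))"
      unfolding s_def
    proof (rule sum_mono, rule mult_mono)
      fix i assume i: "i \<in> block k"
      have "real n * C\<^sup>2 * (1 / real i) \<le> real n * C\<^sup>2 * (1 / real k ^ 5)"
        using inv_le[OF i] N2 by (intro mult_left_mono) auto
      then show "shr \<alpha> i \<le> real n * C\<^sup>2 * (1 / real k ^ 5)" using shr_le[OF i] by linarith
      show "real n * (\<kappa> i * \<mu> i)\<^sup>2 \<le> real n * C\<^sup>2 * (\<mu> i)\<^sup>2"
        using kappa_sq_le[OF ge1[OF i]] by (simp add: power_mult_distrib mult.assoc mult_left_mono mult_right_mono)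
    qed (use N2 in auto)
    also have "\<dots> = (real n * C\<^sup>2 * (1 / real k ^ 5)) * (real n * C\<^sup>2) * (\<Sum>i\<in>block k. (\<mu> i)\<^sup>2)"
      unfolding sum_distrib_left by (intro sum.cong refl) (simp add: mult_ac)
    also have "\<dots> \<le> (real n * C\<^sup>2 * (1 / real k ^ 5)) * (real n * C\<^sup>2) * R\<^sup>2"
      using ge1 by (intro mult_left_mono sum_mu_sq_le finite_block) auto
    also have "\<dots> = real n * C\<^sup>2 * (real n * C\<^sup>2 * R\<^sup>2) * (1 / real k ^ 5)" by (simp add: mult_ac)
    also have "\<dots> \<le> N2 * signal_bound * (1 / (real k)\<^sup>2)"
      using N2 signal_bound_ge_1 kp by (intro mult_mono) (auto simp: signal_bound_def)
    finally show "s \<le> N2 * signal_bound * (1 / (real k)\<^sup>2)" .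
  qed

  define e where "e = (\<Sum>i\<in>block k. (real n / wt \<alpha> i - shr \<alpha> i) * xi Y i)"
  have e: "\<bar>e\<bar> \<le> 63 * N2 * signal_bound * (1 / (real k)\<^sup>2)"
  proof -
    have "\<bar>e\<bar> \<le> (\<Sum>i\<in>block k. \<bar>(real n / wt \<alpha> i - shr \<alpha> i) * xi Y i\<bar>)"
      unfolding e_def by (rule sum_abs)
    also have "\<dots> \<le> (\<Sum>i\<in>block k. N2 * (1 / real k ^ 5) * (\<bar>xi Y i\<bar> / real i))"
    proof (intro sum_mono)
      fix i assume i: "i \<in> block k"
      have "\<bar>(real n / wt \<alpha> i - shr \<alpha> i) * xi Y i\<bar> = (real n / wt \<alpha> i - shr \<alpha> i) * \<bar>xi Y i\<bar>"
        using ratio_minus_shr(1)[OF ge1[OF i] assms(4)] by (simp add: abs_mult)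
      also have "\<dots> \<le> N2 * (1 / (real i)\<^sup>2) * \<bar>xi Y i\<bar>"
        using ratio_minus_shr(2)[OF ge1[OF i] assms(4)] by (intro mult_right_mono) (auto simp: N2_def)
      also have "\<dots> = N2 * (1 / real i) * (\<bar>xi Y i\<bar> / real i)" by (simp add: power2_eq_square)
      also have "\<dots> \<le> N2 * (1 / real k ^ 5) * (\<bar>xi Y i\<bar> / real i)"
        using inv_le[OF i] N2 by (intro mult_right_mono mult_left_mono) auto
      finally show "\<bar>(real n / wt \<alpha> i - shr \<alpha> i) * xi Y i\<bar> \<le> N2 * (1 / real k ^ 5) * (\<bar>xi Y i\<bar> / real i)" .
    qed
    also have "\<dots> = N2 * (1 / real k ^ 5) * H" by (simp only: H_def sum_distrib_left)
    also have "\<dots> \<le> N2 * (1 / (real k)\<^sup>2) * (63 * signal_bound)"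
    proof (rule mult_mono)
      show "N2 * (1 / real k ^ 5) \<le> N2 * (1 / (real k)\<^sup>2)" using kp N2 by (intro mult_left_mono)
      have "63 * signal_bound / real k \<le> 63 * signal_bound / 1" using signal_bound_ge_1 k1 by (intro divide_left_mono) auto
      then show "H \<le> 63 * signal_bound" using H by simp
    qed (use N2 H in auto)
    finally show ?thesis by (simp add: mult_ac)
  qed

  define m where "m = (\<Sum>i\<in>block k. (real n / wt \<alpha> i) * xi Y i)"
  have m: "\<bar>m\<bar> \<le> 631 * N2 * signal_bound * (1 / (real k)\<^sup>2)"
  proof -
    define r where "r = (\<lambda>i. real i powr (-2*\<alpha>) - q)"
    have q: "0 \<le> q" "q \<le> 1"
    proof -
      have "q \<le> (real k ^ 5) powr 0" unfolding q_def using assms(4) k1 by (intro powr_mono) auto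
      then show "q \<le> 1" using k1 by simp
    qed (simp add: q_def)
    have "m = (\<Sum>i\<in>block k. real n * (q * (c i * xi Y i)) + real n * (r i * c i * xi Y i))"
      unfolding m_def r_def c_def by (intro sum.cong refl) (simp add: ratio_eq[OF ge1] algebra_simps)
    also have "\<dots> = real n * q * (\<Sum>i\<in>block k. c i * xi Y i) + real n * (\<Sum>i\<in>block k. r i * c i * xi Y i)"
      by (simp add: sum.distrib sum_distrib_left mult.assoc)
    finally have m_eq: "m = real n * q * (\<Sum>i\<in>block k. c i * xi Y i) + real n * (\<Sum>i\<in>block k. r i * c i * xi Y i)" .
    have D: "\<bar>\<Sum>i\<in>block k. c i * xi Y i\<bar> \<le> 1 / (real k)\<^sup>2"
      using assms(1,2) unfolding tail_event_def c_def by (auto intro: less_imp_le)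
    have "\<bar>\<Sum>i\<in>block k. r i * c i * xi Y i\<bar> \<le> (\<Sum>i\<in>block k. \<bar>r i * c i * xi Y i\<bar>)" by (rule sum_abs)
    also have "\<dots> \<le> (\<Sum>i\<in>block k. (10 * \<alpha> / real k) * C\<^sup>2 * (\<bar>xi Y i\<bar> / real i))"
    proof (intro sum_mono)
      fix i assume i: "i \<in> block k"
      have "\<bar>r i * c i * xi Y i\<bar> = \<bar>r i\<bar> * (\<kappa> i)\<^sup>2 * (\<bar>xi Y i\<bar> / real i)"
        by (simp add: abs_mult c_def)
      also have "\<dots> \<le> (10 * \<alpha> / real k) * C\<^sup>2 * (\<bar>xi Y i\<bar> / real i)"
        using block_power_diff[OF i assms(3,4)] kappa_sq_le[OF ge1[OF i]] assms(4)
        by (intro mult_right_mono mult_mono) (auto simp: r_def q_def)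
      finally show "\<bar>r i * c i * xi Y i\<bar> \<le> (10 * \<alpha> / real k) * C\<^sup>2 * (\<bar>xi Y i\<bar> / real i)" .
    qed
    also have "\<dots> = (10 * \<alpha> / real k) * C\<^sup>2 * H" by (simp only: H_def sum_distrib_left)
    \<comment> \<open>The only use of \<alpha> \<le> T: it is replaced by the crude bound n, which
      makes the estimate uniform in \<alpha>.\<close>
    also have "\<dots> \<le> (10 * real n / real k) * C\<^sup>2 * (63 * signal_bound / real k)"
      using assms(4,5) H ln_le_minus_one[of "real n"] n_pos
      by (intro mult_mono divide_right_mono) auto
    also have "\<dots> = 630 * (real n * C\<^sup>2) * signal_bound * (1 / (real k)\<^sup>2)" by (simp add: power2_eq_square)
    finally have E: "\<bar>\<Sum>i\<in>block k. r i * c i * xi Y i\<bar> \<le> 630 * (real n * C\<^sup>2) * signal_bound * (1 / (real k)\<^sup>2)" .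
    have "\<bar>m\<bar> \<le> real n * q * \<bar>\<Sum>i\<in>block k. c i * xi Y i\<bar> + real n * \<bar>\<Sum>i\<in>block k. r i * c i * xi Y i\<bar>"
      unfolding m_eq using q by (intro order_trans[OF abs_triangle_ineq]) (simp add: abs_mult)
    also have "\<dots> \<le> real n * 1 * (1 / (real k)\<^sup>2) + real n * (630 * (real n * C\<^sup>2) * signal_bound * (1 / (real k)\<^sup>2))"
      using q D E by (intro add_mono mult_mono mult_left_mono) auto
    also have "\<dots> = (real n + 630 * ((real n)\<^sup>2 * C\<^sup>2) * signal_bound) * (1 / (real k)\<^sup>2)"
      by (simp add: algebra_simps power2_eq_square add_divide_distrib)
    also have "\<dots> \<le> (N2 * signal_bound + 630 * N2 * signal_bound) * (1 / (real k)\<^sup>2)"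
    proof (rule mult_right_mono, rule add_mono)
      have "(real n)\<^sup>2 * C\<^sup>2 \<le> N2"
        unfolding N2_def using C_ge_1 by (intro mult_left_mono power_increasing) auto
      then show "630 * ((real n)\<^sup>2 * C\<^sup>2) * signal_bound \<le> 630 * N2 * signal_bound" using signal_bound_ge_1 by (intro mult_right_mono) auto
      have "real n * 1 \<le> real n * C\<^sup>2" using C2_ge_1 by (intro mult_left_mono) auto
      then have "real n * 1 \<le> N2 * signal_bound" using N2 signal_bound_ge_1 by (intro mult_mono) auto
      then show "real n \<le> N2 * signal_bound" by simp
    qed auto
    finally show ?thesis by (simp add: algebra_simps)
  qed

  have block_const_eq: "block_const = 726 * N2 * signal_bound" by (simp add: block_const_def N2_def)
  have "(\<Sum>i\<in>block k. lik \<alpha> Y i) = a - (m - e) - s"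
    unfolding a_def m_def e_def s_def lik_decomp by (simp add: sum_subtractf[symmetric] left_diff_distrib)
  then have "\<bar>\<Sum>i\<in>block k. lik \<alpha> Y i\<bar> \<le> a + \<bar>m\<bar> + \<bar>e\<bar> + s" using a s by linarith
  also have "\<dots> \<le> 31 * N2 * (1 / (real k)\<^sup>2) + 631 * N2 * signal_bound * (1 / (real k)\<^sup>2)
      + 63 * N2 * signal_bound * (1 / (real k)\<^sup>2) + N2 * signal_bound * (1 / (real k)\<^sup>2)"
    using a m e s by linarith
  also have "31 * N2 * (1 / (real k)\<^sup>2) \<le> 31 * N2 * (1 / (real k)\<^sup>2) * signal_bound"
    using N2 signal_bound_ge_1 mult_left_mono[of 1 signal_bound "31 * N2 * (1 / (real k)\<^sup>2)"] by simp
  finally show ?A unfolding block_const_eq by (simp add: algebra_simps)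

  \<comment> \<open>Without cancellation the noise contributes order 1 / k. The parts add up to 31 +
    63 + 1 = 95, well within 726.\<close>
  have "(\<Sum>i\<in>block k. \<bar>lik \<alpha> Y i\<bar>) \<le> (\<Sum>i\<in>block k. (lgt \<alpha> i - shr \<alpha> i) + real n * C\<^sup>2 * (\<bar>xi Y i\<bar> / real i)
      + shr \<alpha> i * (real n * (\<kappa> i * \<mu> i)\<^sup>2))"
  proof (intro sum_mono)
    fix i assume i: "i \<in> block k"
    have "\<bar>shr \<alpha> i * xi Y i\<bar> \<le> real n * C\<^sup>2 * (\<bar>xi Y i\<bar> / real i)"
      using mult_right_mono[OF shr_le[OF i], of "\<bar>xi Y i\<bar>"] shr_pos[OF ge1[OF i], of \<alpha>] by (simp add: abs_mult)
    then show "\<bar>lik \<alpha> Y i\<bar> \<le> (lgt \<alpha> i - shr \<alpha> i) + real n * C\<^sup>2 * (\<bar>xi Y i\<bar> / real i)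
      + shr \<alpha> i * (real n * (\<kappa> i * \<mu> i)\<^sup>2)"
      unfolding lik_decomp using a_term[OF i] s_term[OF i] by linarith
  qed
  also have "\<dots> = a + real n * C\<^sup>2 * H + s"
    by (simp only: a_def s_def H_def sum.distrib sum_distrib_left)
  also have "\<dots> \<le> 31 * N2 * signal_bound * (1 / real k) + N2 * (63 * signal_bound / real k) + N2 * signal_bound * (1 / real k)"
  proof (intro add_mono mult_mono)
    have "31 * N2 \<le> 31 * N2 * signal_bound" using N2 signal_bound_ge_1 mult_left_mono[of 1 signal_bound "31 * N2"] by simp
    from mult_mono[OF this kp(3)] have "31 * N2 * (1 / (real k)\<^sup>2) \<le> 31 * N2 * signal_bound * (1 / real k)"
      using N2 signal_bound_ge_1 by simp
    then show "a \<le> 31 * N2 * signal_bound * (1 / real k)" using a by linarith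
    have "N2 * signal_bound * (1 / (real k)\<^sup>2) \<le> N2 * signal_bound * (1 / real k)"
      using N2 signal_bound_ge_1 kp by (intro mult_left_mono) auto
    then show "s \<le> N2 * signal_bound * (1 / real k)" using s by linarith
  qed (use N2 H in auto)
  also have "\<dots> \<le> 726 * N2 * signal_bound * (1 / real k)" using N2 signal_bound_ge_1 by (simp add: algebra_simps divide_right_mono)
  finally show ?B unfolding block_const_eq by simp
qed


text \<open>With \<open>k'\<close> the last block boundary at or before \<open>m\<close>, the full
  blocks cost 2 / k by the sum of inverse squares and the incomplete one 1 / k, in units of
  \<open>block_const\<close>.\<close>

lemma partial_sum_le:
  assumes "Y \<in> tail_event K" "K \<le> k" "1 \<le> k" "0 \<le> \<alpha>" "\<alpha> \<le> T" "k^5 \<le> m"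
  shows "\<bar>\<Sum>i=k^5..<m. lik \<alpha> Y i\<bar> \<le> 3 * block_const / real k"
proof -
  define k' where "k' = (GREATEST j. j^5 \<le> m)"
  have bd: "\<forall>j. j^5 \<le> m \<longrightarrow> j \<le> m"
  proof (intro allI impI)
    fix j :: nat assume "j^5 \<le> m"
    moreover have "j \<le> j^5" by (cases "j = 0") (auto simp: self_le_power)
    ultimately show "j \<le> m" by linarith
  qed
  have k': "k'^5 \<le> m" unfolding k'_def by (rule GreatestI_nat[where P = "\<lambda>j. j^5 \<le> m", OF assms(6)]) (use bd in auto)
  have kk': "k \<le> k'" unfolding k'_def by (rule Greatest_le_nat[where P = "\<lambda>j. j^5 \<le> m", OF assms(6)]) (use bd in auto)
  have "\<not> (Suc k')^5 \<le> m"
  proof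
    assume "(Suc k')^5 \<le> m"
    then have "Suc k' \<le> (GREATEST j. j^5 \<le> m)"
      by (rule Greatest_le_nat[where P = "\<lambda>j. j^5 \<le> m"]) (use bd in auto)
    then show False unfolding k'_def[symmetric] by simp
  qed
  then have sub: "{k'^5..<m} \<subseteq> block k'" by (auto simp: block_def)
  have "(\<Sum>i=k^5..<m. lik \<alpha> Y i) = (\<Sum>i=k^5..<k'^5. lik \<alpha> Y i) + (\<Sum>i=k'^5..<m. lik \<alpha> Y i)"
    using k' kk' by (intro sum.atLeastLessThan_concat[symmetric] power_mono) auto
  then have "\<bar>\<Sum>i=k^5..<m. lik \<alpha> Y i\<bar> \<le> \<bar>\<Sum>i=k^5..<k'^5. lik \<alpha> Y i\<bar> + \<bar>\<Sum>i=k'^5..<m. lik \<alpha> Y i\<bar>"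
    by simp
  also have "\<bar>\<Sum>i=k^5..<k'^5. lik \<alpha> Y i\<bar> \<le> 2 * block_const / real k"
  proof -
    have "\<bar>\<Sum>i=k^5..<k'^5. lik \<alpha> Y i\<bar> \<le> (\<Sum>j=k..<k'. \<bar>\<Sum>i\<in>block j. lik \<alpha> Y i\<bar>)"
      unfolding sum_blocks[OF kk'] by (rule sum_abs)
    also have "\<dots> \<le> (\<Sum>j=k..<k'. block_const * (1 / (real j)\<^sup>2))"
      using block_bounds(1)[OF assms(1) _ _ assms(4,5)] assms(2,3) by (intro sum_mono) auto
    also have "\<dots> = block_const * (\<Sum>j=k..<k'. 1 / (real j)\<^sup>2)" by (simp only: sum_distrib_left)
    also have "\<dots> \<le> block_const * (2 / real k)" using block_const_nonneg assms by (intro mult_left_mono sum_inverse_squares_le)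
    finally show ?thesis by (simp add: mult.commute)
  qed
  also have "\<bar>\<Sum>i=k'^5..<m. lik \<alpha> Y i\<bar> \<le> block_const / real k"
  proof -
    have "\<bar>\<Sum>i=k'^5..<m. lik \<alpha> Y i\<bar> \<le> (\<Sum>i=k'^5..<m. \<bar>lik \<alpha> Y i\<bar>)" by (rule sum_abs)
    also have "\<dots> \<le> (\<Sum>i\<in>block k'. \<bar>lik \<alpha> Y i\<bar>)" by (intro sum_mono2 finite_block sub) auto
    also have "\<dots> \<le> block_const / real k'" using assms kk' by (intro block_bounds(2)[OF assms(1)]) auto
    also have "\<dots> \<le> block_const / real k" using kk' assms(3) block_const_nonneg by (intro divide_left_mono) auto
    finally show ?thesis .
  qed
  finally show ?thesis by (simp add: add_divide_distrib[symmetric])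
qed

text \<open>Convergence may be conditional, so the partial sums are shown to be Cauchy by comparing
  each with a common block boundary \<open>k^5\<close>. The error bound is the same for all
  \<alpha>, as continuity of the limit requires.\<close>

lemma lik_series:
  assumes "Y \<in> tail_event K" "1 \<le> K" "0 \<le> \<alpha>" "\<alpha> \<le> T"
  shows "summable (\<lambda>k. lik \<alpha> Y (Suc k))"
    and "K \<le> k \<Longrightarrow> \<bar>(\<Sum>k. lik \<alpha> Y (Suc k)) - (\<Sum>i=1..<k^5. lik \<alpha> Y i)\<bar> \<le> 3 * block_const / real k"
proof -
  define S where "S = (\<lambda>m. \<Sum>i=1..<Suc m. lik \<alpha> Y i)"
  have S: "\<bar>S m - (\<Sum>i=1..<k^5. lik \<alpha> Y i)\<bar> \<le> 3 * block_const / real k" if "K \<le> k" "k^5 \<le> m" for m k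
  proof -
    have "1 \<le> k^5" using that(1) assms(2) by (intro one_le_power) auto
    then have "S m = (\<Sum>i=1..<k^5. lik \<alpha> Y i) + (\<Sum>i=k^5..<Suc m. lik \<alpha> Y i)"
      unfolding S_def using that by (intro sum.atLeastLessThan_concat[symmetric]) auto
    then show ?thesis using partial_sum_le[OF assms(1) that(1) _ assms(3,4), of "Suc m"] that assms(2) by simp
  qed
  have "Cauchy S"
  proof (rule metric_CauchyI)
    fix e :: real assume e: "e > 0"
    obtain k where k: "real k > 6 * block_const / e" using reals_Archimedean2 by blast
    define k0 where "k0 = max k K"
    have k0: "K \<le> k0" "real k0 > 6 * block_const / e" "real k0 > 0" using k assms(2) by (auto simp: k0_def)
    have "dist (S m) (S m') < e" if "k0^5 \<le> m" "k0^5 \<le> m'" for m m'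
    proof -
      have "\<bar>S m - S m'\<bar> \<le> 3 * block_const / real k0 + 3 * block_const / real k0"
        using S[OF k0(1) that(1)] S[OF k0(1) that(2)] by linarith
      also have "\<dots> = 6 * block_const / real k0" by simp
      also have "\<dots> < e" using k0 e by (simp add: field_simps)
      finally show ?thesis by (simp add: dist_real_def)
    qed
    then show "\<exists>N. \<forall>m\<ge>N. \<forall>n\<ge>N. dist (S m) (S n) < e" by blast
  qed
  then have "convergent S" by (simp add: Cauchy_convergent_iff)
  moreover have S_eq: "S = (\<lambda>m. \<Sum>k<m. lik \<alpha> Y (Suc k))"
    unfolding S_def sum_Suc_eq[of "lik \<alpha> Y"] ..
  ultimately show sm: "summable (\<lambda>k. lik \<alpha> Y (Suc k))" by (simp add: summable_iff_convergent)
  then have lim: "S \<longlonglongrightarrow> (\<Sum>k. lik \<alpha> Y (Suc k))" unfolding S_eq by (rule summable_LIMSEQ)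
  assume k: "K \<le> k"
  have "(\<lambda>m. \<bar>S m - (\<Sum>i=1..<k^5. lik \<alpha> Y i)\<bar>) \<longlonglongrightarrow> \<bar>(\<Sum>k. lik \<alpha> Y (Suc k)) - (\<Sum>i=1..<k^5. lik \<alpha> Y i)\<bar>"
    by (intro tendsto_intros lim)
  then show "\<bar>(\<Sum>k. lik \<alpha> Y (Suc k)) - (\<Sum>i=1..<k^5. lik \<alpha> Y i)\<bar> \<le> 3 * block_const / real k"
    by (rule Lim_bounded[of _ _ "k^5"]) (use S[OF k] in blast)
qed

lemma ell_continuous:
  assumes "Y \<in> tail_event K" "1 \<le> K"
  shows "continuous_on {0..T} (ell n \<kappa> Y)"
proof -
  have ul: "uniform_limit {0..T} (\<lambda>k \<alpha>. \<Sum>i=1..<k^5. lik \<alpha> Y i) (\<lambda>\<alpha>. \<Sum>k. lik \<alpha> Y (Suc k)) sequentially"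
  proof (rule uniform_limitI)
    fix e :: real assume e: "e > 0"
    obtain k0 where k0: "real k0 > 3 * block_const / e" using reals_Archimedean2 by blast
    have "dist (\<Sum>i=1..<k^5. lik \<alpha> Y i) (\<Sum>k. lik \<alpha> Y (Suc k)) < e"
      if "k \<ge> max k0 K" "\<alpha> \<in> {0..T}" for k \<alpha>
    proof -
      have k: "real k > 3 * block_const / e" "real k > 0" using k0 that assms(2) by auto
      have "\<bar>(\<Sum>k. lik \<alpha> Y (Suc k)) - (\<Sum>i=1..<k^5. lik \<alpha> Y i)\<bar> \<le> 3 * block_const / real k"
        using that by (intro lik_series(2)[OF assms]) auto
      also have "\<dots> < e" using k e by (simp add: field_simps)
      finally show ?thesis by (simp add: dist_real_def abs_minus_commute)
    qed
    then show "\<forall>\<^sub>F k in sequentially. \<forall>\<alpha>\<in>{0..T}. dist (\<Sum>i=1..<k^5. lik \<alpha> Y i) (\<Sum>k. lik \<alpha> Y (Suc k)) < e"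
      unfolding eventually_sequentially by blast
  qed
  have "continuous_on {0..T} (\<lambda>\<alpha>. lik \<alpha> Y i)" if "i \<ge> 1" for i
  proof -
    have w: "continuous_on {0..T} (\<lambda>\<alpha>. wt \<alpha> i)"
      unfolding wt_def using that by (intro continuous_intros) auto
    have pos: "wt \<alpha> i > 0" for \<alpha> by (rule wt_pos[OF that])
    have "1 + real n / wt \<alpha> i > 0" "wt \<alpha> i + real n > 0" for \<alpha>
      using pos[of \<alpha>] n_pos by (auto intro: add_pos_nonneg)
    then show ?thesis
      unfolding lik_def lgt_def shr_def using pos
      by (intro continuous_intros w) (auto simp: less_imp_neq[symmetric])
  qed
  then have "\<forall>\<^sub>F k in sequentially. continuous_on {0..T} (\<lambda>\<alpha>. \<Sum>i=1..<k^5. lik \<alpha> Y i)"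
    by (intro always_eventually allI continuous_on_sum) auto
  from uniform_limit_theorem[OF this ul sequentially_bot]
  have "continuous_on {0..T} (\<lambda>\<alpha>. \<Sum>k. lik \<alpha> Y (Suc k))" .
  then show ?thesis unfolding ell_eq by (intro continuous_intros)
qed

text \<open>Block \<open>n^4\<close> starts at index \<open>(n^4)^5 = n^20\<close>, the cut-off of
  all later sums. The last hypothesis holds for large n because \<open>block_const\<close> grows
  only like n^3.\<close>

lemma ell_approx:
  assumes "Y \<in> tail_event (n^4)" "0 \<le> \<alpha>" "\<alpha> \<le> T" "3 * block_const \<le> real (n^4)"
  shows "\<bar>2 * ell n \<kappa> Y \<alpha> + (\<Sum>i=1..<n^20. lik \<alpha> Y i)\<bar> \<le> 1"
proof -
  have n4: "1 \<le> n^4" using n_ge_3 by simp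
  have "\<bar>(\<Sum>k. lik \<alpha> Y (Suc k)) - (\<Sum>i=1..<(n^4)^5. lik \<alpha> Y i)\<bar> \<le> 3 * block_const / real (n^4)"
    by (rule lik_series(2)[OF assms(1) n4 assms(2,3)]) simp
  also have "\<dots> \<le> 1" using assms(4) n_pos by simp
  also have "(n^4)^5 = n^20" by (simp add: power_mult[symmetric])
  finally show ?thesis unfolding ell_eq by (simp add: abs_minus_commute)
qed

abbreviation "c1 \<equiv> gain_const C"

abbreviation "cs \<equiv> signal_const C"

section \<open>Behaviour below the lower bound\<close>

text \<open>All terms are nonnegative, so only indices up to \<open>dimn \<alpha>'\<close> are kept.
  Their logarithms sum to at least \<open>dimn \<alpha>' * T / (8 * expo \<alpha>')\<close>, and the
  step 1 / T cancels \<open>T\<close>.\<close>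

lemma gain_sum_ge:
  assumes "\<alpha> \<ge> 0" "\<alpha>' = \<alpha> + 1 / T" "dimn \<alpha>' \<ge> 4"
  shows "(\<Sum>i=1..<n^20. lgt \<alpha> i - lgt \<alpha>' i - (shr \<alpha> i - shr \<alpha>' i)) \<ge> c1 * dimn \<alpha>' / expo \<alpha>'"
proof -
  let ?g = "\<lambda>i. lgt \<alpha> i - lgt \<alpha>' i - (shr \<alpha> i - shr \<alpha>' i)"
  define N where "N = nat \<lfloor>dimn \<alpha>'\<rfloor>"
  have \<alpha>': "\<alpha>' \<ge> 0" "\<alpha> \<le> \<alpha>'" using assms T_gt_1 by auto
  have gain: "(shr \<alpha> i - shr \<alpha>' i) * (real n / wt \<alpha>' i) \<le> ?g i" if "i \<ge> 1" for i
    using lgt_diff_ge[OF that \<alpha>'(2)] by (simp add: algebra_simps)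
  have nonneg: "0 \<le> ?g i" if "i \<ge> 1" for i
    by (rule order_trans[OF _ gain[OF that]])
      (use shr_antimono[OF that \<alpha>'(2)] wt_pos[OF that, of \<alpha>'] in auto)
  have N: "real N \<le> dimn \<alpha>'" unfolding N_def using assms by linarith
  have "N \<le> n" using N dimn_le_n[OF \<alpha>'(1)] by linarith
  also have "n < n^20" using n_ge_3 power_strict_increasing[of 1 20 n] by simp
  finally have sub: "{1..N} \<subseteq> {1..<n^20}" by auto
  have "c1 * dimn \<alpha>' / expo \<alpha>' = 2/3 * (1 / T) / (1 + C\<^sup>2)\<^sup>2 * (dimn \<alpha>' * ln (dimn \<alpha>') / 8)"
    using T_gt_1 by (simp add: gain_const_def ln_dimn)
  also have "\<dots> \<le> 2/3 * (1 / T) / (1 + C\<^sup>2)\<^sup>2 * (\<Sum>i=1..N. ln (real i))"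
    unfolding N_def using T_gt_1 by (intro mult_left_mono sum_ln_ge assms) auto
  also have "\<dots> = (\<Sum>i=1..N. 2/3 * (1 / T) * ln (real i) / (1 + C\<^sup>2)\<^sup>2)"
    by (simp add: sum_distrib_left sum_divide_distrib)
  also have "\<dots> \<le> (\<Sum>i=1..N. ?g i)"
  proof (intro sum_mono)
    fix i assume "i \<in> {1..N}"
    then have i: "i \<ge> 1" "real i \<le> dimn \<alpha>'" "i \<le> n" using N \<open>N \<le> n\<close> by auto
    have "ln (real i) \<le> T" using i by simp
    then have "1 / T * ln (real i) \<le> 1" using T_gt_1 by simp
    then have "2/3 * (1 / T) * ln (real i) / (1 + C\<^sup>2)\<^sup>2 \<le> (shr \<alpha> i - shr \<alpha>' i) * (real n / wt \<alpha>' i)"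
      using shr_gain_ge[of i \<alpha> "1 / T"] i assms T_gt_1 by simp
    then show "2/3 * (1 / T) * ln (real i) / (1 + C\<^sup>2)\<^sup>2 \<le> ?g i" using gain[OF i(1)] by linarith
  qed
  also have "\<dots> \<le> (\<Sum>i=1..<n^20. ?g i)"
    using nonneg by (intro sum_mono2 sub) auto
  finally show ?thesis .
qed

section \<open>Sums of coefficients, signal and variances\<close>

lemma sum_shr_le: "\<alpha> \<ge> 0 \<Longrightarrow> (\<Sum>i=1..<n^20. shr \<alpha> i) \<le> 23 * C\<^sup>2 * (dimn \<alpha> * T)"
  by (rule order_trans[OF sum_mono sum_lgt_le_dimn]) (auto intro: shr_le_lgt)

text \<open>One factor \<open>T\<close> comes from \<open>ln i \<le> 20 * T\<close> and one from the
  sum of \<open>shr\<close>; 920 = 2 * 20 * 23. With \<open>d = 1 / T ^ 3\<close> the cost is a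
  multiple of \<open>dimn \<alpha> / T\<close>.\<close>

lemma sum_shr_diff_le:
  assumes "\<alpha> \<ge> 0" "d \<ge> 0"
  shows "(\<Sum>i=1..<n^20. shr \<alpha> i - shr (\<alpha> + d) i) \<le> 920 * C\<^sup>2 * d * T\<^sup>2 * dimn \<alpha>"
proof -
  have "(\<Sum>i=1..<n^20. shr \<alpha> i - shr (\<alpha> + d) i) \<le> (\<Sum>i=1..<n^20. 40 * d * T * shr \<alpha> i)"
  proof (intro sum_mono)
    fix i assume i: "i \<in> {1..<n^20}"
    have "ln (real i) \<le> ln (real (n^20))"
      using i n_ge_3 by (subst ln_le_cancel_iff) (auto simp del: of_nat_power)
    also have "\<dots> = 20 * T" using n_pos by (simp add: ln_realpow)
    finally have "2 * d * ln (real i) * shr \<alpha> i \<le> 2 * d * (20 * T) * shr \<alpha> i"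
      using assms i shr_pos[of i \<alpha>] by (intro mult_right_mono mult_left_mono) auto
    then show "shr \<alpha> i - shr (\<alpha> + d) i \<le> 40 * d * T * shr \<alpha> i"
      using shr_diff_le[of i d \<alpha>] assms i by simp
  qed
  also have "\<dots> = 40 * d * T * (\<Sum>i=1..<n^20. shr \<alpha> i)" by (simp only: sum_distrib_left)
  also have "\<dots> \<le> 40 * d * T * (23 * C\<^sup>2 * (dimn \<alpha> * T))"
    using assms T_gt_1 by (intro mult_left_mono sum_shr_le) auto
  finally show ?thesis by (simp add: power2_eq_square mult_ac)
qed

lemma h_nonneg: "\<alpha> \<ge> 0 \<Longrightarrow> h \<alpha> \<ge> 0"
  unfolding hn_eq using expo_ge_1[of \<alpha>] dimn_pos[of \<alpha>] T_gt_1 sig_nonneg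
  by (intro mult_nonneg_nonneg suminf_nonneg sig_summable divide_nonneg_pos mult_pos_pos) auto

lemma sum_signal_le:
  assumes "\<alpha> \<ge> 0" "d \<ge> 0" "d * T \<le> 2"
  shows "(\<Sum>i=1..<m. (shr \<alpha> i - shr (\<alpha> + d) i) * (real n * (\<kappa> i * \<mu> i)\<^sup>2)) \<le> 4 * cs * (dimn \<alpha> / expo \<alpha> * h \<alpha>)"
proof -
  have h0: "h \<alpha> \<ge> 0" by (rule h_nonneg[OF assms(1)])
  have cs: "cs \<ge> 0" using signal_const_pos[of C] by simp
  have "(\<Sum>i=1..<m. (shr \<alpha> i - shr (\<alpha> + d) i) * (real n * (\<kappa> i * \<mu> i)\<^sup>2)) \<le> (\<Sum>i=1..<m. cs * (2 * d) * (sig \<alpha> i * (\<mu> i)\<^sup>2))"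
  proof (intro sum_mono)
    fix i assume "i \<in> {1..<m}"
    then have "i \<ge> 1" by simp
    from mult_right_mono[OF shr_signal_le[OF this assms], of "(\<mu> i)\<^sup>2"]
    show "(shr \<alpha> i - shr (\<alpha> + d) i) * (real n * (\<kappa> i * \<mu> i)\<^sup>2) \<le> cs * (2 * d) * (sig \<alpha> i * (\<mu> i)\<^sup>2)"
      by (simp add: signal_const_def power_mult_distrib mult.assoc)
  qed
  also have "\<dots> = cs * (2 * d) * (\<Sum>i=1..<m. sig \<alpha> i * (\<mu> i)\<^sup>2)" by (simp only: sum_distrib_left)
  also have "\<dots> \<le> cs * (2 * d) * (dimn \<alpha> * T / expo \<alpha> * h \<alpha>)"
    using assms cs by (intro mult_left_mono sum_sig_le) auto
  also have "\<dots> = 2 * cs * (dimn \<alpha> / expo \<alpha> * h \<alpha>) * (d * T)" by simp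
  also have "\<dots> \<le> 2 * cs * (dimn \<alpha> / expo \<alpha> * h \<alpha>) * 2"
    using cs h0 dimn_pos[of \<alpha>] expo_ge_1[OF assms(1)] assms(3) by (intro mult_left_mono mult_nonneg_nonneg) auto
  finally show ?thesis by simp
qed

text \<open>Coefficients in [0, 1] satisfy \<open>(c i)\<^sup>2 \<le> c i\<close>, so the variance
  is controlled by the same linear sums that describe the means.\<close>

lemma variance_sum_le:
  assumes "\<And>i. i \<ge> 1 \<Longrightarrow> 0 \<le> c i \<and> c i \<le> 1"
  shows "(\<Sum>i=1..<m. (c i)\<^sup>2 * (2 + 4 * real n * (\<kappa> i * \<mu> i)\<^sup>2))
     \<le> 2 * (\<Sum>i=1..<m. c i) + 4 * (\<Sum>i=1..<m. c i * (real n * (\<kappa> i * \<mu> i)\<^sup>2))"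
proof -
  have "(\<Sum>i=1..<m. (c i)\<^sup>2 * (2 + 4 * real n * (\<kappa> i * \<mu> i)\<^sup>2))
     \<le> (\<Sum>i=1..<m. c i * (2 + 4 * real n * (\<kappa> i * \<mu> i)\<^sup>2))"
  proof (intro sum_mono mult_right_mono)
    fix i assume "i \<in> {1..<m}"
    then show "(c i)\<^sup>2 \<le> c i" using assms[of i] by (simp add: power2_eq_square mult_left_le)
  qed auto
  also have "\<dots> = 2 * (\<Sum>i=1..<m. c i) + 4 * (\<Sum>i=1..<m. c i * (real n * (\<kappa> i * \<mu> i)\<^sup>2))"
    by (simp add: sum_distrib_left sum.distrib[symmetric] algebra_simps)
  finally show ?thesis .
qed

lemma shr_diff_bounds: "\<alpha> \<le> \<alpha>' \<Longrightarrow> i \<ge> 1 \<Longrightarrow> 0 \<le> shr \<alpha> i - shr \<alpha>' i \<and> shr \<alpha> i - shr \<alpha>' i \<le> 1"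
  using shr_antimono[of i \<alpha> \<alpha>'] shr_le_1[of i \<alpha>] shr_pos[of i \<alpha>'] by simp

lemma square_obs: "real n * (Y i)\<^sup>2 = 1 + xi Y i + real n * (\<kappa> i * \<mu> i)\<^sup>2"
  by (simp add: noise_def)

text \<open>Each truncated likelihood is off by at most 1, hence the 2. The roles of
  \<open>a\<close> and \<open>b\<close> switch because \<open>lik\<close> carries the opposite
  sign.\<close>

lemma ell_diff_ge:
  assumes "Y \<in> tail_event (n^4)" "3 * block_const \<le> real (n^4)" "a \<in> {0..T}" "b \<in> {0..T}"
  shows "2 * (ell n \<kappa> Y a - ell n \<kappa> Y b) \<ge> (\<Sum>i=1..<n^20. lik b Y i - lik a Y i) - 2"
  using ell_approx[OF assms(1) _ _ assms(2), of a] ell_approx[OF assms(1) _ _ assms(2), of b] assms(3,4)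
  unfolding sum_subtractf by auto

text \<open>
  The threshold is one eighth of the mean gain between \<open>\<alpha> + 1 / T ^ 3\<close> and \<open>\<alpha>'\<close> from \<open>gain_sum_ge\<close>.
\<close>

definition lower_event :: "real \<Rightarrow> (nat \<Rightarrow> real) set" where
  "lower_event \<alpha> = (let \<alpha>' = \<alpha> + (1 / T ^ 3 + 1 / T) in
     {Y. \<bar>\<Sum>i=1..<n^20. (shr \<alpha> i - shr \<alpha>' i) * xi Y i\<bar> < c1 * dimn \<alpha>' / (8 * expo \<alpha>')})"

section \<open>One grid cell below the lower bound\<close>

context
  fixes \<alpha> \<alpha>' :: real
  assumes a0: "\<alpha> \<ge> 0" and a': "\<alpha>' = \<alpha> + (1 / T ^ 3 + 1 / T)" and hl: "h \<alpha> \<le> c1 / (160 * cs * exp 4)"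
begin

text \<open>\<open>\<alpha>'\<close> lies 1 / T beyond the right end of the cell that starts at
  \<alpha>, so every point of the cell is at least 1 / T away from it. The bound 2 is the one
  required by \<open>dimn_ratio\<close> and \<open>sum_signal_le\<close>.\<close>

lemma grid_step: "0 \<le> 1 / T ^ 3 + 1 / T" "(1 / T ^ 3 + 1 / T) * T \<le> 2" "1 / T ^ 3 \<le> 1 / T"
proof -
  show "0 \<le> 1 / T ^ 3 + 1 / T" using T_gt_1 by simp
  have "T ^ 1 \<le> T ^ 3" using T_gt_1 by (intro power_increasing) auto
  then show *: "1 / T ^ 3 \<le> 1 / T" using T_gt_1 by (intro divide_left_mono) auto
  have "(1 / T ^ 3 + 1 / T) * T \<le> (1 / T + 1 / T) * T" using * T_gt_1 by (intro mult_right_mono) auto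
  then show "(1 / T ^ 3 + 1 / T) * T \<le> 2" using T_gt_1 by (simp add: field_simps)
qed

lemma dimn_le_next: "dimn \<alpha> \<le> exp 4 * dimn \<alpha>'"
  using grid_step a' by (intro dimn_ratio a0) auto

text \<open>The origin of \<open>l\<close>: 160 = 4 * 5 * 8, with 4 from
  \<open>sum_signal_le\<close>, 5 from \<open>expo \<alpha>' \<le> 5 * expo \<alpha>\<close> (the
  step is at most 2), and 8 to bring the signal down to an eighth of the gain. The factor
  \<open>exp 4\<close> passes from \<open>dimn \<alpha>\<close> to
  \<open>dimn \<alpha>'\<close>.\<close>

lemma signal_lower: "(\<Sum>i=1..<n^20. (shr \<alpha> i - shr \<alpha>' i) * (real n * (\<kappa> i * \<mu> i)\<^sup>2)) \<le> c1 * dimn \<alpha>' / (8 * expo \<alpha>')"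
proof -
  have e: "expo \<alpha> \<ge> 1" by (rule expo_ge_1[OF a0])
  have "expo \<alpha>' = expo \<alpha> + 2 * (1 / T ^ 3 + 1 / T)" by (simp add: expo_def a')
  moreover have "(1 / T ^ 3 + 1 / T) * 1 \<le> (1 / T ^ 3 + 1 / T) * T"
    using grid_step T_gt_1 by (intro mult_left_mono) auto
  ultimately have e': "expo \<alpha>' \<le> 5 * expo \<alpha>" "expo \<alpha>' > 0" using grid_step e by auto
  have cs: "cs > 0" by (rule signal_const_pos)
  have "(\<Sum>i=1..<n^20. (shr \<alpha> i - shr \<alpha>' i) * (real n * (\<kappa> i * \<mu> i)\<^sup>2)) \<le> 4 * cs * (dimn \<alpha> / expo \<alpha> * h \<alpha>)"
    unfolding a' by (intro sum_signal_le grid_step a0)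
  also have "\<dots> \<le> 4 * cs * ((exp 4 * dimn \<alpha>') / (expo \<alpha>' / 5) * (c1 / (160 * cs * exp 4)))"
    using e e' dimn_pos[of \<alpha>'] cs h_nonneg[OF a0]
    by (intro mult_left_mono mult_mono[OF frac_le hl] dimn_le_next) auto
  also have "\<dots> = c1 * dimn \<alpha>' / (8 * expo \<alpha>')" using cs by simp
  finally show ?thesis .
qed

text \<open>Variance and threshold are both expressed through \<open>dimn \<alpha>'\<close>, so
  Chebyshev leaves its inverse. The variance is at most 2 * 23 + 4 / 8 \<le> 47 units, and 3008 = 47
  * 64.\<close>

lemma lower_event_prob:
  "measure (P0 n \<kappa> \<mu>) (- lower_event \<alpha>) \<le> 3008 * C\<^sup>2 * exp 4 / c1\<^sup>2 * (T * (expo \<alpha>')\<^sup>2 / dimn \<alpha>')"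
proof -
  let ?t = "c1 * dimn \<alpha>' / (8 * expo \<alpha>')"
  define E where "E = exp (4::real)"
  have E1: "E \<ge> 1" by (simp add: E_def)
  have aa: "\<alpha> \<le> \<alpha>'" "0 \<le> \<alpha>'" using grid_step a' a0 by auto
  have e': "expo \<alpha>' \<ge> 1" by (rule expo_ge_1[OF aa(2)])
  have t: "?t > 0" using gain_const_bounds[of C] dimn_pos[of \<alpha>'] e' by auto
  have c: "0 \<le> shr \<alpha> i - shr \<alpha>' i \<and> shr \<alpha> i - shr \<alpha>' i \<le> 1" if "i \<ge> 1" for i
    using shr_diff_bounds[OF aa(1) that] .
  have "(\<Sum>i=1..<n^20. shr \<alpha> i - shr \<alpha>' i) \<le> (\<Sum>i=1..<n^20. shr \<alpha> i)"
    using shr_pos by (intro sum_mono) (auto intro: less_imp_le)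
  also have "\<dots> \<le> 23 * C\<^sup>2 * (dimn \<alpha> * T)" by (rule sum_shr_le[OF a0])
  also have "\<dots> \<le> 23 * C\<^sup>2 * ((E * dimn \<alpha>') * T)"
    using dimn_le_next T_gt_1 by (intro mult_left_mono mult_right_mono) (auto simp: E_def)
  finally have 1: "(\<Sum>i=1..<n^20. shr \<alpha> i - shr \<alpha>' i) \<le> 23 * (C\<^sup>2 * E * dimn \<alpha>' * T)" by (simp add: mult_ac)
  have "c1 * dimn \<alpha>' / (8 * expo \<alpha>') \<le> 1 * dimn \<alpha>' / (8 * 1)"
    using gain_const_bounds[of C] dimn_pos[of \<alpha>'] e' by (intro frac_le mult_right_mono) auto
  also have "\<dots> = 1 * dimn \<alpha>' / 8" by simp
  also have "\<dots> \<le> (C\<^sup>2 * E * T) * dimn \<alpha>' / 8"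
    using mult_mono[of 1 "C\<^sup>2 * E" 1 T] mult_mono[of 1 "C\<^sup>2" 1 E] C2_ge_1 E1 T_gt_1 dimn_pos[of \<alpha>']
    by (intro divide_right_mono mult_right_mono) auto
  finally have 2: "(\<Sum>i=1..<n^20. (shr \<alpha> i - shr \<alpha>' i) * (real n * (\<kappa> i * \<mu> i)\<^sup>2)) \<le> C\<^sup>2 * E * dimn \<alpha>' * T / 8"
    using signal_lower by (simp only: mult_ac)
  have eq: "- lower_event \<alpha> = {Y. \<bar>\<Sum>i=1..<n^20. (shr \<alpha> i - shr \<alpha>' i) * xi Y i\<bar> \<ge> ?t}"
    unfolding lower_event_def a'[symmetric] by (auto simp: Let_def a'[symmetric])
  have "measure (P0 n \<kappa> \<mu>) (- lower_event \<alpha>) \<le> (\<Sum>i=1..<n^20. (shr \<alpha> i - shr \<alpha>' i)\<^sup>2 * (2 + 4 * real n * (\<kappa> i * \<mu> i)\<^sup>2)) / ?t\<^sup>2"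
    unfolding eq using n_ge_3 by (intro noise_sum_tail_prob t) auto
  also have "\<dots> \<le> (47 * (C\<^sup>2 * E * dimn \<alpha>' * T)) / ?t\<^sup>2"
  proof (intro divide_right_mono)
    have "0 \<le> C\<^sup>2 * E * dimn \<alpha>' * T" using E1 dimn_pos[of \<alpha>'] T_gt_1 by simp
    then show "(\<Sum>i=1..<n^20. (shr \<alpha> i - shr \<alpha>' i)\<^sup>2 * (2 + 4 * real n * (\<kappa> i * \<mu> i)\<^sup>2)) \<le> 47 * (C\<^sup>2 * E * dimn \<alpha>' * T)"
      using variance_sum_le[of "\<lambda>i. shr \<alpha> i - shr \<alpha>' i" "n^20", OF c] 1 2 by linarith
  qed simp
  also have "\<dots> = 3008 * C\<^sup>2 * E / c1\<^sup>2 * (T * (expo \<alpha>')\<^sup>2 / dimn \<alpha>')"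
    using gain_const_bounds[of C] dimn_pos[of \<alpha>'] e' by (simp add: power2_eq_square field_simps)
  finally show ?thesis by (simp add: E_def)
qed

text \<open>For any \<open>b\<close> in the cell the logarithms are bounded using its right end and
  the quadratic terms using its left end, so a single noise event covers the cell. The mismatch of
  the two ends is the cost bounded by \<open>Q / 4\<close>.\<close>

lemma lower_step:
  assumes "Y \<in> tail_event (n^4)" "3 * block_const \<le> real (n^4)" "Y \<in> lower_event \<alpha>"
    and "\<alpha>' \<le> T" "dimn \<alpha>' \<ge> 4" "920 * C\<^sup>2 * exp 4 / T \<le> c1 / (4 * expo \<alpha>')"
    and "2 < c1 * dimn \<alpha>' / (4 * expo \<alpha>')"
    and b: "\<alpha> \<le> b" "b \<le> \<alpha> + 1 / T ^ 3"
  shows "ell n \<kappa> Y b < ell n \<kappa> Y \<alpha>'"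
proof -
  define \<alpha>1 where "\<alpha>1 = \<alpha> + 1 / T ^ 3"
  define Q where "Q = c1 * dimn \<alpha>' / expo \<alpha>'"
  have a1: "\<alpha>1 \<ge> 0" "\<alpha>' = \<alpha>1 + 1 / T" "b \<le> \<alpha>1" "\<alpha>1 \<le> \<alpha>'" using a0 T_gt_1 b by (auto simp: \<alpha>1_def a')
  have "(\<Sum>i=1..<n^20. shr \<alpha> i - shr \<alpha>1 i) \<le> 920 * C\<^sup>2 * (1 / T ^ 3) * T\<^sup>2 * dimn \<alpha>"
    unfolding \<alpha>1_def using T_gt_1 by (intro sum_shr_diff_le a0) auto
  also have "\<dots> = 920 * C\<^sup>2 / T * dimn \<alpha>" using T_gt_1 by (simp add: power2_eq_square power3_eq_cube)
  also have "\<dots> \<le> 920 * C\<^sup>2 / T * (exp 4 * dimn \<alpha>')" using T_gt_1 by (intro mult_left_mono dimn_le_next) auto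
  also have "\<dots> = (920 * C\<^sup>2 * exp 4 / T) * dimn \<alpha>'" by simp
  also have "\<dots> \<le> c1 / (4 * expo \<alpha>') * dimn \<alpha>'" using dimn_pos[of \<alpha>'] by (intro mult_right_mono assms) auto
  finally have cost: "(\<Sum>i=1..<n^20. shr \<alpha> i - shr \<alpha>1 i) \<le> Q / 4" by (simp add: Q_def)
  have gain: "(\<Sum>i=1..<n^20. lgt \<alpha>1 i - lgt \<alpha>' i - (shr \<alpha>1 i - shr \<alpha>' i)) \<ge> Q"
    unfolding Q_def by (rule gain_sum_ge[OF a1(1,2) assms(5)])
  have sg: "(\<Sum>i=1..<n^20. (shr \<alpha> i - shr \<alpha>' i) * (real n * (\<kappa> i * \<mu> i)\<^sup>2)) \<le> Q / 8"
    using signal_lower by (simp add: Q_def)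
  have nz: "(\<Sum>i=1..<n^20. (shr \<alpha> i - shr \<alpha>' i) * xi Y i) \<le> Q / 8"
    using assms(3) unfolding lower_event_def a'[symmetric] Let_def by (auto simp: Q_def)
  \<comment> \<open>Gain minus cost of the mesh, noise and signal; half of the gain survives and
    exceeds the truncation errors.\<close>
  have "Q - Q / 4 - Q / 8 - Q / 8 \<le> (\<Sum>i=1..<n^20. lgt \<alpha>1 i - lgt \<alpha>' i - (shr \<alpha>1 i - shr \<alpha>' i))
     - (\<Sum>i=1..<n^20. shr \<alpha> i - shr \<alpha>1 i) - (\<Sum>i=1..<n^20. (shr \<alpha> i - shr \<alpha>' i) * xi Y i)
     - (\<Sum>i=1..<n^20. (shr \<alpha> i - shr \<alpha>' i) * (real n * (\<kappa> i * \<mu> i)\<^sup>2))"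
    using cost gain sg nz by linarith
  also have "\<dots> = (\<Sum>i=1..<n^20. lgt \<alpha>1 i - lgt \<alpha>' i - (shr \<alpha> i - shr \<alpha>' i) * (real n * (Y i)\<^sup>2))"
    unfolding sum_subtractf[symmetric] square_obs by (intro sum.cong refl) (simp add: algebra_simps)
  also have "\<dots> \<le> (\<Sum>i=1..<n^20. lik b Y i - lik \<alpha>' Y i)"
  proof (intro sum_mono)
    fix i assume "i \<in> {1..<n^20}"
    then have i: "i \<ge> 1" by simp
    have "(shr b i - shr \<alpha>' i) * (real n * (Y i)\<^sup>2) \<le> (shr \<alpha> i - shr \<alpha>' i) * (real n * (Y i)\<^sup>2)"
      using shr_antimono[OF i b(1)] by (intro mult_right_mono) auto
    then show "lgt \<alpha>1 i - lgt \<alpha>' i - (shr \<alpha> i - shr \<alpha>' i) * (real n * (Y i)\<^sup>2) \<le> lik b Y i - lik \<alpha>' Y i"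
      using lgt_antimono[OF i a1(3)] unfolding lik_def by (simp add: left_diff_distrib)
  qed
  finally have 1: "Q / 2 \<le> (\<Sum>i=1..<n^20. lik b Y i - lik \<alpha>' Y i)" by simp
  have 2: "2 < Q / 4" using assms(7) by (simp add: Q_def)
  have "(\<Sum>i=1..<n^20. lik b Y i - lik \<alpha>' Y i) - 2 \<le> 2 * (ell n \<kappa> Y \<alpha>' - ell n \<kappa> Y b)"
  proof (intro ell_diff_ge assms)
    have "b \<le> \<alpha>'" "0 \<le> b" using a1 a0 b by linarith+
    then show "b \<in> {0..T}" "\<alpha>' \<in> {0..T}" using assms(4) by auto
  qed
  then have "0 < 2 * (ell n \<kappa> Y \<alpha>' - ell n \<kappa> Y b)" using 1 2 by linarith
  then show ?thesis by simp
qed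

end

section \<open>Behaviour above the upper bound\<close>

text \<open>The threshold is relative to the signal, which also enters the variance linearly;
  variance over squared threshold is then of order one over the signal, however large the signal
  is.\<close>

definition upper_event :: "real \<Rightarrow> (nat \<Rightarrow> real) set" where
  "upper_event \<alpha> = (let c = (\<lambda>i. shr (\<alpha> - 2 / T) i - shr (\<alpha> - 1 / T) i) in
     {Y. \<bar>\<Sum>i=1..<n^20. c i * xi Y i\<bar> < (\<Sum>i=1..<n^20. c i * (real n * (\<kappa> i * \<mu> i)\<^sup>2)) / 4})"

section \<open>A single reference point to the left of the upper crossing\<close>

context
  fixes \<alpha> L :: real
  assumes aT: "2 / T \<le> \<alpha>" "\<alpha> \<le> T + 1" and hL: "h \<alpha> > L * T\<^sup>2"
    and L: "L \<ge> 184 * C\<^sup>2 * exp 8 * (5 + 2 * p)"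
    and large: "C^4 * R\<^sup>2 / (2 * \<beta>) \<le> L * T\<^sup>2 / (2 * (5 + 2 * p))"
begin

definition signal_gain where "signal_gain = (\<Sum>i=1..<n^20. (shr (\<alpha> - 2 / T) i - shr (\<alpha> - 1 / T) i) * (real n * (\<kappa> i * \<mu> i)\<^sup>2))"

lemma upper_alpha_nonneg: "\<alpha> \<ge> 0" using aT T_gt_1 by (meson divide_nonneg_pos less_trans order_trans zero_le_numeral zero_less_one)

lemma upper_shift_le: "\<alpha> - 2 / T \<le> \<alpha> - 1 / T"
  using T_gt_1 by (simp add: divide_right_mono)

text \<open>The origin of \<open>L\<close>. For \<alpha> \<le> T + 1 one has
  \<open>expo \<alpha> \<le> (5 + 2 * p) * T\<close>, so \<open>h \<alpha> > L * T\<^sup>2\<close>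
  makes the series at least \<open>dimn \<alpha> * L * T\<^sup>2 / (5 + 2 * p)\<close>; half of it
  is given up for indices beyond n. The step 1 / T leaves order \<open>dimn \<alpha> * T\<close>, to
  be 8 times the logarithms: 184 = 8 * 23, and \<open>exp 8\<close> combines
  \<open>shr_signal_ge\<close> with \<open>dimn_ratio\<close>.\<close>

lemma signal_gain_ge: "signal_gain \<ge> 184 * C\<^sup>2 * exp 4 * (dimn \<alpha> * T)"
proof -
  define P where "P = 5 + 2 * p"
  have P: "P \<ge> 5" using p_nonneg by (simp add: P_def)
  have e: "expo \<alpha> \<ge> 1" by (rule expo_ge_1[OF upper_alpha_nonneg])
  have "expo \<alpha> \<le> 3 * 1 + 2 * T + 2 * p * 1" using aT by (simp add: expo_def)
  also have "\<dots> \<le> 3 * T + 2 * T + 2 * p * T"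
    using T_gt_1 p_nonneg by (intro add_mono mult_left_mono) auto
  finally have eP: "expo \<alpha> \<le> P * T" by (simp add: P_def algebra_simps)
  have L0: "L \<ge> 0" by (rule order_trans[OF _ L]) (use p_nonneg in auto)
  have "dimn \<alpha> * (L * T\<^sup>2 / P) = dimn \<alpha> * T / (P * T) * (L * T\<^sup>2)" using T_gt_1 P by simp
  also have "\<dots> \<le> dimn \<alpha> * T / expo \<alpha> * h \<alpha>"
    using hL eP e dimn_pos[of \<alpha>] T_gt_1 P L0 by (intro mult_mono frac_le divide_nonneg_pos) auto
  finally have 1: "dimn \<alpha> * (L * T\<^sup>2 / P) \<le> dimn \<alpha> * T / expo \<alpha> * h \<alpha>" .
  have "C^4 / (2 * \<beta>) * dimn \<alpha> * R\<^sup>2 = dimn \<alpha> * (C^4 * R\<^sup>2 / (2 * \<beta>))" by simp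
  also have "\<dots> \<le> dimn \<alpha> * (L * T\<^sup>2 / (2 * P))"
    using dimn_pos[of \<alpha>] large by (intro mult_left_mono) (auto simp: P_def)
  also have "\<dots> = dimn \<alpha> * (L * T\<^sup>2 / P) / 2" by simp
  finally have 2: "(\<Sum>i=1..<Suc n. sig \<alpha> i * (\<mu> i)\<^sup>2) \<ge> dimn \<alpha> * (L * T\<^sup>2 / P) / 2"
    using sum_sig_ge[OF upper_alpha_nonneg] 1 by linarith
  have "184 * C\<^sup>2 * exp 4 * (dimn \<alpha> * T) = (exp (-4) * dimn \<alpha> * T / P) * (184 * C\<^sup>2 * exp 8 * P)"
    using P by (simp add: exp_add[symmetric] mult_ac)
  also have "\<dots> \<le> (exp (-4) * dimn \<alpha> * T / P) * L"
    using L P dimn_pos[of \<alpha>] T_gt_1 by (intro mult_left_mono) (auto simp: P_def)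
  also have "\<dots> = 2 * exp (-4) / T * (dimn \<alpha> * (L * T\<^sup>2 / P) / 2)"
    using T_gt_1 by (simp add: power2_eq_square)
  also have "\<dots> \<le> 2 * exp (-4) / T * (\<Sum>i=1..<Suc n. sig \<alpha> i * (\<mu> i)\<^sup>2)"
    using 2 T_gt_1 by (intro mult_left_mono) auto
  also have "\<dots> = (\<Sum>i=1..<Suc n. (2 * exp (-4) / T * sig \<alpha> i) * (\<mu> i)\<^sup>2)"
    by (simp only: sum_distrib_left mult.assoc)
  also have "\<dots> \<le> (\<Sum>i=1..<Suc n. (shr (\<alpha> - 2 / T) i - shr (\<alpha> - 1 / T) i) * (real n * (\<kappa> i * \<mu> i)\<^sup>2))"
  proof (intro sum_mono)
    fix i assume i: "i \<in> {1..<Suc n}"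
    have "\<alpha> - 2 / T + 1 / T = \<alpha> - 1 / T" by (simp add: algebra_simps add_divide_distrib[symmetric] diff_divide_distrib[symmetric])
    then have "2 * exp (-4) / T * sig \<alpha> i \<le> (shr (\<alpha> - 2 / T) i - shr (\<alpha> - 1 / T) i) * (real n * (\<kappa> i)\<^sup>2)"
      using shr_signal_ge[of i "\<alpha> - 2 / T"] i aT by simp
    from mult_right_mono[OF this, of "(\<mu> i)\<^sup>2"]
    show "(2 * exp (-4) / T * sig \<alpha> i) * (\<mu> i)\<^sup>2 \<le> (shr (\<alpha> - 2 / T) i - shr (\<alpha> - 1 / T) i) * (real n * (\<kappa> i * \<mu> i)\<^sup>2)"
      by (simp add: power_mult_distrib mult.assoc)
  qed
  also have "\<dots> \<le> signal_gain"
    unfolding signal_gain_def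
  proof (intro sum_mono2)
    have "n < n^20" using n_ge_3 power_strict_increasing[of 1 20 n] by simp
    then show "{1..<Suc n} \<subseteq> {1..<n^20}" by auto
    show "0 \<le> (shr (\<alpha> - 2 / T) i - shr (\<alpha> - 1 / T) i) * (real n * (\<kappa> i * \<mu> i)\<^sup>2)" if "i \<in> {1..<n^20} - {1..<Suc n}" for i
      using shr_diff_bounds[OF upper_shift_le, of i] that by auto
  qed auto
  finally show ?thesis .
qed

lemma lgt_sum_upper: "(\<Sum>i=1..<n^20. lgt (\<alpha> - 2 / T) i) \<le> signal_gain / 8"
proof -
  have "(\<Sum>i=1..<n^20. lgt (\<alpha> - 2 / T) i) \<le> 23 * C\<^sup>2 * (dimn (\<alpha> - 2 / T) * T)"
    using aT by (intro sum_lgt_le_dimn) auto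
  also have "\<dots> \<le> 23 * C\<^sup>2 * ((exp 4 * dimn \<alpha>) * T)"
    using aT T_gt_1 by (intro mult_left_mono mult_right_mono dimn_ratio) auto
  also have "\<dots> = (184 * C\<^sup>2 * exp 4 * (dimn \<alpha> * T)) / 8" by simp
  also have "\<dots> \<le> signal_gain / 8" using signal_gain_ge by (intro divide_right_mono) auto
  finally show ?thesis .
qed

lemma signal_gain_large: "signal_gain \<ge> 184 * T"
proof -
  have "1 * 1 * (1 * T) \<le> C\<^sup>2 * exp 4 * (dimn \<alpha> * T)"
    using C2_ge_1 T_gt_1 dimn_ge_1[OF upper_alpha_nonneg] by (intro mult_mono mult_nonneg_nonneg) auto
  then show ?thesis using signal_gain_ge by simp
qed

text \<open>The variance is at most (2 / 8 + 4) \<le> 5 times the signal, so Chebyshev gives 80 over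
  the signal. As the signal is at least 184 T even when \<open>dimn \<alpha>\<close> is bounded,
  this is below 1 / T.\<close>

lemma upper_event_prob: "measure (P0 n \<kappa> \<mu>) (- upper_event \<alpha>) \<le> 1 / T"
proof -
  let ?c = "\<lambda>i. shr (\<alpha> - 2 / T) i - shr (\<alpha> - 1 / T) i"
  have gain0: "signal_gain > 0" using signal_gain_large T_gt_1 by linarith
  have c: "0 \<le> ?c i \<and> ?c i \<le> 1" if "i \<ge> 1" for i using shr_diff_bounds[OF upper_shift_le that] .
  have "(\<Sum>i=1..<n^20. ?c i) \<le> (\<Sum>i=1..<n^20. lgt (\<alpha> - 2 / T) i)"
  proof (intro sum_mono)
    fix i assume "i \<in> {1..<n^20}"
    then show "?c i \<le> lgt (\<alpha> - 2 / T) i"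
      using shr_le_lgt[of i "\<alpha> - 2 / T"] shr_pos[of i "\<alpha> - 1 / T"] by simp
  qed
  then have 1: "(\<Sum>i=1..<n^20. ?c i) \<le> signal_gain / 8" using lgt_sum_upper by linarith
  have eq: "- upper_event \<alpha> = {Y. \<bar>\<Sum>i=1..<n^20. ?c i * xi Y i\<bar> \<ge> signal_gain / 4}"
    unfolding upper_event_def signal_gain_def by (auto simp: Let_def)
  have "measure (P0 n \<kappa> \<mu>) (- upper_event \<alpha>) \<le> (\<Sum>i=1..<n^20. (?c i)\<^sup>2 * (2 + 4 * real n * (\<kappa> i * \<mu> i)\<^sup>2)) / (signal_gain / 4)\<^sup>2"
    unfolding eq using n_ge_3 gain0 by (intro noise_sum_tail_prob) auto
  also have "\<dots> \<le> (5 * signal_gain) / (signal_gain / 4)\<^sup>2"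
  proof (intro divide_right_mono)
    show "(\<Sum>i=1..<n^20. (?c i)\<^sup>2 * (2 + 4 * real n * (\<kappa> i * \<mu> i)\<^sup>2)) \<le> 5 * signal_gain"
      using variance_sum_le[of ?c "n^20", OF c] 1 gain0 unfolding signal_gain_def[symmetric] by linarith
  qed simp
  also have "\<dots> = 80 / signal_gain" using gain0 by (simp add: power2_eq_square)
  also have "\<dots> \<le> 80 / (184 * T)" using signal_gain_large T_gt_1 gain0 by (intro divide_left_mono) auto
  also have "\<dots> \<le> 1 / T" using T_gt_1 by (simp add: field_simps)
  finally show ?thesis .
qed

text \<open>The quadratic loss from the reference point to \<open>b\<close> is at least the loss to
  \<open>\<alpha> - 1 / T\<close>, for all such \<open>b\<close> simultaneously, and
  \<open>lgt b\<close> is dropped as nonnegative. Of the signal, 1 - 1/4 - 1/8 = 5/8 survives noise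
  and logarithms.\<close>

lemma upper_step:
  assumes "Y \<in> tail_event (n^4)" "3 * block_const \<le> real (n^4)" "Y \<in> upper_event \<alpha>"
    and b: "\<alpha> - 1 / T \<le> b" "b \<le> T" and le: "\<alpha> - 2 / T \<le> T"
  shows "ell n \<kappa> Y b < ell n \<kappa> Y (\<alpha> - 2 / T)"
proof -
  let ?c = "\<lambda>i. shr (\<alpha> - 2 / T) i - shr (\<alpha> - 1 / T) i"
  have ev: "(\<Sum>i=1..<n^20. ?c i * xi Y i) \<ge> - (signal_gain / 4)"
    using assms(3) unfolding upper_event_def Let_def signal_gain_def by auto
  have c: "0 \<le> (\<Sum>i=1..<n^20. ?c i)"
    using shr_diff_bounds[OF upper_shift_le] by (intro sum_nonneg) auto
  have "5/8 * signal_gain \<le> (\<Sum>i=1..<n^20. ?c i) + (\<Sum>i=1..<n^20. ?c i * xi Y i) + signal_gain - (\<Sum>i=1..<n^20. lgt (\<alpha> - 2 / T) i)"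
    using lgt_sum_upper ev c by linarith
  also have "\<dots> = (\<Sum>i=1..<n^20. ?c i * (real n * (Y i)\<^sup>2) - lgt (\<alpha> - 2 / T) i)"
    unfolding signal_gain_def square_obs sum.distrib[symmetric] sum_subtractf[symmetric]
    by (intro sum.cong refl) (simp add: algebra_simps)
  also have "\<dots> \<le> (\<Sum>i=1..<n^20. lik b Y i - lik (\<alpha> - 2 / T) Y i)"
  proof (intro sum_mono)
    fix i assume "i \<in> {1..<n^20}"
    then have i: "i \<ge> 1" by simp
    have "?c i * (real n * (Y i)\<^sup>2) \<le> (shr (\<alpha> - 2 / T) i - shr b i) * (real n * (Y i)\<^sup>2)"
      using shr_antimono[OF i b(1)] by (intro mult_right_mono) auto
    then show "?c i * (real n * (Y i)\<^sup>2) - lgt (\<alpha> - 2 / T) i \<le> lik b Y i - lik (\<alpha> - 2 / T) Y i"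
      using lgt_nonneg[OF i, of b] unfolding lik_def by (simp add: left_diff_distrib)
  qed
  finally have 1: "5/8 * signal_gain \<le> (\<Sum>i=1..<n^20. lik b Y i - lik (\<alpha> - 2 / T) Y i)" .
  have "(\<Sum>i=1..<n^20. lik b Y i - lik (\<alpha> - 2 / T) Y i) - 2 \<le> 2 * (ell n \<kappa> Y (\<alpha> - 2 / T) - ell n \<kappa> Y b)"
    using aT b le upper_shift_le by (intro ell_diff_ge assms) auto
  moreover have "signal_gain > 184" using signal_gain_large T_gt_1 by linarith
  ultimately have "0 < 2 * (ell n \<kappa> Y (\<alpha> - 2 / T) - ell n \<kappa> Y b)" using 1 by linarith
  then show ?thesis by simp
qed

end

section \<open>The coverage theorem\<close>

lemma lower_event_sets: "lower_event \<alpha> \<in> sets (P0 n \<kappa> \<mu>)"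
  unfolding lower_event_def Let_def by (rule noise_sum_sets)

lemma upper_event_sets: "upper_event \<alpha> \<in> sets (P0 n \<kappa> \<mu>)"
  unfolding upper_event_def Let_def by (rule noise_sum_sets)

text \<open>All requirements on the size of n are collected in \<open>n1\<close> to
  \<open>n7\<close>, none of which mentions \<open>\<mu>\<close>; this is what makes the final
  choice of n uniform over the ball. The three error terms belong to the tail event, the grid and
  the upper crossing.\<close>

lemma good_event_prob:
  fixes l L q :: real
  defines "q \<equiv> 7 + 2 * p" and "l \<equiv> c1 / (160 * cs * exp 4)"
  assumes L: "L \<ge> 184 * C\<^sup>2 * exp 8 * (5 + 2 * p)" "l \<le> L"
    and n1: "3 * (726 * (real n)\<^sup>2 * C^4 * (1 + real n * C\<^sup>2 * R\<^sup>2)) \<le> real n ^ 4"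
    and n2: "920 * C\<^sup>2 * exp 4 / T \<le> c1 / (4 * (q * sqrt T))"
    and n3: "2 < c1 * exp (sqrt T / q) / (4 * (q * sqrt T))" "4 \<le> exp (sqrt T / q)"
    and n4: "sqrt T + 2 / T \<le> T"
    and n5: "4 / T \<le> \<beta>"
    and n6: "(1 + \<beta> + 2 * p) * C^4 * R\<^sup>2 / (\<beta> * T) \<le> l"
    and n7: "C^4 * R\<^sup>2 / (2 * \<beta>) \<le> L * T\<^sup>2 / (2 * (5 + 2 * p))"
  shows "\<exists>A\<in>sets (P0 n \<kappa> \<mu>). A \<subseteq> good_event n p \<kappa> \<mu> l L \<and> measure (P0 n \<kappa> \<mu>) A \<ge>
    1 - (496 * C^4 * (1 + real n * C\<^sup>2 * R\<^sup>2) / real n ^ 4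
      + 2 * T^4 * (3008 * C\<^sup>2 * exp 4 / c1\<^sup>2 * (T * (q * sqrt T)\<^sup>2 / exp (sqrt T / q))) + 1 / T)"
proof -
  interpret prob_space "P0 n \<kappa> \<mu>" using n_ge_3 by (intro prob_space_P0) auto
  have Mle: "3 * block_const \<le> real (n^4)" using n1 by (simp add: block_const_def signal_bound_def)
  have q: "q \<ge> 7" using p_nonneg by (simp add: q_def)
  have sT: "sqrt T \<ge> 1" "sqrt T \<le> T" "sqrt T * sqrt T = T"
  proof -
    show "sqrt T \<ge> 1" "sqrt T * sqrt T = T" using T_gt_1 by auto
    then show "sqrt T \<le> T" using mult_left_mono[of 1 "sqrt T" "sqrt T"] by simp
  qed
  have T3: "T ^ 3 > 0" "1 / T ^ 3 \<le> 1 / T"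
  proof -
    have "T ^ 1 \<le> T ^ 3" using T_gt_1 by (intro power_increasing) auto
    then show "T ^ 3 > 0" "1 / T ^ 3 \<le> 1 / T" using T_gt_1 by (auto intro!: divide_left_mono)
  qed
  have smooth: "h y \<le> l" if "0 \<le> y" "2 * y \<le> \<beta>" for y
    using hn_le_smooth[OF that] n6 by linarith

  \<comment> \<open>Only grid points with \<open>h \<le> l\<close> are kept, since the deviation
    bound of \<open>lower_event\<close> relies on it. The set depends on \<open>\<mu>\<close> but
    not on \<open>Y\<close>, so the union bound applies.\<close>
  define J where "J = {j \<in> {..nat \<lfloor>sqrt T * T ^ 3\<rfloor>}. h (real j / T ^ 3) \<le> l}"
  have grid: "real j / T ^ 3 \<le> sqrt T" if "j \<in> J" for j
  proof -
    have "real j \<le> sqrt T * T ^ 3" using that sT T3 by (auto simp: J_def le_nat_iff le_floor_iff)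
    then show ?thesis using T3 by (simp add: divide_le_eq)
  qed
  have next_facts: "expo \<alpha>' \<le> q * sqrt T" "exp (sqrt T / q) \<le> dimn \<alpha>'" "\<alpha>' \<le> T" "expo \<alpha>' \<ge> 1"
    if "0 \<le> \<alpha>" "\<alpha> \<le> sqrt T" "\<alpha>' = \<alpha> + (1 / T ^ 3 + 1 / T)" for \<alpha> \<alpha>'
  proof -
    have a': "\<alpha>' \<le> sqrt T + 2 / T" "\<alpha>' \<ge> 0" using that T3 T_gt_1 by auto
    then show "\<alpha>' \<le> T" using n4 by linarith
    show e1: "expo \<alpha>' \<ge> 1" by (rule expo_ge_1[OF a'(2)])
    have "2 / T \<le> 2 / 1" using T_gt_1 by (intro divide_left_mono) auto
    then have "expo \<alpha>' \<le> 2 * sqrt T + (5 + 2 * p) * 1" using a' by (simp add: expo_def)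
    also have "\<dots> \<le> 2 * sqrt T + (5 + 2 * p) * sqrt T"
      using sT p_nonneg by (intro add_mono mult_left_mono) auto
    finally show e: "expo \<alpha>' \<le> q * sqrt T" by (simp add: q_def algebra_simps)
    have "sqrt T / q = T / (q * sqrt T)" using sT q by (simp add: field_simps)
    also have "\<dots> \<le> T / expo \<alpha>'" using e e1 T_gt_1 by (intro divide_left_mono) auto
    finally show "exp (sqrt T / q) \<le> dimn \<alpha>'" by (simp add: dimn_exp)
  qed

  define S where "S = {y. y > 0 \<and> h y > L * T\<^sup>2}"
  \<comment> \<open>The infimum of \<open>S\<close> need not belong to \<open>S\<close>, so a point
    within 1 / T above it is used; the reference point is moved a further 1 / T to the left for this
    reason.\<close>
  define as where "as = (SOME y. y \<in> S \<and> y < Inf S + 1 / T)"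
  \<comment> \<open>If \<open>S\<close> has no point below \<open>T\<close>, the upper bound is at
    least \<open>T\<close> and no maximiser can exceed it, so no event is required.\<close>
  define U where "U = (if \<exists>y\<in>S. y < T then upper_event as else UNIV)"
  have S_bdd: "bdd_below S" unfolding S_def by (rule bdd_belowI[of _ 0]) auto
  have as: "as \<in> S" "as < Inf S + 1 / T" "2 / T \<le> as" "as \<le> T + 1 / T" "as \<le> T + 1" "h as > L * T\<^sup>2"
    if y: "y \<in> S" "y < T" for y
  proof -
    have "\<exists>y. y \<in> S \<and> y < Inf S + 1 / T"
      using cInf_lessD[of S "Inf S + 1 / T"] y T_gt_1 by auto
    from someI_ex[OF this] show as: "as \<in> S" "as < Inf S + 1 / T" by (auto simp: as_def)
    then show h: "h as > L * T\<^sup>2" by (simp add: S_def)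
    have "Inf S \<le> y" by (rule cInf_lower[OF y(1) S_bdd])
    then show "as \<le> T + 1 / T" using as y by linarith
    moreover have "1 / T \<le> 1" using T_gt_1 by simp
    ultimately show "as \<le> T + 1" by linarith
    \<comment> \<open>Below 2 / T smoothness would force \<open>h as \<le> l\<close>, contradicting
      \<open>h as > L * T\<^sup>2\<close>. Hence the reference point \<open>as - 2 / T\<close> is a
      legitimate competitor in [0, T].\<close>
    show "2 / T \<le> as"
    proof (rule ccontr)
      assume "\<not> 2 / T \<le> as"
      then have "2 * as \<le> \<beta>" using n5 by (simp add: field_simps)
      then have "h as \<le> l" using as by (intro smooth) (auto simp: S_def)
      moreover have "l \<ge> 0" using gain_const_bounds(1)[of C] signal_const_pos[of C] by (simp add: l_def)
      then have "L * 1 \<le> L * T\<^sup>2" using L T_gt_1 by (intro mult_left_mono one_le_power) auto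
      ultimately show False using h L by linarith
    qed
  qed

  define A where "A = tail_event (n^4) \<inter> ((\<Inter>j\<in>J. lower_event (real j / T ^ 3)) \<inter> U)"
  have finJ: "finite J" by (simp add: J_def)
  have U_sets: "U \<in> events" using sets.top[of "P0 n \<kappa> \<mu>"] upper_event_sets by (auto simp: U_def space_P0)
  have low_sets: "- lower_event \<alpha> \<in> events" for \<alpha>
    using sets.compl_sets[OF lower_event_sets[of \<alpha>]] by (simp add: space_P0 Compl_eq_Diff_UNIV)
  have cA: "- A = - tail_event (n^4) \<union> ((\<Union>j\<in>J. - lower_event (real j / T ^ 3)) \<union> - U)"
    unfolding A_def by auto
  have sets: "- tail_event (n^4) \<in> events" "- U \<in> events" "(\<Union>j\<in>J. - lower_event (real j / T ^ 3)) \<in> events"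
    using sets.compl_sets[OF tail_event_sets[of "n^4"]] sets.compl_sets[OF U_sets]
      sets.finite_UN[OF finJ low_sets]
    by (simp_all add: space_P0 Compl_eq_Diff_UNIV)
  have cA_sets: "- A \<in> events" unfolding cA using sets by auto
  have A_sets: "A \<in> events"
    using sets.compl_sets[OF cA_sets] by (simp add: space_P0 Compl_eq_Diff_UNIV[symmetric])

  have p1: "prob (- tail_event (n^4)) \<le> 496 * C^4 * (1 + real n * C\<^sup>2 * R\<^sup>2) / real n ^ 4"
    using tail_event_prob[of "n^4"] prob_compl[OF tail_event_sets[of "n^4"]] n_ge_3
    by (simp add: space_P0 Compl_eq_Diff_UNIV signal_bound_def)
  define B where "B = 3008 * C\<^sup>2 * exp 4 / c1\<^sup>2 * (T * (q * sqrt T)\<^sup>2 / exp (sqrt T / q))"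
  have B0: "B \<ge> 0" unfolding B_def using T_gt_1 by (intro mult_nonneg_nonneg divide_nonneg_nonneg) auto
  have p2: "prob (\<Union>j\<in>J. - lower_event (real j / T ^ 3)) \<le> 2 * T^4 * B"
  proof -
    have "prob (\<Union>j\<in>J. - lower_event (real j / T ^ 3)) \<le> (\<Sum>j\<in>J. prob (- lower_event (real j / T ^ 3)))"
      by (intro measure_UNION_le finJ low_sets)
    also have "\<dots> \<le> real (card J) * B"
    proof (rule sum_bounded_above)
      fix j assume j: "j \<in> J"
      define \<alpha> \<alpha>' where "\<alpha> = real j / T ^ 3" and "\<alpha>' = \<alpha> + (1 / T ^ 3 + 1 / T)"
      have a: "0 \<le> \<alpha>" "\<alpha> \<le> sqrt T" "h \<alpha> \<le> c1 / (160 * cs * exp 4)"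
        using grid[OF j] T3 j by (auto simp: \<alpha>_def J_def l_def)
      note nf = next_facts[OF a(1,2) \<alpha>'_def]
      have "prob (- lower_event \<alpha>) \<le> 3008 * C\<^sup>2 * exp 4 / c1\<^sup>2 * (T * (expo \<alpha>')\<^sup>2 / dimn \<alpha>')"
        by (rule lower_event_prob[OF a(1) \<alpha>'_def a(3)])
      also have "\<dots> \<le> B"
        unfolding B_def using nf T_gt_1
        by (intro mult_left_mono frac_le power_mono divide_nonneg_nonneg mult_nonneg_nonneg) auto
      finally show "prob (- lower_event (real j / T ^ 3)) \<le> B" by (simp add: \<alpha>_def)
    qed
    also have "\<dots> \<le> (2 * T^4) * B"
    proof (intro mult_right_mono B0)
      have "card J \<le> card {..nat \<lfloor>sqrt T * T ^ 3\<rfloor>}" unfolding J_def by (intro card_mono) auto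
      then have "real (card J) \<le> real (nat \<lfloor>sqrt T * T ^ 3\<rfloor>) + 1" by simp
      also have "real (nat \<lfloor>sqrt T * T ^ 3\<rfloor>) \<le> sqrt T * T ^ 3" using sT T3 by simp
      also have "\<dots> \<le> T * T ^ 3" using sT T3 by (intro mult_right_mono) auto
      also have "\<dots> = T ^ 4" by (simp add: eval_nat_numeral)
      finally have "real (card J) \<le> T ^ 4 + 1" by simp
      moreover have "1 \<le> T ^ 4" using T_gt_1 by (intro one_le_power) auto
      ultimately show "real (card J) \<le> 2 * T ^ 4" by linarith
    qed
    finally show ?thesis .
  qed
  have p3: "prob (- U) \<le> 1 / T"
  proof (cases "\<exists>y\<in>S. y < T")
    case True
    then obtain y where y: "y \<in> S" "y < T" by auto
    have "prob (- upper_event as) \<le> 1 / T"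
      by (rule upper_event_prob[OF as(3)[OF y] as(5)[OF y] as(6)[OF y] L(1) n7])
    then show ?thesis using True by (simp add: U_def)
  next
    case False
    then show ?thesis using T_gt_1 by (simp add: U_def)
  qed
  have "prob (- A) \<le> prob (- tail_event (n^4)) + (prob (\<Union>j\<in>J. - lower_event (real j / T ^ 3)) + prob (- U))"
    unfolding cA using sets by (intro order_trans[OF measure_Un_le] add_left_mono measure_Un_le) auto
  then have "prob (- A) \<le> 496 * C^4 * (1 + real n * C\<^sup>2 * R\<^sup>2) / real n ^ 4 + 2 * T^4 * B + 1 / T"
    using p1 p2 p3 by linarith
  moreover have "prob (- A) = 1 - prob A"
    using prob_compl[OF A_sets] by (simp add: space_P0 Compl_eq_Diff_UNIV)
  ultimately have probA: "prob A \<ge> 1 - (496 * C^4 * (1 + real n * C\<^sup>2 * R\<^sup>2) / real n ^ 4 + 2 * T^4 * B + 1 / T)"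
    by linarith

  have "A \<subseteq> good_event n p \<kappa> \<mu> l L"
  proof
    fix Y assume "Y \<in> A"
    then have Y: "Y \<in> tail_event (n^4)" "\<And>j. j \<in> J \<Longrightarrow> Y \<in> lower_event (real j / T ^ 3)" "Y \<in> U"
      by (auto simp: A_def)
    have "\<exists>a\<in>{0..T}. \<forall>b\<in>{0..T}. ell n \<kappa> Y b \<le> ell n \<kappa> Y a"
      using T_gt_1 n_ge_3 by (intro continuous_attains_sup ell_continuous[OF Y(1)]) auto
    then have ex: "\<exists>a. is_argmax_ell n \<kappa> Y a" by (auto simp: is_argmax_ell_def)
    have "alpha_low n p \<kappa> \<mu> l \<le> ereal a \<and> ereal a \<le> alpha_up n p \<kappa> \<mu> L" if am: "is_argmax_ell n \<kappa> Y a" for a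
    proof
      have aT: "0 \<le> a" "a \<le> T" and max: "\<And>b. b \<in> {0..T} \<Longrightarrow> ell n \<kappa> Y b \<le> ell n \<kappa> Y a"
        using am by (auto simp: is_argmax_ell_def)
      show "alpha_low n p \<kappa> \<mu> l \<le> ereal a"
      proof (rule ccontr)
        assume "\<not> alpha_low n p \<kappa> \<mu> l \<le> ereal a"
        then have lt: "ereal a < Inf (ereal ` {\<alpha>. \<alpha> > 0 \<and> h \<alpha> > l})" "a < sqrt T"
          by (auto simp: alpha_low_def not_le)
        \<comment> \<open>The left end of the grid cell containing the supposed maximiser
          \<open>a\<close>.\<close>
        define j where "j = nat \<lfloor>a * T ^ 3\<rfloor>"
        define \<alpha> \<alpha>' where "\<alpha> = real j / T ^ 3" and "\<alpha>' = \<alpha> + (1 / T ^ 3 + 1 / T)"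
        have "real j \<le> a * T ^ 3" "a * T ^ 3 \<le> real j + 1"
          using aT T3 mult_nonneg_nonneg[of a "T ^ 3"] unfolding j_def by linarith+
        then have a: "0 \<le> \<alpha>" "\<alpha> \<le> a" "a \<le> \<alpha> + 1 / T ^ 3"
          using T3 by (auto simp: \<alpha>_def field_simps)
        have hl: "h \<alpha> \<le> l"
        \<comment> \<open>The infimum ranges over positive arguments and gives no information at 0,
          where smoothness is used instead.\<close>
        proof (cases "\<alpha> = 0")
          case True
          then show ?thesis using beta_pos by (intro smooth) auto
        next
          case False
          show ?thesis
          proof (rule ccontr)
            assume "\<not> h \<alpha> \<le> l"
            then have "Inf (ereal ` {\<alpha>. \<alpha> > 0 \<and> h \<alpha> > l}) \<le> ereal \<alpha>"
              using a False by (intro Inf_lower) auto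
            then have "ereal a < ereal \<alpha>" using lt(1) by (rule less_le_trans[rotated])
            then show False using a by simp
          qed
        qed
        have "a * T ^ 3 \<le> sqrt T * T ^ 3" using lt T3 by (intro mult_right_mono) auto
        then have "j \<in> J" using hl unfolding J_def j_def \<alpha>_def by (auto intro!: nat_mono floor_mono)
        note nf = next_facts[OF a(1) order_trans[OF a(2) less_imp_le[OF lt(2)]] \<alpha>'_def]
        have "ell n \<kappa> Y a < ell n \<kappa> Y \<alpha>'"
        proof (rule lower_step[OF a(1) \<alpha>'_def hl[unfolded l_def] Y(1) Mle _ nf(3) _ _ _ a(2,3)])
          show "Y \<in> lower_event \<alpha>" using Y(2)[OF \<open>j \<in> J\<close>] by (simp add: \<alpha>_def)
          show "4 \<le> dimn \<alpha>'" using n3 nf by linarith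
          have "c1 / (4 * (q * sqrt T)) \<le> c1 / (4 * expo \<alpha>')"
            using nf gain_const_bounds(1)[of C] q sT by (intro divide_left_mono mult_left_mono mult_pos_pos) auto
          then show "920 * C\<^sup>2 * exp 4 / T \<le> c1 / (4 * expo \<alpha>')" using n2 by linarith
          have "c1 * exp (sqrt T / q) / (4 * (q * sqrt T)) \<le> c1 * dimn \<alpha>' / (4 * expo \<alpha>')"
            using nf gain_const_bounds(1)[of C] dimn_pos[of \<alpha>'] by (intro frac_le mult_left_mono) auto
          then show "2 < c1 * dimn \<alpha>' / (4 * expo \<alpha>')" using n3 by linarith
        qed
        moreover have "\<alpha>' \<in> {0..T}" using nf a T3 T_gt_1 by (auto simp: \<alpha>'_def)
        ultimately show False using max[of \<alpha>'] by simp
      qed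
      show "ereal a \<le> alpha_up n p \<kappa> \<mu> L"
      proof (rule ccontr)
        assume "\<not> ereal a \<le> alpha_up n p \<kappa> \<mu> L"
        then have "Inf (ereal ` S) < ereal a" by (simp add: alpha_up_def S_def)
        then obtain y where y: "y \<in> S" "y < a" by (auto simp: Inf_less_iff)
        then have yT: "y < T" using aT by simp
        have "Inf S \<le> y" by (rule cInf_lower[OF y(1) S_bdd])
        then have b: "as - 1 / T \<le> a" using as(2)[OF y(1) yT] y by linarith
        have le: "as - 2 / T \<le> T"
        proof -
          have "1 / T \<le> 2 / T" using T_gt_1 by (intro divide_right_mono) auto
          then show ?thesis using as(4)[OF y(1) yT] by linarith
        qed
        have "Y \<in> upper_event as" using Y(3) y yT by (auto simp: U_def split: if_splits)
        then have "ell n \<kappa> Y a < ell n \<kappa> Y (as - 2 / T)"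
          using as[OF y(1) yT] L n7 Y(1) Mle b aT le by (intro upper_step) auto
        moreover have "as - 2 / T \<in> {0..T}" using le as(3)[OF y(1) yT] by auto
        ultimately show False using max[of "as - 2 / T"] by simp
      qed
    qed
    then show "Y \<in> good_event n p \<kappa> \<mu> l L" using ex by (auto simp: good_event_def)
  qed
  then show ?thesis using A_sets probA unfolding B_def by blast
qed

end

text \<open>\<open>l\<close> and \<open>L\<close> are built from \<open>C\<close> and
  \<open>p\<close>, while \<open>R\<close> and \<open>\<beta>\<close> determine how large n must be.
  The summand \<open>l\<close> in \<open>L\<close> ensures \<open>l < L\<close>.\<close>

lemma unif_prob_sobolev:
  fixes \<kappa> :: "nat \<Rightarrow> real" and p C \<beta> R :: real
  assumes p: "p \<ge> 0" and C: "C \<ge> 1"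
    and kappa: "\<And>i. i \<ge> 1 \<Longrightarrow> inverse C * real i powr (-p) \<le> \<kappa> i \<and> \<kappa> i \<le> C * real i powr (-p)"
    and \<beta>: "\<beta> > 0" and R: "R > 0"
  shows "\<exists>l L. 0 < l \<and> l < L \<and> unif_prob_to_one p \<kappa> (sobolev_ball \<beta> R) l L"
proof -
  define c1 where "c1 = gain_const C"
  define q where "q = 7 + 2 * p"
  define q5 where "q5 = 5 + 2 * p"
  define l where "l = c1 / (160 * signal_const C * exp 4)"
  define L where "L = 184 * C\<^sup>2 * exp 8 * q5 + l"
  have c1: "c1 > 0" using gain_const_bounds(1) by (simp add: c1_def)
  have l: "l > 0" using c1 signal_const_pos[of C] by (simp add: l_def)
  have q: "q > 0" "q5 > 0" "C > 0" using p C by (auto simp: q_def q5_def)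
  have lL: "l < L" using q by (simp add: L_def)
  have L0: "L > 0" using l lL by linarith
  have "unif_prob_to_one p \<kappa> (sobolev_ball \<beta> R) l L"
    unfolding unif_prob_to_one_def
  proof (intro allI impI)
    fix \<epsilon> :: real assume \<epsilon>: "\<epsilon> > 0"
    define D1 D2 D3 where "D1 = 920 * C\<^sup>2 * exp 4" and "D2 = 3008 * C\<^sup>2 * exp 4 / c1\<^sup>2"
      and "D3 = (1 + \<beta> + 2 * p) * C^4 * R\<^sup>2"
    have D: "D1 > 0" "D2 > 0" "D3 > 0" using p q c1 \<beta> R by (auto simp: D1_def D2_def D3_def intro!: mult_pos_pos add_pos_nonneg)
    have e1: "\<forall>\<^sub>F n::nat in at_top. 3 * (726 * (real n)\<^sup>2 * C^4 * (1 + real n * C\<^sup>2 * R\<^sup>2)) \<le> real n ^ 4"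
      using q R by real_asymp
    have e2: "\<forall>\<^sub>F n::nat in at_top. D1 / ln (real n) \<le> c1 / (4 * (q * sqrt (ln (real n))))"
      using D q c1 by real_asymp
    have e3: "\<forall>\<^sub>F n::nat in at_top. 2 < c1 * exp (sqrt (ln (real n)) / q) / (4 * (q * sqrt (ln (real n))))"
      using q c1 by real_asymp
    have e3': "\<forall>\<^sub>F n::nat in at_top. 4 \<le> exp (sqrt (ln (real n)) / q)"
      using q by real_asymp
    have e4: "\<forall>\<^sub>F n::nat in at_top. sqrt (ln (real n)) + 2 / ln (real n) \<le> ln (real n)"
      by real_asymp
    have e5: "\<forall>\<^sub>F n::nat in at_top. 4 / ln (real n) \<le> \<beta>"
      using \<beta> by real_asymp
    have e6: "\<forall>\<^sub>F n::nat in at_top. D3 / (\<beta> * ln (real n)) \<le> l"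
      using D \<beta> l by real_asymp
    have e7: "\<forall>\<^sub>F n::nat in at_top. C^4 * R\<^sup>2 / (2 * \<beta>) \<le> L * (ln (real n))\<^sup>2 / (2 * q5)"
      using q R \<beta> L0 by real_asymp
    \<comment> \<open>With T = ln n, the three terms are of order n^-3, T^6 * exp (- sqrt T / q) and
      1 / T.\<close>
    have "((\<lambda>n::nat. 496 * C^4 * (1 + real n * C\<^sup>2 * R\<^sup>2) / real n ^ 4
      + 2 * (ln (real n))^4 * (D2 * (ln (real n) * (q * sqrt (ln (real n)))\<^sup>2 / exp (sqrt (ln (real n)) / q))) + 1 / ln (real n)) \<longlongrightarrow> 0) at_top"
      using q R D by real_asymp
    from order_tendstoD(2)[OF this \<epsilon>]
    have e8: "\<forall>\<^sub>F n::nat in at_top. 496 * C^4 * (1 + real n * C\<^sup>2 * R\<^sup>2) / real n ^ 4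
      + 2 * (ln (real n))^4 * (D2 * (ln (real n) * (q * sqrt (ln (real n)))\<^sup>2 / exp (sqrt (ln (real n)) / q))) + 1 / ln (real n) < \<epsilon>" .
    have "\<forall>\<^sub>F n::nat in at_top. \<forall>\<mu>\<in>sobolev_ball \<beta> R. \<exists>A\<in>sets (P0 n \<kappa> \<mu>).
        A \<subseteq> good_event n p \<kappa> \<mu> l L \<and> measure (P0 n \<kappa> \<mu>) A \<ge> 1 - \<epsilon>"
      using e1 e2 e3 e3' e4 e5 e6 e7 e8 eventually_ge_at_top[of "3::nat"]
    proof eventually_elim
      case (elim n)
      show ?case
      proof
        fix \<mu> assume \<mu>: "\<mu> \<in> sobolev_ball \<beta> R"
        interpret sobolev_model \<kappa> p C n \<mu> \<beta> R
          by unfold_locales (use p C kappa elim \<beta> \<mu> in auto)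
        have L1: "184 * C\<^sup>2 * exp 8 * (5 + 2 * p) \<le> L" using l by (simp add: L_def q5_def)
        have "\<exists>A\<in>sets (P0 n \<kappa> \<mu>). A \<subseteq> good_event n p \<kappa> \<mu> l L \<and> measure (P0 n \<kappa> \<mu>) A \<ge>
          1 - (496 * C^4 * (1 + real n * C\<^sup>2 * R\<^sup>2) / real n ^ 4
            + 2 * (ln (real n))^4 * (D2 * (ln (real n) * (q * sqrt (ln (real n)))\<^sup>2 / exp (sqrt (ln (real n)) / q))) + 1 / ln (real n))"
          using L1 less_imp_le[OF lL] elim(1-8)
          unfolding q_def q5_def l_def D1_def D2_def D3_def c1_def by (rule good_event_prob)
        then obtain A where "A \<in> sets (P0 n \<kappa> \<mu>)" "A \<subseteq> good_event n p \<kappa> \<mu> l L"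
          "measure (P0 n \<kappa> \<mu>) A \<ge> 1 - (496 * C^4 * (1 + real n * C\<^sup>2 * R\<^sup>2) / real n ^ 4
            + 2 * (ln (real n))^4 * (D2 * (ln (real n) * (q * sqrt (ln (real n)))\<^sup>2 / exp (sqrt (ln (real n)) / q))) + 1 / ln (real n))"
          by (elim bexE conjE)
        then show "\<exists>A\<in>sets (P0 n \<kappa> \<mu>). A \<subseteq> good_event n p \<kappa> \<mu> l L \<and> measure (P0 n \<kappa> \<mu>) A \<ge> 1 - \<epsilon>"
          using elim(9) by (intro bexI[of _ A] conjI) linarith+
      qed
    qed
    then show "\<exists>N. \<forall>n\<ge>N. \<forall>\<mu>\<in>sobolev_ball \<beta> R. \<exists>A\<in>sets (P0 n \<kappa> \<mu>).
        A \<subseteq> good_event n p \<kappa> \<mu> l L \<and> measure (P0 n \<kappa> \<mu>) A \<ge> 1 - \<epsilon>"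
      unfolding eventually_sequentially .
  qed
  then show ?thesis using l lL by blast
qed

lemma unif_prob_to_one_mono:
  assumes "unif_prob_to_one p \<kappa> B l L" "B' \<subseteq> B"
  shows "unif_prob_to_one p \<kappa> B' l L"
  unfolding unif_prob_to_one_def
proof (intro allI impI)
  fix \<epsilon> :: real assume e: "\<epsilon> > 0"
  obtain N where N: "\<forall>n\<ge>N. \<forall>\<mu>\<in>B. \<exists>A\<in>sets (P0 n \<kappa> \<mu>).
      A \<subseteq> good_event n p \<kappa> \<mu> l L \<and> measure (P0 n \<kappa> \<mu>) A \<ge> 1 - \<epsilon>"
    using assms(1)[unfolded unif_prob_to_one_def, THEN spec, THEN mp, OF e] by (elim exE)
  show "\<exists>N. \<forall>n\<ge>N. \<forall>\<mu>\<in>B'. \<exists>A\<in>sets (P0 n \<kappa> \<mu>).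
      A \<subseteq> good_event n p \<kappa> \<mu> l L \<and> measure (P0 n \<kappa> \<mu>) A \<ge> 1 - \<epsilon>"
    by (intro exI[of _ N] allI impI ballI) (use N assms(2) in \<open>simp add: subset_iff\<close>)
qed

text \<open>Squaring \<gamma> i \<le> exp (\<gamma> i) gives i^2 \<le> exp (2 \<gamma> i) /
  \<gamma>^2, so order one is reached with radius R / \<gamma>.\<close>

lemma analytic_ball_subset_sobolev_ball:
  assumes "\<gamma> > 0"
  shows "analytic_ball \<gamma> R \<subseteq> sobolev_ball 1 (R / \<gamma>)"
proof
  fix \<mu> assume mu: "\<mu> \<in> analytic_ball \<gamma> R"
  let ?f = "\<lambda>k. exp (2*\<gamma>*real (Suc k)) * (\<mu> (Suc k))\<^sup>2"
  let ?g = "\<lambda>k. real (Suc k) powr (2*1) * (\<mu> (Suc k))\<^sup>2"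
  have f: "summable ?f" "sqrt (\<Sum>k. ?f k) \<le> R" "\<mu> \<in> l2" using mu by (auto simp: analytic_ball_def)
  have le: "?g k \<le> (1 / \<gamma>\<^sup>2) * ?f k" for k
  proof -
    have "\<gamma> * real (Suc k) \<le> exp (\<gamma> * real (Suc k))"
      using exp_ge_add_one_self[of "\<gamma> * real (Suc k)"] by linarith
    then have "(\<gamma> * real (Suc k))\<^sup>2 \<le> (exp (\<gamma> * real (Suc k)))\<^sup>2"
      using assms by (intro power_mono) auto
    also have "\<dots> = exp (2*\<gamma>*real (Suc k))" by (simp add: exp_double[symmetric] mult.assoc)
    finally have "(real (Suc k))\<^sup>2 \<le> (1 / \<gamma>\<^sup>2) * exp (2*\<gamma>*real (Suc k))"
      using assms unfolding power_mult_distrib by (simp add: divide_simps mult.commute)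
    then have "(real (Suc k))\<^sup>2 * (\<mu> (Suc k))\<^sup>2 \<le> (1 / \<gamma>\<^sup>2) * exp (2*\<gamma>*real (Suc k)) * (\<mu> (Suc k))\<^sup>2"
      by (intro mult_right_mono) auto
    then show ?thesis by (simp add: mult.assoc)
  qed
  have g: "summable ?g"
    using le by (intro summable_comparison_test'[OF summable_mult[OF f(1), of "1 / \<gamma>\<^sup>2"], of 0]) auto
  have "(\<Sum>k. ?g k) \<le> (\<Sum>k. (1 / \<gamma>\<^sup>2) * ?f k)"
    by (intro suminf_le le g summable_mult f)
  also have "\<dots> = (1 / \<gamma>\<^sup>2) * (\<Sum>k. ?f k)" by (intro suminf_mult f)
  finally have "sqrt (\<Sum>k. ?g k) \<le> sqrt ((1 / \<gamma>\<^sup>2) * (\<Sum>k. ?f k))" by simp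
  also have "\<dots> = sqrt (\<Sum>k. ?f k) / \<gamma>" using assms by (simp add: real_sqrt_divide)
  also have "\<dots> \<le> R / \<gamma>" using f assms by (intro divide_right_mono) auto
  finally show "\<mu> \<in> sobolev_ball 1 (R / \<gamma>)" using f g by (simp add: sobolev_ball_def)
qed

theorem theorem2p1:
  fixes \<kappa> :: "nat \<Rightarrow> real" and p C \<beta> \<gamma> :: real
  assumes "p \<ge> 0" and "C \<ge> 1"
    and "\<And>i. i \<ge> 1 \<Longrightarrow> inverse C * real i powr (-p) \<le> \<kappa> i \<and> \<kappa> i \<le> C * real i powr (-p)"
    and "\<beta> > 0" and "\<gamma> > 0"
  shows "(\<forall>R>0. \<exists>l L. 0 < l \<and> l < L \<and> unif_prob_to_one p \<kappa> (sobolev_ball \<beta> R) l L)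
       \<and> (\<forall>R>0. \<exists>l L. 0 < l \<and> l < L \<and> unif_prob_to_one p \<kappa> (analytic_ball \<gamma> R) l L)"
proof (intro conjI allI impI)
  fix R :: real assume R: "R > 0"
  show "\<exists>l L. 0 < l \<and> l < L \<and> unif_prob_to_one p \<kappa> (sobolev_ball \<beta> R) l L"
    by (rule unif_prob_sobolev[OF assms(1-4) R])
  have "R / \<gamma> > 0" using R assms(5) by simp
  from unif_prob_sobolev[OF assms(1-3) zero_less_one this]
  obtain l L where "0 < l" "l < L" "unif_prob_to_one p \<kappa> (sobolev_ball 1 (R / \<gamma>)) l L" by blast
  then show "\<exists>l L. 0 < l \<and> l < L \<and> unif_prob_to_one p \<kappa> (analytic_ball \<gamma> R) l L"
    using unif_prob_to_one_mono[OF _ analytic_ball_subset_sobolev_ball[OF assms(5)]] by blast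
qed

end
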